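(* Let $V_0\in H^s(\mathbb T^3)$, $s>5/2$, with horizontal average $\underline{V_0}$ and $\widetilde V_0=V_0-\underline{V_0}$. Let $U$ be the solution of the limit system obtained as a limit point, as $\varepsilon\to0$, of the filtered solutions $(U^\varepsilon)_{\varepsilon>0}$ with initial datum $V_0$ (see context). Then the horizontal average $\underline U=(\underline u^h,0,\underline U^4)$ of $U$ solves the homogeneous diffusion system $$\begin{cases}\partial_t\underline u^h(x_3,t)-\nu\partial_3^2\underline u^h(x_3,t)=0,\\ \underline U^4(x_3,t)=\underline{V_0^4}(x_3),\\ \underline u^h|_{t=0}=\underline{V_0^h},\quad\underline U^4|_{t=0}=\underline{V_0^4}\end{cases}$$ almost everywhere in $[0,T]\times\mathbb T^1_v$, for each $T\in[0,T^\star)$.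
   Context: Fix $a_1,a_2,a_3>0$ and $\nu>0$. $\mathbb T^3=\prod_{i=1}^3\mathbb R/(2\pi a_i\mathbb Z)$; $\mathbb T^2_h$, $\mathbb T^1_v$ are the tori in $x_h=(x_1,x_2)$ and in $x_3$. Fields $V=(v,V^4)$ have four components, zero mean over $\mathbb T^3$, and $\operatorname{div}v=0$ for $v=(V^1,V^2,V^3)$; $V^h=(V^1,V^2)$. The horizontal average is $\underline V(x_3)=\frac1{4\pi^2a_1a_2}\int_{\mathbb T^2_h}V(y_h,x_3)\,dy_h$. $(\mathrm{PBS}_\varepsilon)$: $\partial_tV^\varepsilon+v^\varepsilon\cdot\nabla V^\varepsilon-\mathcal A_2(D)V^\varepsilon+\frac1\varepsilon\mathcal AV^\varepsilon=-\frac1\varepsilon(\nabla\Phi^\varepsilon,0)^\intercal$, $\operatorname{div}v^\varepsilon=0$, $V^\varepsilon|_{t=0}=V_0$, with $\mathcal A_2(D)=\mathrm{diag}(\nu\Delta,\nu\Delta,\nu\Delta,0)$, $\mathcal A(X_1,X_2,X_3,X_4)^\intercal=(0,0,X_4,-X_3)^\intercal$. $\mathbb P$ is the Leray projector on the first three components and the identity on the fourth; $\mathcal L(\tau)=e^{-\tau\mathbb P\mathcal A}$. There is $T^\star>0$, independent of $\varepsilon$, such that for every $T\in[0,T^\star)$ the system has a unique solution in $\mathcal C([0,T];H^s)$, bounded uniformly in $\varepsilon$. The filtered solution is $U^\varepsilon=\mathcal L(-t/\varepsilon)V^\varepsilon$. The family $(U^\varepsilon)$ is relatively compact in $\mathcal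 C([0,T];H^\sigma(\mathbb T^3))$ for $\sigma\in(s-2,s)$, and $U$ denotes any limit point as $\varepsilon\to0$; such $U$ is what is called here a solution of the limit system with initial datum $V_0$. *)

theory Defs
  imports "HOL-Analysis.Analysis"
begin

text \<open>
  Functions on the torus with periods \<open>2 * pi * a$i\<close> are periodic functions on \<open>real^3\<close>;
  a field \<open>V = (v, V\<^sup>4)\<close> has values in \<open>real^4\<close>. Elements of \<open>L\<^sup>2\<close> and of Sobolev spaces are
  represented by Borel functions, so that for them equality means equality almost everywhere.
\<close>

type_synonym field = "real^3 \<Rightarrow> real^4"

definition torus_cell :: "real^'n \<Rightarrow> (real^'n) set" where
  "torus_cell a = cbox 0 ((2 * pi) *\<^sub>R a)"

definition torus_periodic :: "real^'n \<Rightarrow> (real^'n \<Rightarrow> 'b) \<Rightarrow> bool" where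
  "torus_periodic a f \<longleftrightarrow> (\<forall>i x. f (x + axis i (2 * pi * a $ i)) = f x)"

definition torus_L2 :: "real^'n \<Rightarrow> (real^'n \<Rightarrow> 'b::euclidean_space) set" where
  "torus_L2 a = {f \<in> borel_measurable borel. torus_periodic a f \<and>
     set_integrable lborel (torus_cell a) (\<lambda>x. (norm (f x))\<^sup>2)}"

definition torus_mean :: "real^'n \<Rightarrow> (real^'n \<Rightarrow> 'b::euclidean_space) \<Rightarrow> 'b" where
  "torus_mean a f = (1 / (\<Prod>i\<in>UNIV. 2 * pi * a $ i)) *\<^sub>R (LINT x:torus_cell a|lborel. f x)"


subsection \<open>Fourier coefficients and Sobolev spaces\<close>

definition freq :: "real^3 \<Rightarrow> int^3 \<Rightarrow> real^3" where
  "freq a n = (\<chi> i. of_int (n $ i) / a $ i)"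

definition fcoef :: "real^3 \<Rightarrow> (real^3 \<Rightarrow> real) \<Rightarrow> int^3 \<Rightarrow> complex" where
  "fcoef a f n = torus_mean a (\<lambda>x. complex_of_real (f x) * cis (- (freq a n \<bullet> x)))"

definition vcoef :: "real^3 \<Rightarrow> field \<Rightarrow> int^3 \<Rightarrow> complex^4" where
  "vcoef a V n = (\<chi> k. fcoef a (\<lambda>x. V x $ k) n)"

definition sobolev :: "real^3 \<Rightarrow> real \<Rightarrow> field set" where
  "sobolev a s = {V \<in> torus_L2 a.
     (\<lambda>n. (1 + (norm (freq a n))\<^sup>2) powr s * (norm (vcoef a V n))\<^sup>2) summable_on UNIV}"

text \<open>Only meaningful on \<open>sobolev a s\<close>: the value of a divergent \<open>infsum\<close> is \<open>0\<close>.\<close>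

definition sobolev_norm :: "real^3 \<Rightarrow> real \<Rightarrow> field \<Rightarrow> real" where
  "sobolev_norm a s V =
     sqrt (\<Sum>\<^sub>\<infinity>n. (1 + (norm (freq a n))\<^sup>2) powr s * (norm (vcoef a V n))\<^sup>2)"

text \<open>\<open>V \<in> C([0,T]; H\<^sup>s)\<close>; only the values of \<open>V\<close> at times in \<open>{0..T}\<close> matter.\<close>

definition sobolev_path :: "real^3 \<Rightarrow> real \<Rightarrow> real \<Rightarrow> (real \<Rightarrow> field) \<Rightarrow> bool" where
  "sobolev_path a s T V \<longleftrightarrow>
     (\<forall>t\<in>{0..T}. V t \<in> sobolev a s \<and>
        ((\<lambda>r. sobolev_norm a s (\<lambda>x. V r x - V t x)) \<longlongrightarrow> 0) (at t within {0..T}))"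

text \<open>
  \<open>kdot k X\<close> is \<open>k \<cdot> (X\<^sup>1, X\<^sup>2, X\<^sup>3)\<close>, so that \<open>\<i> * kdot (freq a n) (vcoef a V n)\<close> is the
  \<open>n\<close>-th Fourier coefficient of the distribution \<open>div v\<close>.
\<close>

definition kdot :: "real^3 \<Rightarrow> complex^4 \<Rightarrow> complex" where
  "kdot k X = of_real (k $ 1) * X $ 1 + of_real (k $ 2) * X $ 2 + of_real (k $ 3) * X $ 3"

definition div_free :: "real^3 \<Rightarrow> field \<Rightarrow> bool" where
  "div_free a V \<longleftrightarrow> (\<forall>n. kdot (freq a n) (vcoef a V n) = 0)"


subsection \<open>The system \<open>(PBS)\<close>\<close>

definition velocity :: "field \<Rightarrow> real^3 \<Rightarrow> real^3" where
  "velocity V x = vector [V x $ 1, V x $ 2, V x $ 3]"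

text \<open>\<open>v \<cdot> \<nabla>V\<close>, the derivative of \<open>V\<close> in the direction \<open>v\<close>.\<close>

definition convection :: "field \<Rightarrow> field" where
  "convection V x = frechet_derivative V (at x) (velocity V x)"

definition skew :: "field \<Rightarrow> field" where
  "skew V x = vector [0, 0, V x $ 4, - (V x $ 3)]"

definition diffusion_symbol :: "real \<Rightarrow> real^3 \<Rightarrow> complex^4 \<Rightarrow> complex^4" where
  "diffusion_symbol \<nu> k X =
     vector [- of_real (\<nu> * (norm k)\<^sup>2) * X $ 1, - of_real (\<nu> * (norm k)\<^sup>2) * X $ 2,
             - of_real (\<nu> * (norm k)\<^sup>2) * X $ 3, 0]"

definition grad_symbol :: "real^3 \<Rightarrow> complex \<Rightarrow> complex^4" where
  "grad_symbol k p =
     vector [\<i> * of_real (k $ 1) * p, \<i> * of_real (k $ 2) * p, \<i> * of_real (k $ 3) * p, 0]"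

text \<open>
  A solution in \<open>C([0,T]; H\<^sup>s)\<close>, for \<open>s > 5/2\<close>. The function \<open>V t\<close> is required to be the
  differentiable representative of its class (there is one, \<open>H\<^sup>s\<close> being embedded in \<open>C\<^sup>1\<close>), so
  \<open>convection\<close> is classical. The second-order term lies only in \<open>H\<^sup>s\<^sup>-\<^sup>2\<close>; accordingly the
  equation is an equality of periodic distributions at each time, that is, of all Fourier
  coefficients. At the end points of \<open>{0..T}\<close> the time derivative is one-sided.
\<close>

definition PBS_solution ::
  "real^3 \<Rightarrow> real \<Rightarrow> real \<Rightarrow> real \<Rightarrow> field \<Rightarrow> real \<Rightarrow> (real \<Rightarrow> field) \<Rightarrow> bool" where
  "PBS_solution a \<nu> s \<epsilon> V0 T V \<longleftrightarrow>
     sobolev_path a s T V \<and>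
     (\<forall>t\<in>{0..T}. torus_mean a (V t) = 0 \<and> div_free a (V t) \<and> (\<forall>x. V t differentiable (at x))) \<and>
     (AE x in lborel. V 0 x = V0 x) \<and>
     (\<exists>\<Phi> :: real \<Rightarrow> real^3 \<Rightarrow> real. \<forall>t\<in>{0..T}. \<Phi> t \<in> torus_L2 a \<and>
        (\<forall>n. \<exists>D. ((\<lambda>r. vcoef a (V r) n) has_vector_derivative D) (at t within {0..T}) \<and>
           D + vcoef a (convection (V t)) n - diffusion_symbol \<nu> (freq a n) (vcoef a (V t) n)
             + (1 / \<epsilon>) *\<^sub>R vcoef a (skew (V t)) n
           = - ((1 / \<epsilon>) *\<^sub>R grad_symbol (freq a n) (fcoef a (\<Phi> t) n))))"

text \<open>
  On every \<open>[0,T]\<close> with \<open>T < Tstar\<close> there is, for each \<open>\<epsilon> > 0\<close>, exactly one solution, and these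
  solutions are bounded in \<open>C([0,T]; H\<^sup>s)\<close> uniformly in \<open>\<epsilon>\<close>.
\<close>

definition uniform_lifespan :: "real^3 \<Rightarrow> real \<Rightarrow> real \<Rightarrow> field \<Rightarrow> real \<Rightarrow> bool" where
  "uniform_lifespan a \<nu> s V0 Tstar \<longleftrightarrow>
     0 < Tstar \<and>
     (\<forall>T. 0 \<le> T \<and> T < Tstar \<longrightarrow>
        (\<exists>M. \<forall>\<epsilon>>0. \<exists>V. PBS_solution a \<nu> s \<epsilon> V0 T V \<and>
           (\<forall>t\<in>{0..T}. sobolev_norm a s (V t) \<le> M) \<and>
           (\<forall>W. PBS_solution a \<nu> s \<epsilon> V0 T W \<longrightarrow> (\<forall>t\<in>{0..T}. W t = V t))))"


subsection \<open>The filtering operator and limit points\<close>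

definition fourier_series :: "real^3 \<Rightarrow> (int^3 \<Rightarrow> complex^4) \<Rightarrow> field" where
  "fourier_series a c x = (\<chi> k. Re (\<Sum>\<^sub>\<infinity>n. c n $ k * cis (freq a n \<bullet> x)))"

text \<open>
  For \<open>k = 0\<close> the quotient is \<open>0\<close>, so that the symbol is the identity on the mean value.
\<close>

definition leray_symbol :: "real^3 \<Rightarrow> complex^4 \<Rightarrow> complex^4" where
  "leray_symbol k X =
     X - vector [of_real (k $ 1) * kdot k X / of_real ((norm k)\<^sup>2),
                 of_real (k $ 2) * kdot k X / of_real ((norm k)\<^sup>2),
                 of_real (k $ 3) * kdot k X / of_real ((norm k)\<^sup>2), 0]"

text \<open>
  The pointwise Fourier series is used only for fields in \<open>H\<^sup>s\<close> with \<open>s > 3/2\<close>, for which it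
  converges absolutely.
\<close>

definition leray :: "real^3 \<Rightarrow> field \<Rightarrow> field" where
  "leray a V = fourier_series a (\<lambda>n. leray_symbol (freq a n) (vcoef a V n))"

definition operator_exp :: "(field \<Rightarrow> field) \<Rightarrow> field \<Rightarrow> field" where
  "operator_exp B V x = (\<Sum>k. (1 / fact k) *\<^sub>R (B ^^ k) V x)"

definition filter_group :: "real^3 \<Rightarrow> real \<Rightarrow> field \<Rightarrow> field" where
  "filter_group a \<tau> = operator_exp (\<lambda>W x. (- \<tau>) *\<^sub>R leray a (skew W) x)"

definition filtered_solution ::
  "real^3 \<Rightarrow> (real \<Rightarrow> real \<Rightarrow> field) \<Rightarrow> real \<Rightarrow> real \<Rightarrow> field" where
  "filtered_solution a V \<epsilon> t = filter_group a (- t / \<epsilon>) (V \<epsilon> t)"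

definition limit_point_at_zero ::
  "real^3 \<Rightarrow> real \<Rightarrow> real \<Rightarrow> (real \<Rightarrow> real \<Rightarrow> field) \<Rightarrow> (real \<Rightarrow> field) \<Rightarrow> bool" where
  "limit_point_at_zero a \<sigma> T F U \<longleftrightarrow>
     sobolev_path a \<sigma> T U \<and>
     (\<exists>\<epsilon> :: nat \<Rightarrow> real. (\<forall>j. 0 < \<epsilon> j) \<and> \<epsilon> \<longlonglongrightarrow> 0 \<and>
        uniform_limit {0..T} (\<lambda>j t. sobolev_norm a \<sigma> (\<lambda>x. F (\<epsilon> j) t x - U t x))
          (\<lambda>_. 0) sequentially)"


subsection \<open>Horizontal averages and the diffusion equation\<close>

definition horizontal_average :: "real^3 \<Rightarrow> field \<Rightarrow> real \<Rightarrow> real^4" where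
  "horizontal_average a V z =
     torus_mean (vector [a $ 1, a $ 2] :: real^2) (\<lambda>y. V (vector [y $ 1, y $ 2, z]))"

text \<open>
  \<open>u t z\<close> is a function of \<open>t \<in> [0,T]\<close> and of \<open>z\<close> in the circle of length \<open>2 * pi * a3\<close>. The
  derivatives occurring in the equation exist in the classical sense at all points of \<open>[0,T]\<close>
  times the circle, which excludes functions singular in time whose derivative vanishes almost
  everywhere.
\<close>

definition heat_solution_ae ::
  "real \<Rightarrow> real \<Rightarrow> real \<Rightarrow> (real \<Rightarrow> real \<Rightarrow> real^2) \<Rightarrow> bool" where
  "heat_solution_ae a3 \<nu> T u \<longleftrightarrow>
     (\<forall>t\<in>{0..T}. \<forall>z. u t (z + 2 * pi * a3) = u t z) \<and>
     (\<exists>ut uz uzz.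
        (\<forall>t\<in>{0..T}. \<forall>z.
           ((\<lambda>r. u r z) has_vector_derivative ut t z) (at t within {0..T}) \<and>
           (u t has_vector_derivative uz t z) (at z) \<and>
           (uz t has_vector_derivative uzz t z) (at z)) \<and>
        (AE p in lborel. fst p \<in> {0..T} \<longrightarrow>
           ut (fst p) (snd p) - \<nu> *\<^sub>R uzz (fst p) (snd p) = 0))"

end

theory Submission
  imports Defs
begin

text \<open>
  The horizontal average of a field is the sum of its Fourier modes \<open>(0,0,m)\<close>. On such a mode a
  divergence-free field of zero mean has no third component, so that the penalised operator
  (the Leray projection of \<open>skew\<close>) annihilates it and the filtering group acts there as the
  identity. The modes \<open>(0,0,m)\<close> of \<open>U\<close> are therefore limits of those of the unfiltered solutions
  \<open>V\<^sup>\<epsilon>\<close>, and along these modes the singular term and the pressure drop out of the components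
  \<open>j = 1, 2, 4\<close> of the equation: with \<open>n = (0,0,m)\<close> and \<open>k\<close> the frequency of \<open>n\<close>,

  \<open>d/dt V\<^sub>n\<^sup>j + \<kappa> V\<^sub>n\<^sup>j + \<i> k\<^sub>3 (\<Sum>p. V\<^sub>p\<^sup>3 V\<^sub>n\<^sub>-\<^sub>p\<^sup>j) = 0\<close>,
  where \<open>\<kappa> = \<nu> k\<^sub>3\<^sup>2\<close> for \<open>j = 1, 2\<close> and \<open>\<kappa> = 0\<close> for \<open>j = 4\<close>.

  The whole point is that the quadratic term disappears as \<open>\<epsilon> \<rightarrow> 0\<close>. After symmetrisation in \<open>p\<close> and
  \<open>n - p\<close>, each of its summands is the derivative, along the fast linear flow, of a bilinear
  expression in \<open>V\<^sub>p\<close> and \<open>V\<^sub>n\<^sub>-\<^sub>p\<close> (\<open>vertical_flux_is_fast_derivative\<close>). For \<open>j = 4\<close> this is the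
  identity \<open>V\<^sup>3 V\<^sup>4 = \<epsilon> d/dt (V\<^sup>4)\<^sup>2 / 2 + O(\<epsilon>)\<close> for horizontal means. For \<open>j = 1, 2\<close> the divergence of
  the vertical momentum flux is rewritten through the vorticity; the vertical vorticity is constant
  under the fast flow and \<open>V\<^sup>3\<close> is the fast derivative of \<open>V\<^sup>4\<close>. Resonant and non-resonant pairs of
  modes are treated alike. Correcting \<open>V\<^sub>n\<^sup>j\<close> by \<open>\<epsilon>\<close> times finitely many of these bilinear expressions leaves an error of order \<open>\<epsilon>\<close>, and the uniform bound in \<open>H\<^sup>s\<close> makes the remaining summands
  uniformly small (\<open>slow_mode_estimate\<close>, \<open>horizontal_mode_convergence\<close>). Hence
  \<open>U\<^sub>n\<^sup>j (t) = exp (- \<kappa> t) (V\<^sub>0)\<^sub>n\<^sup>j\<close> (\<open>limit_vertical_modes\<close>).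

  Two tools connect modes and functions. An integrable function all of whose Fourier coefficients
  vanish is zero almost everywhere (\<open>null_spectrum_AE_zero\<close>). In three dimensions it shows that
  the solutions, which are continuous with summable coefficients, equal their Fourier series
  (\<open>fourier_inversion\<close>), whence the convolution formula for the convection term
  (\<open>convection_fourier_coefficients\<close>); in one dimension it recovers the horizontal averages from
  the modes \<open>(0,0,m)\<close> (\<open>horizontal_average_eq_series\<close>). Finally \<open>s > 5/2\<close> makes \<open>\<Sum>m. m\<^sup>2 |(V\<^sub>0)\<^sub>n|\<close>
  finite, so the resulting series solves the heat equation classically, up to and including the
  initial time (\<open>heat_series_derivatives\<close>).
\<close>


section \<open>Sums over arbitrary index sets\<close>

lemma continuous_on_infsum:
  fixes f :: "'i \<Rightarrow> 'a::topological_space \<Rightarrow> 'b::banach"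
  assumes "\<And>i. continuous_on S (f i)" "\<And>i x. x \<in> S \<Longrightarrow> norm (f i x) \<le> M i" "M summable_on UNIV"
  shows "continuous_on S (\<lambda>x. \<Sum>\<^sub>\<infinity>i. f i x)"
proof (rule uniform_limit_theorem)
  show "uniform_limit S (\<lambda>F x. \<Sum>i\<in>F. f i x) (\<lambda>x. \<Sum>\<^sub>\<infinity>i. f i x) (finite_subsets_at_top UNIV)"
    by (rule Weierstrass_m_test_general) (use assms in auto)
qed (use assms(1) in \<open>auto intro!: always_eventually continuous_on_sum\<close>)

lemma summable_on_bound:
  fixes f :: "'i \<Rightarrow> 'b::banach"
  assumes "\<And>i. i \<in> A \<Longrightarrow> norm (f i) \<le> M i" "M summable_on A"
  shows "f summable_on A" "(\<lambda>i. norm (f i)) summable_on A"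
proof -
  show *: "(\<lambda>i. norm (f i)) summable_on A"
    by (rule summable_on_comparison_test[OF assms(2)]) (use assms in auto)
  show "f summable_on A" using * by (rule abs_summable_summable)
qed

lemma has_sum_diff:
  fixes f g :: "'i \<Rightarrow> 'b::real_normed_vector"
  assumes "(f has_sum x) A" "(g has_sum y) A"
  shows "((\<lambda>i. f i - g i) has_sum (x - y)) A"
  using has_sum_add[OF assms(1) has_sum_uminus[where f = g and a = "- y" and A = A, THEN iffD2]] assms(2) by simp

text \<open>
  Integration over a compact set is continuous for uniform convergence, here along the net of
  finite partial sums.
\<close>

lemma has_sum_lebesgue_integral:
  fixes f :: "'i \<Rightarrow> 'a::euclidean_space \<Rightarrow> complex"
  assumes K: "compact K" and "\<And>i. continuous_on K (f i)"
    and "\<And>i x. x \<in> K \<Longrightarrow> norm (f i x) \<le> M i" "M summable_on UNIV"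
  shows "((\<lambda>i. LINT x:K|lborel. f i x) has_sum (LINT x:K|lborel. \<Sum>\<^sub>\<infinity>i. f i x)) UNIV"
proof -
  let ?g = "\<lambda>x. \<Sum>\<^sub>\<infinity>i. f i x"
  have int: "set_integrable lborel K h" if "continuous_on K h" for h :: "'a \<Rightarrow> complex"
    using borel_integrable_compact[OF K that] by (simp add: set_integrable_def)
  have cg: "continuous_on K ?g" by (rule continuous_on_infsum) (use assms in auto)
  have U: "uniform_limit K (\<lambda>F x. \<Sum>i\<in>F. f i x) ?g (finite_subsets_at_top UNIV)"
    by (rule Weierstrass_m_test_general) (use assms in auto)
  define v where "v = measure lborel K"
  have v: "0 \<le> v" "emeasure lborel K < \<infinity>" "K \<in> sets lborel"
    using emeasure_compact_finite[OF K] K by (auto simp: v_def intro: borel_compact)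
  have "((\<lambda>F. \<Sum>i\<in>F. (LINT x:K|lborel. f i x)) \<longlongrightarrow> (LINT x:K|lborel. ?g x)) (finite_subsets_at_top UNIV)"
  proof (rule tendstoI)
    fix e :: real assume e: "0 < e"
    have ev_fin: "\<forall>\<^sub>F F in finite_subsets_at_top (UNIV :: 'i set). finite F"
      by (rule eventually_finite_subsets_at_top_weakI)
    have "\<forall>\<^sub>F F in finite_subsets_at_top UNIV. \<forall>x\<in>K. dist (\<Sum>i\<in>F. f i x) (?g x) < e / (v + 1)"
      using uniform_limitD[OF U, of "e / (v+1)"] e v by simp
    then show "\<forall>\<^sub>F F in finite_subsets_at_top UNIV.
        dist (\<Sum>i\<in>F. (LINT x:K|lborel. f i x)) (LINT x:K|lborel. ?g x) < e"
      using ev_fin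
    proof eventually_elim
      case (elim F)
      have eq: "(\<Sum>i\<in>F. (LINT x:K|lborel. f i x)) = (LINT x:K|lborel. (\<Sum>i\<in>F. f i x))"
        using int[OF assms(2)] unfolding set_lebesgue_integral_def set_integrable_def scaleR_sum_right
        by (intro Bochner_Integration.integral_sum[symmetric]) auto
      have ci: "continuous_on K (\<lambda>x. (\<Sum>i\<in>F. f i x))"
        by (intro continuous_on_sum assms)
      have "dist (\<Sum>i\<in>F. (LINT x:K|lborel. f i x)) (LINT x:K|lborel. ?g x)
          = norm (LINT x:K|lborel. (\<Sum>i\<in>F. f i x) - ?g x)"
        unfolding eq dist_norm by (subst set_integral_diff[OF int[OF ci] int[OF cg]]) simp
      also have "\<dots> \<le> (LINT x:K|lborel. norm ((\<Sum>i\<in>F. f i x) - ?g x))"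
        by (rule set_integral_norm_bound) (intro int continuous_intros ci cg)
      also have "\<dots> \<le> (LINT x:K|lborel. e / (v + 1))"
      proof (rule set_integral_mono)
        show "set_integrable lborel K (\<lambda>x. norm ((\<Sum>i\<in>F. f i x) - ?g x))"
          by (rule set_integrable_norm) (intro int continuous_intros ci cg)
        show "set_integrable lborel K (\<lambda>x. e / (v + 1))"
          using borel_integrable_compact[OF K, of "\<lambda>x. e / (v + 1)"] by (simp add: set_integrable_def)
      qed (use elim in \<open>auto simp: dist_norm intro: less_imp_le\<close>)
      also have "\<dots> = e / (v + 1) * v"
        using v by (simp add: set_lebesgue_integral_def v_def)
      also have "\<dots> < e" using e v by (simp add: field_simps)
      finally show ?case .
    qed
  qed
  then show ?thesis by (simp add: has_sum_def)
qed

lemma onorm_scaleR_le: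
  fixes y :: "'b::real_normed_vector"
  assumes "norm y \<le> m"
  shows "onorm (\<lambda>x. x *\<^sub>R y) \<le> m"
  using assms by (intro onorm_le) (simp add: mult.commute[of m] mult_left_mono)

lemma has_vector_derivative_iff_quotient:
  "(f has_vector_derivative D) (at t within S) \<longleftrightarrow>
    ((\<lambda>r. (f r - f t) /\<^sub>R (r - t)) \<longlongrightarrow> D) (at t within S)"
proof -
  have "((\<lambda>r. norm (f r - f t - (r - t) *\<^sub>R D) / norm (r - t)) \<longlongrightarrow> 0) (at t within S) \<longleftrightarrow>
      ((\<lambda>r. norm ((f r - f t) /\<^sub>R (r - t) - D)) \<longlongrightarrow> 0) (at t within S)"
  proof (rule filterlim_cong[OF refl refl])
    have "norm (f r - f t - (r - t) *\<^sub>R D) / norm (r - t) = norm ((f r - f t) /\<^sub>R (r - t) - D)"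
      if "r \<noteq> t" for r
    proof -
      have "(f r - f t) /\<^sub>R (r - t) - D = (f r - f t - (r - t) *\<^sub>R D) /\<^sub>R (r - t)"
        using that by (simp add: scaleR_diff_right)
      then show ?thesis by (simp add: divide_inverse mult.commute)
    qed
    then show "\<forall>\<^sub>F r in at t within S. norm (f r - f t - (r - t) *\<^sub>R D) / norm (r - t)
        = norm ((f r - f t) /\<^sub>R (r - t) - D)"
      by (simp add: eventually_at_filter)
  qed
  also have "\<dots> \<longleftrightarrow> ((\<lambda>r. (f r - f t) /\<^sub>R (r - t)) \<longlongrightarrow> D) (at t within S)"
    by (simp add: tendsto_norm_zero_iff LIM_zero_iff)
  finally show ?thesis
    by (simp add: has_vector_derivative_def has_derivative_iff_norm bounded_linear_scaleR_left)
qed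

text \<open>
  The difference quotients are dominated by \<open>M\<close> because of the mean value inequality, so the
  limit defining the derivative may be taken under the sum. One-sided derivatives at the end
  points of an interval are included, as the heat equation requires at the initial time.
\<close>

lemma has_vector_derivative_infsum:
  fixes f :: "'i \<Rightarrow> real \<Rightarrow> 'b::banach"
  assumes S: "convex S" and t: "t \<in> S"
    and d: "\<And>i r. r \<in> S \<Longrightarrow> (f i has_vector_derivative f' i r) (at r within S)"
    and M: "\<And>i r. r \<in> S \<Longrightarrow> norm (f' i r) \<le> M i" "M summable_on UNIV"
    and s: "\<And>r. r \<in> S \<Longrightarrow> (\<lambda>i. f i r) summable_on UNIV"
  shows "((\<lambda>r. \<Sum>\<^sub>\<infinity>i. f i r) has_vector_derivative (\<Sum>\<^sub>\<infinity>i. f' i t)) (at t within S)"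
proof -
  define q where "q i r = (f i r - f i t) /\<^sub>R (r - t)" for i r
  have M0: "0 \<le> M i" for i using M(1)[OF t, of i] norm_ge_zero order_trans by blast
  have lip: "norm (f i r - f i u) \<le> M i * norm (r - u)" if "r \<in> S" "u \<in> S" for i r u
    by (rule differentiable_bound[OF S d[unfolded has_vector_derivative_def] _ that])
      (use M(1) onorm_scaleR_le in auto)
  have q_bd: "norm (q i r) \<le> M i" if r: "r \<in> S" for i r
    using lip[OF r t, of i] M0[of i] by (cases "r = t") (auto simp: q_def divide_simps mult.commute)
  have U: "uniform_limit S (\<lambda>F x. \<Sum>i\<in>F. q i x) (\<lambda>x. \<Sum>\<^sub>\<infinity>i. q i x) (finite_subsets_at_top UNIV)"
    by (rule Weierstrass_m_test_general) (use q_bd M in auto)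
  have "((\<lambda>r. \<Sum>\<^sub>\<infinity>i. q i r) \<longlongrightarrow> (\<Sum>\<^sub>\<infinity>i. f' i t)) (at t within S)"
  proof (rule swap_uniform_limit[OF _ _ U])
    show "\<forall>\<^sub>F F in finite_subsets_at_top UNIV.
        ((\<lambda>r. \<Sum>i\<in>F. q i r) \<longlongrightarrow> (\<Sum>i\<in>F. f' i t)) (at t within S)"
      using d[OF t] unfolding has_vector_derivative_iff_quotient q_def
      by (intro always_eventually allI tendsto_sum)
    have "(\<lambda>i. f' i t) summable_on UNIV"
      by (rule summable_on_bound(1)[OF _ M(2)]) (use M(1) t in auto)
    then show "((\<lambda>F. \<Sum>i\<in>F. f' i t) \<longlongrightarrow> (\<Sum>\<^sub>\<infinity>i. f' i t)) (finite_subsets_at_top UNIV)"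
      by (rule infsum_tendsto)
  qed simp
  moreover have "(\<Sum>\<^sub>\<infinity>i. q i r) = ((\<Sum>\<^sub>\<infinity>i. f i r) - (\<Sum>\<^sub>\<infinity>i. f i t)) /\<^sub>R (r - t)" if "r \<in> S" for r
    unfolding q_def using has_sum_diff[OF has_sum_infsum[OF s[OF that]] has_sum_infsum[OF s[OF t]]]
    by (intro infsumI has_sum_scaleR)
  then have "\<forall>\<^sub>F r in at t within S.
      (\<Sum>\<^sub>\<infinity>i. q i r) = ((\<Sum>\<^sub>\<infinity>i. f i r) - (\<Sum>\<^sub>\<infinity>i. f i t)) /\<^sub>R (r - t)"
    by (simp add: eventually_at_filter)
  ultimately show ?thesis
    unfolding has_vector_derivative_iff_quotient by (rule Lim_transform_eventually)
qed

lemma summable_int_powr: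
  fixes q b :: real assumes q: "1/2 < q" and b: "0 < b"
  shows "(\<lambda>n::int. (1 + (of_int n / b)\<^sup>2) powr (- q)) summable_on UNIV"
proof -
  let ?f = "\<lambda>n::int. (1 + (of_int n / b)\<^sup>2) powr (- q)"
  have "summable (\<lambda>n::nat. b powr (2 * q) * real n powr (- (2 * q)))"
    using q by (intro summable_mult) (simp add: summable_real_powr_iff)
  then have "summable (\<lambda>n::nat. ?f (int n))"
  proof (rule summable_comparison_test_ev[rotated])
    have "norm (?f (int n)) \<le> b powr (2 * q) * real n powr (- (2 * q))" if "0 < n" for n :: nat
    proof -
      have "?f (int n) \<le> ((real n / b)\<^sup>2) powr (- q)"
        using that b q by (intro powr_mono2') auto
      also have "\<dots> = (real n / b) powr (- (2 * q))"
        using that b by (simp add: powr_powr flip: powr_numeral)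
      also have "\<dots> = b powr (2 * q) * real n powr (- (2 * q))"
        using that b by (simp add: powr_divide powr_minus divide_simps)
      finally show ?thesis by simp
    qed
    then show "\<forall>\<^sub>F n in sequentially. norm (?f (int n)) \<le> b powr (2 * q) * real n powr (- (2 * q))"
      by (intro eventually_mono[OF eventually_gt_at_top[of "0::nat"]])
  qed
  then have nat: "(\<lambda>n. ?f (int n)) summable_on UNIV"
    by (rule summable_nonneg_imp_summable_on) simp
  then have "?f summable_on range int"
    by (subst summable_on_reindex) (auto simp: o_def inj_on_def)
  moreover have "?f summable_on range (\<lambda>n. - int n)"
    using nat by (subst summable_on_reindex) (auto simp: o_def inj_on_def)
  ultimately have "?f summable_on (range int \<union> range (\<lambda>n. - int n))"
    by (rule summable_on_union)
  moreover have "range int \<union> range (\<lambda>n. - int n) = UNIV"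
  proof (intro set_eqI iffI UNIV_I)
    fix m :: int
    show "m \<in> range int \<union> range (\<lambda>n. - int n)"
      by (cases m rule: int_cases2) auto
  qed
  ultimately show ?thesis by (simp only:)
qed

text \<open>
  The sum over the lattice is dominated by a product of three one-dimensional sums, since
  \<open>1 + |k|\<^sup>2\<close> dominates each \<open>1 + k\<^sub>i\<^sup>2\<close> and hence the geometric mean of the three.
\<close>

lemma summable_freq_powr:
  fixes a :: "real^3" assumes a: "\<And>i. 0 < a $ i" and p: "3/2 < p"
  shows "(\<lambda>n. (1 + (norm (freq a n))\<^sup>2) powr (- p)) summable_on UNIV"
proof -
  define g where "g i (m::int) = (1 + (of_int m / a $ i)\<^sup>2) powr (- (p / 3))" for i m
  have gpos: "0 < g i m" for i m
  proof -
    have "0 < 1 + (of_int m / a $ i)\<^sup>2" by (simp add: add_pos_nonneg)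
    then show ?thesis unfolding g_def by simp
  qed
  have gs: "(\<lambda>m. norm (g i m)) summable_on UNIV" for i
    using summable_int_powr[of "p/3" "a $ i"] p a by (simp add: g_def)
  have "(\<lambda>h. \<Prod>i\<in>UNIV. g i (h i)) summable_on PiE UNIV (\<lambda>_. UNIV)"
  proof (rule ccontr)
    assume "\<not> ?thesis"
    \<comment> \<open>A divergent sum would have the value zero, but the product of the three sums is positive.\<close>
    then have "infsum (\<lambda>h. \<Prod>i\<in>UNIV. g i (h i)) (PiE UNIV (\<lambda>_. UNIV)) = 0"
      by (rule infsum_not_exists)
    moreover have "infsum (\<lambda>h. \<Prod>i\<in>UNIV. g i (h i)) (PiE UNIV (\<lambda>_. UNIV)) = (\<Prod>i\<in>UNIV. infsum (g i) UNIV)"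
      by (rule infsum_prod_PiE_abs) (use gs in auto)
    moreover have "0 < infsum (g i) UNIV" for i
    proof -
      have "(\<Sum>m\<in>{0}. g i m) \<le> infsum (g i) UNIV"
        by (rule finite_sum_le_infsum) (use gs gpos[THEN less_imp_le] in \<open>auto intro: abs_summable_summable\<close>)
      with gpos[of i 0] show ?thesis by simp
    qed
    then have "0 < (\<Prod>i\<in>UNIV. infsum (g i) UNIV)" by (intro prod_pos) auto
    ultimately show False by (simp only: PiE_UNIV_domain less_irrefl)
  qed
  then have "(\<lambda>h. \<Prod>i\<in>UNIV. g i (h i)) summable_on UNIV"
    by (simp add: PiE_UNIV_domain)
  moreover have "range (vec_nth :: int^3 \<Rightarrow> _) = UNIV"
    by (rule surjI[of _ vec_lambda]) (rule vec_lambda_inverse, simp)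
  ultimately have "(\<lambda>h. \<Prod>i\<in>UNIV. g i (h i)) summable_on range (vec_nth :: int^3 \<Rightarrow> _)"
    by simp
  then have sum: "(\<lambda>n :: int^3. \<Prod>i\<in>UNIV. g i (n $ i)) summable_on UNIV"
    by (subst (asm) summable_on_reindex) (auto simp: o_def inj_on_def vec_nth_inject)
  show ?thesis
  proof (rule summable_on_comparison_test[OF sum])
    fix n :: "int^3"
    let ?w = "1 + (norm (freq a n))\<^sup>2"
    have "(\<Prod>i\<in>UNIV. g i (n $ i)) \<ge> (\<Prod>i\<in>(UNIV :: 3 set). ?w powr (- (p / 3)))"
    proof (rule prod_mono, safe)
      fix i
      have "\<bar>of_int (n $ i) / a $ i\<bar> \<le> norm (freq a n)"
        using component_le_norm_cart[of "freq a n" i] by (simp add: freq_def)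
      then have "(of_int (n $ i) / a $ i)\<^sup>2 \<le> (norm (freq a n))\<^sup>2"
        by (metis abs_ge_zero power2_abs power_mono)
      then show "?w powr (- (p / 3)) \<le> g i (n $ i)"
        unfolding g_def using p by (intro powr_mono2') (auto simp: add_pos_nonneg)
    qed simp
    also have "(\<Prod>i\<in>(UNIV :: 3 set). ?w powr (- (p / 3))) = ?w powr (- p)"
    proof -
      have "0 < ?w" by (simp add: add_pos_nonneg)
      then show ?thesis by (simp add: powr_powr flip: powr_numeral)
    qed
    finally show "?w powr (- p) \<le> (\<Prod>i\<in>UNIV. g i (n $ i))" .
  qed simp
qed


section \<open>Uniqueness of Fourier coefficients on a box\<close>

text \<open>
  The frequencies of the functions with period \<open>L \<bullet> b\<close> in each coordinate direction \<open>b\<close>. An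
  arbitrary Euclidean space is used so that the results apply both to the three-dimensional torus
  and to the vertical circle.
\<close>

definition dual_lattice :: "'e::euclidean_space \<Rightarrow> 'e set" where
  "dual_lattice L = {\<kappa>. \<forall>b\<in>Basis. \<exists>m::int. (\<kappa> \<bullet> b) * (L \<bullet> b) = 2 * pi * m}"

lemma dual_lattice_add: "\<kappa> \<in> dual_lattice L \<Longrightarrow> \<mu> \<in> dual_lattice L \<Longrightarrow> \<kappa> + \<mu> \<in> dual_lattice L"
  unfolding dual_lattice_def by (auto simp: inner_simps distrib_right) (metis distrib_left of_int_add)

lemma dual_lattice_minus: "\<kappa> \<in> dual_lattice L \<Longrightarrow> - \<kappa> \<in> dual_lattice L"
  unfolding dual_lattice_def by (auto simp: inner_simps) (metis mult_minus_right of_int_minus)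

lemma set_integrable_compact:
  fixes f :: "'e::euclidean_space \<Rightarrow> 'b::{banach,second_countable_topology}"
  assumes "compact K" "continuous_on K f"
  shows "set_integrable lborel K f"
  using borel_integrable_compact[OF assms] by (simp add: set_integrable_def)

lemma lborel_set_integral_cis:
  fixes c l :: real and m :: int
  assumes l: "0 \<le> l" and cl: "c * l = 2 * pi * m"
  shows "(\<integral>x. indicator {0..l} x *\<^sub>R cis (c * x) \<partial>lborel) = (if c = 0 then of_real l else 0)"
proof (cases "c = 0")
  case False
  have "(\<integral>x. indicator {0..l} x *\<^sub>R cis (c * x) \<partial>lborel) = cis (c * l) / (\<i> * c) - cis (c * 0) / (\<i> * c)"
  proof (rule integral_FTC_Icc[OF l])
    fix x
    show "((\<lambda>x. cis (c * x) / (\<i> * c)) has_vector_derivative cis (c * x)) (at x within {0..l})"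
      unfolding cis_conv_exp of_real_mult mult.assoc[symmetric] using False
      by (intro has_vector_derivative_real_field) (auto intro!: derivative_eq_intros)
  qed (auto intro!: continuous_intros)
  also have "cis (c * l) = 1" unfolding cl by (metis cis_multiple_2pi Ints_of_int mult.commute)
  finally show ?thesis using False by simp
qed (use l in \<open>simp add: scaleR_conv_of_real\<close>)

text \<open>
  Orthogonality of the characters: the integral over a box is the product of integrals over its
  sides, one of which runs over full periods unless the frequency is zero.
\<close>

lemma set_integral_cis_cbox:
  fixes L :: "'e::euclidean_space"
  assumes L: "\<And>b. b \<in> Basis \<Longrightarrow> 0 < L \<bullet> b" and \<kappa>: "\<kappa> \<in> dual_lattice L"
  shows "(LINT x:cbox 0 L|lborel. cis (\<kappa> \<bullet> x)) = (if \<kappa> = 0 then of_real (\<Prod>b\<in>Basis. L \<bullet> b) else 0)"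
proof -
  interpret P: product_sigma_finite "\<lambda>_::'e. lborel :: real measure" by standard
  let ?g = "\<lambda>b z. indicator {0..L \<bullet> b} z *\<^sub>R cis ((\<kappa> \<bullet> b) * z)"
  have g: "integrable lborel (?g b)" for b
    unfolding set_integrable_def[symmetric]
    by (rule set_integrable_compact) (auto intro!: continuous_intros)
  have "(LINT x:cbox 0 L|lborel. cis (\<kappa> \<bullet> x)) =
      (\<integral>f. indicator (cbox 0 L) (\<Sum>b\<in>Basis. f b *\<^sub>R b) *\<^sub>R cis (\<kappa> \<bullet> (\<Sum>b\<in>Basis. f b *\<^sub>R b))
        \<partial>(\<Pi>\<^sub>M b\<in>Basis. lborel))"
    unfolding set_lebesgue_integral_def
  proof (subst lborel_eq, rule integral_distr)
    have [measurable]: "(\<lambda>x. cis (\<kappa> \<bullet> x)) \<in> borel_measurable borel"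
      by (intro borel_measurable_continuous_onI continuous_intros)
    show "(\<lambda>x. indicator (cbox 0 L) x *\<^sub>R cis (\<kappa> \<bullet> x)) \<in> borel_measurable borel"
      by measurable
  qed measurable
  also have "\<dots> = (\<integral>f. (\<Prod>b\<in>Basis. ?g b (f b)) \<partial>(\<Pi>\<^sub>M b\<in>Basis. lborel))"
  proof (rule Bochner_Integration.integral_cong[OF refl])
    fix f :: "'e \<Rightarrow> real"
    have "cis (\<kappa> \<bullet> (\<Sum>b\<in>Basis. f b *\<^sub>R b)) = (\<Prod>b\<in>Basis. cis ((\<kappa> \<bullet> b) * f b))"
      by (simp add: cis_conv_exp inner_sum_right sum_distrib_left exp_sum mult.commute)
    moreover have "(\<Sum>b\<in>Basis. f b *\<^sub>R b) \<in> cbox 0 L \<longleftrightarrow> (\<forall>b\<in>Basis. f b \<in> {0..L \<bullet> b})"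
      by (simp add: mem_box inner_sum_left_Basis)
    ultimately show "indicator (cbox 0 L) (\<Sum>b\<in>Basis. f b *\<^sub>R b) *\<^sub>R cis (\<kappa> \<bullet> (\<Sum>b\<in>Basis. f b *\<^sub>R b))
        = (\<Prod>b\<in>Basis. ?g b (f b))"
      by (auto simp: indicator_def)
  qed
  also have "\<dots> = (\<Prod>b\<in>Basis. \<integral>z. ?g b z \<partial>lborel)"
    by (rule P.product_integral_prod) (use g in auto)
  also have "\<dots> = (\<Prod>b\<in>Basis. if \<kappa> \<bullet> b = 0 then of_real (L \<bullet> b) else 0)"
  proof (rule prod.cong[OF refl])
    fix b :: 'e assume b: "b \<in> Basis"
    then obtain m :: int where "(\<kappa> \<bullet> b) * (L \<bullet> b) = 2 * pi * m" using \<kappa> by (auto simp: dual_lattice_def)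
    then show "(\<integral>z. ?g b z \<partial>lborel) = (if \<kappa> \<bullet> b = 0 then of_real (L \<bullet> b) else 0)"
      using L[OF b] by (intro lborel_set_integral_cis) auto
  qed
  also have "\<dots> = (if \<kappa> = 0 then of_real (\<Prod>b\<in>Basis. L \<bullet> b) else 0)"
    by (auto simp: euclidean_eq_iff[of \<kappa> 0])
  finally show ?thesis .
qed

lemma trig_series_coefficient:
  fixes L :: "'e::euclidean_space"
  assumes L: "\<And>b. b \<in> Basis \<Longrightarrow> 0 < L \<bullet> b" and \<kappa>: "\<And>i. \<kappa> i \<in> dual_lattice L"
    and \<mu>: "\<mu> \<in> dual_lattice L" and c: "(\<lambda>i. norm (c i)) summable_on UNIV"
  shows "(LINT x:cbox 0 L|lborel. (\<Sum>\<^sub>\<infinity>i. c i * cis (\<kappa> i \<bullet> x)) * cis (- (\<mu> \<bullet> x)))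
    = (\<Sum>\<^sub>\<infinity>i\<in>{i. \<kappa> i = \<mu>}. c i) * of_real (\<Prod>b\<in>Basis. L \<bullet> b)"
proof -
  let ?p = "of_real (\<Prod>b\<in>Basis. L \<bullet> b) :: complex"
  have "((\<lambda>i. LINT x:cbox 0 L|lborel. c i * cis ((\<kappa> i - \<mu>) \<bullet> x)) has_sum
      (LINT x:cbox 0 L|lborel. \<Sum>\<^sub>\<infinity>i. c i * cis ((\<kappa> i - \<mu>) \<bullet> x))) UNIV"
    by (rule has_sum_lebesgue_integral[OF _ _ _ c]) (auto intro!: continuous_intros simp: norm_mult)
  moreover have "(LINT x:cbox 0 L|lborel. c i * cis ((\<kappa> i - \<mu>) \<bullet> x)) = (if \<kappa> i = \<mu> then c i * ?p else 0)" for i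
    using set_integral_cis_cbox[OF L, of "\<kappa> i - \<mu>"] dual_lattice_add[OF \<kappa> dual_lattice_minus[OF \<mu>]]
    by simp
  moreover have "(\<Sum>\<^sub>\<infinity>i. c i * cis ((\<kappa> i - \<mu>) \<bullet> x)) = (\<Sum>\<^sub>\<infinity>i. c i * cis (\<kappa> i \<bullet> x)) * cis (- (\<mu> \<bullet> x))" for x
    by (subst infsum_cmult_left'[symmetric]) (simp add: mult.assoc cis_mult inner_diff_left)
  ultimately have "((\<lambda>i. if \<kappa> i = \<mu> then c i * ?p else 0) has_sum
      (LINT x:cbox 0 L|lborel. (\<Sum>\<^sub>\<infinity>i. c i * cis (\<kappa> i \<bullet> x)) * cis (- (\<mu> \<bullet> x)))) UNIV" by simp
  from infsumI[OF this]
  have "(LINT x:cbox 0 L|lborel. (\<Sum>\<^sub>\<infinity>i. c i * cis (\<kappa> i \<bullet> x)) * cis (- (\<mu> \<bullet> x)))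
      = (\<Sum>\<^sub>\<infinity>i. if \<kappa> i = \<mu> then c i * ?p else 0)" by (rule sym)
  also have "\<dots> = (\<Sum>\<^sub>\<infinity>i\<in>{i. \<kappa> i = \<mu>}. c i * ?p)" by (rule infsum_cong_neutral) auto
  also have "\<dots> = (\<Sum>\<^sub>\<infinity>i\<in>{i. \<kappa> i = \<mu>}. c i) * ?p" by (rule infsum_cmult_left')
  finally show ?thesis .
qed

definition null_spectrum :: "'e::euclidean_space \<Rightarrow> ('e \<Rightarrow> complex) \<Rightarrow> bool" where
  "null_spectrum L f \<longleftrightarrow> set_integrable lborel (cbox 0 L) f \<and>
     (\<forall>\<kappa>\<in>dual_lattice L. (LINT x:cbox 0 L|lborel. f x * cis (\<kappa> \<bullet> x)) = 0)"

text \<open>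
  The torus as a compact subset of Euclidean space, the pair of real and imaginary parts of the
  numbers \<open>exp (2 \<pi> i x\<^sub>b / L\<^sub>b)\<close>. Polynomials on the target restrict to trigonometric polynomials.
\<close>

definition torus_embedding :: "'e::euclidean_space \<Rightarrow> 'e \<Rightarrow> 'e \<times> 'e" where
  "torus_embedding L x = ((\<Sum>b\<in>Basis. cos (2 * pi * (x \<bullet> b) / (L \<bullet> b)) *\<^sub>R b),
     (\<Sum>b\<in>Basis. sin (2 * pi * (x \<bullet> b) / (L \<bullet> b)) *\<^sub>R b))"

lemma continuous_on_torus_embedding: "continuous_on A (torus_embedding L)"
  unfolding torus_embedding_def divide_inverse by (intro continuous_intros)

lemma set_integrable_mult_continuous:
  fixes f g :: "'e::euclidean_space \<Rightarrow> complex"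
  assumes f: "set_integrable lborel (cbox 0 L) f" and g: "continuous_on UNIV g"
  shows "set_integrable lborel (cbox 0 L) (\<lambda>x. f x * g x)"
proof -
  have "bounded (g ` cbox 0 L)"
    by (intro compact_imp_bounded compact_continuous_image continuous_on_subset[OF g]) auto
  then obtain B where B: "\<And>x. x \<in> cbox 0 L \<Longrightarrow> norm (g x) \<le> B" by (auto simp: bounded_iff)
  have [measurable]: "g \<in> borel_measurable borel" by (rule borel_measurable_continuous_onI[OF g])
  have m: "(\<lambda>x. indicat_real (cbox 0 L) x *\<^sub>R f x) \<in> borel_measurable lborel"
    using f by (auto simp: set_integrable_def)
  have "integrable lborel (\<lambda>x. (indicat_real (cbox 0 L) x *\<^sub>R f x) * g x)"
  proof (rule Bochner_Integration.integrable_bound)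
    show "integrable lborel (\<lambda>x. B *\<^sub>R (indicat_real (cbox 0 L) x *\<^sub>R f x))"
      using f unfolding set_integrable_def by (rule integrable_scaleR_right)
    show "AE x in lborel. norm ((indicat_real (cbox 0 L) x *\<^sub>R f x) * g x)
        \<le> norm (B *\<^sub>R (indicat_real (cbox 0 L) x *\<^sub>R f x))"
      using B by (intro AE_I2) (auto simp: indicator_def norm_mult mult.commute[of "norm (f _)"]
        intro!: mult_right_mono order.trans[OF B abs_ge_self])
    show "(\<lambda>x. (indicat_real (cbox 0 L) x *\<^sub>R f x) * g x) \<in> borel_measurable lborel"
      using m by measurable
  qed
  then show ?thesis by (simp add: set_integrable_def)
qed

lemma null_spectrum_add: "null_spectrum L f \<Longrightarrow> null_spectrum L g \<Longrightarrow> null_spectrum L (\<lambda>x. f x + g x)"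
  unfolding null_spectrum_def
  by (auto simp: distrib_right set_integrable_mult_continuous continuous_intros)

lemma null_spectrum_cmult: "null_spectrum L f \<Longrightarrow> null_spectrum L (\<lambda>x. c * f x)"
  unfolding null_spectrum_def by (auto simp: mult.assoc)

lemma null_spectrum_sum:
  assumes "\<And>i. i \<in> A \<Longrightarrow> null_spectrum L (f i)"
  shows "null_spectrum L (\<lambda>x. \<Sum>i\<in>A. f i x)"
  using assms
proof (induction A rule: infinite_finite_induct)
  case (insert i A)
  then show ?case by (simp add: null_spectrum_add)
qed (simp_all add: null_spectrum_def set_integrable_def set_lebesgue_integral_def)

lemma null_spectrum_cis:
  assumes "null_spectrum L f" "\<mu> \<in> dual_lattice L"
  shows "null_spectrum L (\<lambda>x. f x * cis (\<mu> \<bullet> x))"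
proof -
  have "(LINT x:cbox 0 L|lborel. f x * cis (\<mu> \<bullet> x) * cis (\<kappa> \<bullet> x)) = 0" if "\<kappa> \<in> dual_lattice L" for \<kappa>
    using assms dual_lattice_add[OF assms(2) that]
    by (simp add: null_spectrum_def mult.assoc cis_mult flip: inner_add_left)
  moreover have "set_integrable lborel (cbox 0 L) (\<lambda>x. f x * cis (\<mu> \<bullet> x))"
    using assms(1) by (intro set_integrable_mult_continuous continuous_intros)
      (auto simp: null_spectrum_def)
  ultimately show ?thesis by (simp add: null_spectrum_def)
qed

text \<open>
  Induction over the polynomial with the statement for all \<open>f\<close>: multiplication by a coordinate of
  \<open>torus_embedding\<close> is a combination of two frequency shifts, and a product of polynomials acts by
  one multiplication after the other.
\<close>

lemma null_spectrum_polynomial: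
  fixes L :: "'e::euclidean_space"
  assumes L: "\<And>b. b \<in> Basis \<Longrightarrow> 0 < L \<bullet> b"
    and p: "real_polynomial_function p" and f: "null_spectrum L f"
  shows "null_spectrum L (\<lambda>x. f x * of_real (p (torus_embedding L x)))"
  using p f
proof (induction p arbitrary: f rule: real_polynomial_function.induct)
  case (linear p)
  interpret bounded_linear p by fact
  define \<mu> where "\<mu> b = (2 * pi / (L \<bullet> b)) *\<^sub>R b" for b :: 'e
  have \<mu>: "\<mu> b \<in> dual_lattice L" if "b \<in> Basis" for b
    unfolding dual_lattice_def
  proof safe
    fix b' :: 'e assume b': "b' \<in> Basis"
    show "\<exists>m::int. \<mu> b \<bullet> b' * (L \<bullet> b') = 2 * pi * m"
      using L[OF that] b' that by (intro exI[of _ "if b = b' then 1 else 0"]) (auto simp: \<mu>_def inner_Basis)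
  qed
  have \<mu>x: "\<mu> b \<bullet> x = 2 * pi * (x \<bullet> b) / (L \<bullet> b)" for b x
    by (simp add: \<mu>_def inner_commute)
  define A B where "A b = (of_real (p (b, 0)) :: complex)" and "B b = (of_real (p (0, b)) :: complex)" for b
  have cs: "complex_of_real (cos r) = (1/2) * (cis r + cis (- r))"
    "complex_of_real (sin r) = (\<i>/2) * (cis (- r) - cis r)" for r
    by (simp_all add: complex_eq_iff)
  have "null_spectrum L (\<lambda>x. \<Sum>b\<in>Basis.
      ((1/2) * A b - (\<i>/2) * B b) * (f x * cis (\<mu> b \<bullet> x))
      + ((1/2) * A b + (\<i>/2) * B b) * (f x * cis (- \<mu> b \<bullet> x)))"
    by (intro null_spectrum_sum null_spectrum_add null_spectrum_cmult null_spectrum_cis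
        linear.prems dual_lattice_minus \<mu>)
  moreover have "f x * of_real (p (torus_embedding L x)) = (\<Sum>b\<in>Basis.
      ((1/2) * A b - (\<i>/2) * B b) * (f x * cis (\<mu> b \<bullet> x))
      + ((1/2) * A b + (\<i>/2) * B b) * (f x * cis (- \<mu> b \<bullet> x)))" for x
  proof -
    have "torus_embedding L x = (\<Sum>b\<in>Basis. cos (\<mu> b \<bullet> x) *\<^sub>R (b, 0) + sin (\<mu> b \<bullet> x) *\<^sub>R (0, b))"
      by (simp add: torus_embedding_def \<mu>x prod_eq_iff fst_sum snd_sum)
    then have "p (torus_embedding L x) = (\<Sum>b\<in>Basis. cos (\<mu> b \<bullet> x) * p (b, 0) + sin (\<mu> b \<bullet> x) * p (0, b))"
      by (simp only: sum add scaleR real_scaleR_def)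
    then have "of_real (p (torus_embedding L x)) =
        (\<Sum>b\<in>Basis. (1/2) * (cis (\<mu> b \<bullet> x) + cis (- (\<mu> b \<bullet> x))) * A b
          + (\<i>/2) * (cis (- (\<mu> b \<bullet> x)) - cis (\<mu> b \<bullet> x)) * B b)"
      by (simp only: of_real_sum of_real_add of_real_mult cs A_def B_def)
    then show ?thesis
      by (simp only: sum_distrib_left inner_minus_left) (rule sum.cong[OF refl], simp add: algebra_simps)
  qed
  ultimately show ?case by simp
next
  case (const c)
  then show ?case using null_spectrum_cmult[of L f "of_real c"] by (simp add: mult.commute)
next
  case (add p q)
  show ?case using null_spectrum_add[OF add.IH(1)[OF add.prems] add.IH(2)[OF add.prems]]
    by (simp add: distrib_left)
next
  case (mult p q)
  show ?case using mult.IH(2)[OF mult.IH(1)[OF mult.prems]] by (simp add: mult.assoc)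
qed

text \<open>
  By the Stone-Weierstrass theorem on the embedded torus.
\<close>

lemma null_spectrum_continuous:
  fixes L :: "'e::euclidean_space"
  assumes L: "\<And>b. b \<in> Basis \<Longrightarrow> 0 < L \<bullet> b"
    and f: "null_spectrum L f" and \<phi>: "continuous_on UNIV \<phi>"
  shows "(LINT x:cbox 0 L|lborel. f x * of_real (\<phi> (torus_embedding L x))) = 0"
proof -
  define m where "m = (LINT x:cbox 0 L|lborel. norm (f x))"
  have fi: "set_integrable lborel (cbox 0 L) f" using f by (simp add: null_spectrum_def)
  have m: "0 \<le> m" unfolding m_def set_lebesgue_integral_def by (rule Bochner_Integration.integral_nonneg) simp
  have "norm (LINT x:cbox 0 L|lborel. f x * of_real (\<phi> (torus_embedding L x))) \<le> e" if e: "0 < e" for e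
  proof -
    obtain p where p: "real_polynomial_function p"
      "\<And>z. z \<in> torus_embedding L ` cbox 0 L \<Longrightarrow> \<bar>\<phi> z - p z\<bar> < e / (m + 1)"
      using Stone_Weierstrass_real_polynomial_function[of "torus_embedding L ` cbox 0 L" \<phi> "e / (m + 1)"]
        compact_continuous_image[OF continuous_on_torus_embedding, of "cbox 0 L" L]
        continuous_on_subset[OF \<phi>] e m by auto
    have cp: "continuous_on UNIV (\<lambda>x. complex_of_real (p (torus_embedding L x)))"
      using continuous_on_polymonial_function p(1) real_polynomial_function_eq
      by (intro continuous_intros continuous_on_compose2[OF _ continuous_on_torus_embedding]) blast+
    have c\<phi>: "continuous_on UNIV (\<lambda>x. complex_of_real (\<phi> (torus_embedding L x)))"
      by (intro continuous_intros continuous_on_compose2[OF \<phi> continuous_on_torus_embedding]) auto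
    note ip = set_integrable_mult_continuous[OF fi cp]
    note i\<phi> = set_integrable_mult_continuous[OF fi c\<phi>]
    have "0 \<in> dual_lattice L" by (auto simp: dual_lattice_def intro: exI[of _ 0])
    then have "(LINT x:cbox 0 L|lborel. f x * of_real (p (torus_embedding L x))) = 0"
      using null_spectrum_polynomial[OF L p(1) f] by (force simp: null_spectrum_def)
    then have "norm (LINT x:cbox 0 L|lborel. f x * of_real (\<phi> (torus_embedding L x)))
      = norm (LINT x:cbox 0 L|lborel. f x * of_real (\<phi> (torus_embedding L x)) - f x * of_real (p (torus_embedding L x)))"
      by (subst set_integral_diff[OF i\<phi> ip]) simp
    also have "\<dots> \<le> (LINT x:cbox 0 L|lborel. norm (f x * of_real (\<phi> (torus_embedding L x)) - f x * of_real (p (torus_embedding L x))))"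
      by (rule set_integral_norm_bound[OF set_integral_diff(1)[OF i\<phi> ip]])
    also have "\<dots> \<le> (LINT x:cbox 0 L|lborel. e / (m + 1) * norm (f x))"
    proof (rule set_integral_mono)
      show "set_integrable lborel (cbox 0 L) (\<lambda>x. e / (m + 1) * norm (f x))"
        using set_integrable_norm[OF fi] by simp
      fix x assume "x \<in> cbox 0 L"
      then have *: "\<bar>\<phi> (torus_embedding L x) - p (torus_embedding L x)\<bar> \<le> e / (m + 1)"
        using p(2)[OF imageI] by (simp add: less_imp_le)
      have "norm (f x * of_real (\<phi> (torus_embedding L x)) - f x * of_real (p (torus_embedding L x)))
        = norm (f x) * \<bar>\<phi> (torus_embedding L x) - p (torus_embedding L x)\<bar>"
        by (simp only: right_diff_distrib[symmetric] of_real_diff[symmetric] norm_mult norm_of_real)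
      then show "norm (f x * of_real (\<phi> (torus_embedding L x)) - f x * of_real (p (torus_embedding L x)))
          \<le> e / (m + 1) * norm (f x)"
        using * by (simp only: mult.commute[of "norm (f x)"]) (rule mult_right_mono, auto)
    qed (intro set_integrable_norm set_integral_diff(1)[OF i\<phi> ip])
    also have "\<dots> = e / (m + 1) * m" by (simp add: m_def)
    also have "\<dots> \<le> e" using e m by (simp add: field_simps)
    finally show ?thesis .
  qed
  then have "norm (LINT x:cbox 0 L|lborel. f x * of_real (\<phi> (torus_embedding L x))) \<le> 0"
    by (rule field_le_epsilon[of _ 0, simplified])
  then show ?thesis by simp
qed

text \<open>
  Only points of the boundary of the box are identified by the embedding, and an interior point is
  identified with no other point of the closed box.
\<close>

lemma torus_embedding_inj:
  fixes L :: "'e::euclidean_space"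
  assumes L: "\<And>b. b \<in> Basis \<Longrightarrow> 0 < L \<bullet> b"
    and x: "x \<in> box 0 L" and y: "y \<in> cbox 0 L" and eq: "torus_embedding L x = torus_embedding L y"
  shows "x = y"
proof (rule euclidean_eqI)
  fix b :: 'e assume b: "b \<in> Basis"
  let ?\<theta> = "\<lambda>x. 2 * pi * (x \<bullet> b) / (L \<bullet> b)"
  have "fst (torus_embedding L x) \<bullet> b = fst (torus_embedding L y) \<bullet> b"
    "snd (torus_embedding L x) \<bullet> b = snd (torus_embedding L y) \<bullet> b" by (simp_all add: eq)
  then have "sin (?\<theta> x) = sin (?\<theta> y) \<and> cos (?\<theta> x) = cos (?\<theta> y)"
    using b by (simp add: torus_embedding_def inner_sum_left_Basis)
  then obtain m :: int where m: "?\<theta> x = ?\<theta> y + 2 * pi * m" by (auto simp only: sin_cos_eq_iff)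
  have "2 * pi * (x \<bullet> b) = 2 * pi * (y \<bullet> b + m * (L \<bullet> b))"
    using m L[OF b] by (simp add: field_simps)
  then have xy: "x \<bullet> b = y \<bullet> b + m * (L \<bullet> b)" by simp
  have "0 < x \<bullet> b" "x \<bullet> b < L \<bullet> b" "0 \<le> y \<bullet> b" "y \<bullet> b \<le> L \<bullet> b"
    using x y b by (auto simp: mem_box)
  with xy have "real_of_int m * (L \<bullet> b) < 1 * (L \<bullet> b)" "(-1) * (L \<bullet> b) < real_of_int m * (L \<bullet> b)"
    by linarith+
  then have "m < 1" "-1 < m" using L[OF b] by (simp_all only: mult_less_cancel_right_pos of_int_less_1_iff)
  then have "m = 0" by simp
  then show "x \<bullet> b = y \<bullet> b" using xy by simp
qed

text \<open>
  Uniqueness of Fourier coefficients. The indicator of a closed set \<open>C\<close> is, up to the boundary of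
  the box, the pointwise limit of continuous functions on the embedded torus; so the integral of
  \<open>f\<close> over every closed set vanishes, and by a Dynkin argument that over every Borel set.
\<close>

theorem null_spectrum_AE_zero:
  fixes L :: "'e::euclidean_space"
  assumes L: "\<And>b. b \<in> Basis \<Longrightarrow> 0 < L \<bullet> b" and f: "null_spectrum L f"
  shows "AE x in lborel. x \<in> cbox 0 L \<longrightarrow> f x = 0"
proof -
  define F where "F x = indicat_real (cbox 0 L) x *\<^sub>R f x" for x
  have F: "integrable lborel F" using f by (simp add: F_def[abs_def] null_spectrum_def set_integrable_def)
  then have [measurable]: "F \<in> borel_measurable borel" by auto
  have F0: "integral\<^sup>L lborel F = 0"
    using null_spectrum_continuous[OF L f, of "\<lambda>_. 1"] by (simp add: F_def[abs_def] set_lebesgue_integral_def)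
  have closed: "(LINT x:C|lborel. F x) = 0" if C: "closed C" for C
  proof (cases "C \<inter> cbox 0 L = {}")
    case True
    then have "(\<lambda>x. indicat_real C x *\<^sub>R F x) = (\<lambda>x. 0)"
      by (intro ext) (auto simp: F_def indicator_def)
    then show ?thesis by (simp only: set_lebesgue_integral_def integral_zero)
  next
    case False
    define A where "A = torus_embedding L ` (C \<inter> cbox 0 L)"
    have A: "closed A" "A \<noteq> {}" unfolding A_def
      using False by (auto intro!: compact_imp_closed compact_continuous_image
        continuous_on_torus_embedding closed_Int_compact C)
    \<comment> \<open>These functions decrease to the indicator of \<open>A\<close>, because \<open>A\<close> is closed.\<close>
    define \<phi> where "\<phi> j z = max 0 (1 - real j * infdist z A)" for j z
    have \<phi>: "continuous_on UNIV (\<phi> j)" for j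
      unfolding \<phi>_def by (intro continuous_intros)
    have [measurable]: "(\<lambda>x. complex_of_real (\<phi> j (torus_embedding L x))) \<in> borel_measurable borel" for j
      by (intro borel_measurable_continuous_onI continuous_intros
          continuous_on_compose2[OF \<phi> continuous_on_torus_embedding]) auto
    have [measurable]: "C \<in> sets borel" using C by auto
    have "(\<lambda>j. \<integral>x. F x * of_real (\<phi> j (torus_embedding L x)) \<partial>lborel)
        \<longlonglongrightarrow> (\<integral>x. indicat_real C x *\<^sub>R F x \<partial>lborel)"
    proof (rule integral_dominated_convergence)
      show "integrable lborel (\<lambda>x. norm (F x))" using F by simp
      show "AE x in lborel. norm (F x * of_real (\<phi> j (torus_embedding L x))) \<le> norm (F x)" for j
        by (intro AE_I2) (auto simp: norm_mult \<phi>_def infdist_nonneg intro!: mult_left_le)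
      have "AE x in lborel. x \<notin> cbox 0 L - box 0 L"
        by (rule AE_not_in[OF null_sets_cbox_Diff_box])
      then show "AE x in lborel. (\<lambda>j. F x * of_real (\<phi> j (torus_embedding L x))) \<longlonglongrightarrow> indicat_real C x *\<^sub>R F x"
      proof eventually_elim
        case (elim x)
        show ?case
        proof (cases "x \<in> box 0 L")
          case True
          show ?thesis
          proof (cases "x \<in> C")
            case True
            then have "torus_embedding L x \<in> A" using \<open>x \<in> box 0 L\<close> box_subset_cbox by (auto simp: A_def)
            then show ?thesis using True by (simp add: \<phi>_def)
          next
            case False
            have "torus_embedding L x \<notin> A"
              using torus_embedding_inj[OF L \<open>x \<in> box 0 L\<close>] False by (auto simp: A_def)
            then have d: "0 < infdist (torus_embedding L x) A"
              using A in_closed_iff_infdist_zero infdist_nonneg[of _ A] by (metis less_eq_real_def)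
            obtain N :: nat where N: "1 < N * infdist (torus_embedding L x) A"
              using reals_Archimedean3[OF d] by blast
            have "\<phi> j (torus_embedding L x) = 0" if "N \<le> j" for j
            proof -
              have "N * infdist (torus_embedding L x) A \<le> j * infdist (torus_embedding L x) A"
                using that d by (intro mult_right_mono) auto
              with N show ?thesis by (simp add: \<phi>_def)
            qed
            then have "\<forall>\<^sub>F j in sequentially. F x * of_real (\<phi> j (torus_embedding L x)) = 0"
              by (auto simp: eventually_sequentially)
            then show ?thesis using False by (simp add: tendsto_eventually)
          qed
        next
          case False
          then show ?thesis using elim by (simp add: F_def)
        qed
      qed
    qed measurable
    moreover have "(\<integral>x. F x * of_real (\<phi> j (torus_embedding L x)) \<partial>lborel) = 0" for j
      using null_spectrum_continuous[OF L f \<phi>, of j] by (simp add: F_def[abs_def] set_lebesgue_integral_def)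
    ultimately show ?thesis
      by (simp add: set_lebesgue_integral_def LIMSEQ_const_iff)
  qed
  have "(LINT x:A|lborel. F x) = 0" if "A \<in> sets borel" for A
  proof -
    have "Int_stable (Collect closed :: 'e set set)" "Collect closed \<subseteq> Pow (UNIV :: 'e set)"
      "A \<in> sigma_sets UNIV (Collect closed)"
      using that by (auto simp: Int_stable_def borel_eq_closed)
    then show ?thesis
    proof (induction rule: sigma_sets_induct_disjoint)
      case (compl B)
      have B: "B \<in> sets borel" using compl(1) by (simp add: borel_eq_closed)
      have "(LINT x:UNIV - B|lborel. F x) = (\<integral>x. F x - indicat_real B x *\<^sub>R F x \<partial>lborel)"
        unfolding set_lebesgue_integral_def
        by (intro Bochner_Integration.integral_cong) (auto simp: indicator_def)
      also have "\<dots> = integral\<^sup>L lborel F - (LINT x:B|lborel. F x)"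
        unfolding set_lebesgue_integral_def
        by (intro Bochner_Integration.integral_diff F integrable_mult_indicator) (use B in auto)
      also have "\<dots> = 0" using compl(2) F0 by simp
      finally show ?case .
    next
      case (union B)
      have B: "B i \<in> sets borel" for i using union(2) by (auto simp: borel_eq_closed)
      have "set_integrable lborel (\<Union>i. B i) F" unfolding set_integrable_def
        using B F by (intro integrable_mult_indicator) auto
      then have "(LINT x:(\<Union>i. B i)|lborel. F x) = (\<Sum>i. LINT x:B i|lborel. F x)"
        using B union(1) by (intro lebesgue_integral_countable_add) (auto simp: disjoint_family_on_def)
      then show ?case using union(3) by simp
    next
      case (basic B)
      then show ?case by (simp add: closed)
    qed (simp add: set_lebesgue_integral_def)
  qed
  then have "AE x in lborel. F x = 0" by (intro sigma_finite_measure.density_zero[OF lborel.sigma_finite_measure_axioms F]) auto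
  then show ?thesis by eventually_elim (auto simp: F_def)
qed


section \<open>Fourier series on the three-dimensional torus\<close>

lemma prod_Basis_cart: "(\<Prod>b\<in>Basis. f b) = (\<Prod>i\<in>UNIV. f (axis i (1::real)))"
  for f :: "real^'n \<Rightarrow> 'b::comm_monoid_mult"
proof -
  have B: "Basis = range (\<lambda>i. axis i (1::real) :: real^'n)" by (auto simp: Basis_vec_def)
  have "inj (\<lambda>i. axis i (1::real) :: real^'n)" by (auto simp: inj_on_def axis_eq_axis)
  then show ?thesis unfolding B by (simp add: prod.reindex)
qed

lemma periods_pos:
  fixes a :: "real^'n"
  assumes "\<And>i. 0 < a $ i" and "b \<in> Basis"
  shows "0 < ((2 * pi) *\<^sub>R a) \<bullet> b"
  using assms by (auto simp: Basis_vec_def inner_axis)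

lemma freq_add: "freq a (n + m) = freq a n + freq a m"
  by (simp add: freq_def vec_eq_iff add_divide_distrib)

lemma freq_uminus: "freq a (- n) = - freq a n"
  by (simp add: freq_def vec_eq_iff)

lemma freq_diff: "freq a (n - m) = freq a n - freq a m"
  using freq_add[of a n "- m"] by (simp add: freq_uminus)

lemma freq_eq_iff:
  assumes "\<And>i. 0 < a $ i"
  shows "freq a n = freq a m \<longleftrightarrow> n = m"
  using assms by (auto simp: freq_def vec_eq_iff) (metis less_irrefl)

lemma range_freq:
  assumes a: "\<And>i. 0 < a $ i"
  shows "range (freq a) = dual_lattice ((2 * pi) *\<^sub>R a)"
proof (intro equalityI subsetI)
  fix \<kappa> assume "\<kappa> \<in> range (freq a)"
  then show "\<kappa> \<in> dual_lattice ((2 * pi) *\<^sub>R a)"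
    using a by (auto simp: dual_lattice_def freq_def Basis_vec_def inner_axis less_imp_neq[symmetric])
next
  fix \<kappa> assume "\<kappa> \<in> dual_lattice ((2 * pi) *\<^sub>R a)"
  then have "\<exists>m::int. \<kappa> $ i * (2 * pi * a $ i) = 2 * pi * m" for i
    by (auto simp: dual_lattice_def Basis_vec_def inner_axis)
  then obtain m :: "3 \<Rightarrow> int" where "\<And>i. \<kappa> $ i * (2 * pi * a $ i) = 2 * pi * m i" by metis
  then have "2 * pi * (\<kappa> $ i * a $ i) = 2 * pi * m i" for i by (simp add: mult_ac)
  then have "\<kappa> $ i * a $ i = m i" for i by simp
  then have "\<kappa> = freq a (\<chi> i. m i)"
    using a less_imp_neq[OF a] by (auto simp: freq_def vec_eq_iff field_simps)
  then show "\<kappa> \<in> range (freq a)" by simp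
qed

lemma freq_in_dual_lattice: "(\<And>i. 0 < a $ i) \<Longrightarrow> freq a n \<in> dual_lattice ((2 * pi) *\<^sub>R a)"
  using range_freq by blast

lemma fcoef_trig_series:
  fixes a :: "real^3" and m :: "'i \<Rightarrow> int^3"
  assumes a: "\<And>i. 0 < a $ i" and c: "(\<lambda>i. norm (c i)) summable_on UNIV"
    and f: "\<And>x. complex_of_real (f x) = (\<Sum>\<^sub>\<infinity>i. c i * cis (freq a (m i) \<bullet> x))"
  shows "fcoef a f n = (\<Sum>\<^sub>\<infinity>i\<in>{i. m i = n}. c i)"
proof -
  have "(\<Prod>b\<in>Basis. ((2 * pi) *\<^sub>R a) \<bullet> b) = (\<Prod>i\<in>UNIV. 2 * pi * a $ i)"
    by (simp add: prod_Basis_cart inner_axis)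
  moreover have "(\<Prod>i\<in>UNIV. 2 * pi * a $ i) \<noteq> 0" using less_imp_neq[OF a] by simp
  ultimately show ?thesis
    using trig_series_coefficient[of "(2 * pi) *\<^sub>R a" "\<lambda>i. freq a (m i)" "freq a n" c]
      periods_pos[OF a] freq_in_dual_lattice[OF a] c
    by (simp add: fcoef_def torus_mean_def torus_cell_def f freq_eq_iff[OF a] scaleR_conv_of_real)
qed

lemma torus_periodic_shift:
  fixes a :: "real^'n"
  assumes p: "torus_periodic a f"
  shows "f (x + (\<chi> i. of_int (m i) * (2 * pi * a $ i))) = f x"
proof -
  have nat: "f (x + axis i (of_nat j * (2 * pi * a $ i))) = f x" for i x j
  proof (induction j)
    case (Suc j)
    have "x + axis i (of_nat (Suc j) * (2 * pi * a $ i))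
        = (x + axis i (of_nat j * (2 * pi * a $ i))) + axis i (2 * pi * a $ i)"
      by (simp add: vec_eq_iff axis_def algebra_simps)
    then show ?case using p Suc by (simp only: torus_periodic_def)
  next
    case 0
    have "axis i 0 = (0 :: real^'n)" by (simp add: vec_eq_iff axis_def)
    then show ?case by (simp only: of_nat_0 mult_zero_left add_0_right)
  qed
  have int: "f (x + axis i (of_int j * (2 * pi * a $ i))) = f x" for i x j
  proof (cases j rule: int_cases2)
    case (nonneg k)
    then show ?thesis using nat[of x i k] by simp
  next
    case (nonpos k)
    have "x + axis i (of_int j * (2 * pi * a $ i)) + axis i (of_nat k * (2 * pi * a $ i)) = x"
      by (simp add: nonpos vec_eq_iff axis_def)
    then show ?thesis using nat[of "x + axis i (of_int j * (2 * pi * a $ i))" i k] by (simp only:)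
  qed
  have "f (x + (\<Sum>i\<in>A. axis i (of_int (m i) * (2 * pi * a $ i)))) = f x" if "finite A" for A
    using that
  proof (induction A)
    case (insert i A)
    have "f (x + (\<Sum>i\<in>insert i A. axis i (of_int (m i) * (2 * pi * a $ i))))
        = f ((x + (\<Sum>i\<in>A. axis i (of_int (m i) * (2 * pi * a $ i)))) + axis i (of_int (m i) * (2 * pi * a $ i)))"
      using insert.hyps by (simp add: add_ac)
    then show ?case by (simp only: int insert.IH)
  qed simp
  moreover have "(\<Sum>i\<in>UNIV. axis i (of_int (m i) * (2 * pi * a $ i)))
      = (\<chi> i. of_int (m i) * (2 * pi * a $ i))"
    by (simp add: vec_eq_iff axis_def)
  ultimately show ?thesis by (metis finite)
qed

lemma torus_periodic_zero:
  fixes a :: "real^'n"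
  assumes a: "\<And>i. 0 < a $ i" and p: "torus_periodic a f"
    and z: "\<And>x. x \<in> torus_cell a \<Longrightarrow> f x = 0"
  shows "f x = 0"
proof -
  define m where "m i = - \<lfloor>x $ i / (2 * pi * a $ i)\<rfloor>" for i
  have "x + (\<chi> i. of_int (m i) * (2 * pi * a $ i)) \<in> torus_cell a"
    unfolding torus_cell_def mem_box_cart
  proof safe
    fix i
    let ?l = "2 * pi * a $ i"
    have l: "0 < ?l" using a by simp
    have "real_of_int \<lfloor>x $ i / ?l\<rfloor> \<le> x $ i / ?l" "x $ i / ?l \<le> real_of_int \<lfloor>x $ i / ?l\<rfloor> + 1"
      by linarith+
    then have "real_of_int \<lfloor>x $ i / ?l\<rfloor> * ?l \<le> x $ i" "x $ i \<le> (real_of_int \<lfloor>x $ i / ?l\<rfloor> + 1) * ?l"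
      unfolding pos_le_divide_eq[OF l] pos_divide_le_eq[OF l] .
    then show "(0::real^'n) $ i \<le> (x + (\<chi> i. of_int (m i) * (2 * pi * a $ i))) $ i"
      "(x + (\<chi> i. of_int (m i) * (2 * pi * a $ i))) $ i \<le> ((2 * pi) *\<^sub>R a) $ i"
      by (simp_all add: m_def algebra_simps)
  qed
  then show ?thesis using z torus_periodic_shift[OF p, of x m] by metis
qed

lemma cis_freq_periodic:
  assumes a: "\<And>i. 0 < a $ i"
  shows "cis (freq a n \<bullet> (x + axis i (2 * pi * a $ i))) = cis (freq a n \<bullet> x)"
proof -
  have "freq a n \<bullet> axis i (2 * pi * a $ i) = 2 * pi * of_int (n $ i)"
    using a[of i] by (simp add: inner_axis freq_def)
  then show ?thesis
    by (simp add: inner_add_right flip: cis_mult)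
qed

text \<open>
  The difference of the function and its Fourier series is continuous and has zero coefficients;
  it vanishes almost everywhere on a cell, hence on the closed cell by continuity and everywhere
  by periodicity.
\<close>

lemma fourier_inversion:
  fixes f :: "real^3 \<Rightarrow> real"
  assumes a: "\<And>i. 0 < a $ i" and f: "continuous_on UNIV f" and p: "torus_periodic a f"
    and s: "(\<lambda>n. norm (fcoef a f n)) summable_on UNIV"
  shows "complex_of_real (f x) = (\<Sum>\<^sub>\<infinity>n. fcoef a f n * cis (freq a n \<bullet> x))"
proof -
  let ?L = "(2 * pi) *\<^sub>R a"
  define g where "g x = (\<Sum>\<^sub>\<infinity>n. fcoef a f n * cis (freq a n \<bullet> x))" for x
  define h where "h x = complex_of_real (f x) - g x" for x
  have g: "continuous_on UNIV g" unfolding g_def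
    by (rule continuous_on_infsum[OF _ _ s]) (auto intro!: continuous_intros simp: norm_mult)
  have h: "continuous_on UNIV h" unfolding h_def by (intro continuous_intros f g)
  have L: "\<And>b. b \<in> Basis \<Longrightarrow> 0 < ?L \<bullet> b" using a by (rule periods_pos)
  have pp: "(\<Prod>b\<in>Basis. ?L \<bullet> b) = (\<Prod>i\<in>UNIV. 2 * pi * a $ i)" "(\<Prod>i\<in>UNIV. 2 * pi * a $ i) \<noteq> 0"
    using less_imp_neq[OF a] by (simp_all add: prod_Basis_cart inner_axis)
  have "null_spectrum ?L h"
    unfolding null_spectrum_def
  proof (intro conjI ballI)
    show "set_integrable lborel (cbox 0 ?L) h"
      by (intro set_integrable_compact continuous_on_subset[OF h]) auto
    fix \<kappa> assume \<kappa>: "\<kappa> \<in> dual_lattice ?L"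
    then obtain n where n: "- \<kappa> = freq a n"
      using dual_lattice_minus range_freq[OF a] by (metis imageE)
    have si: "set_integrable lborel (cbox 0 ?L) (\<lambda>x. u x * cis (\<kappa> \<bullet> x))" if "continuous_on UNIV u" for u
      by (intro set_integrable_compact continuous_intros continuous_on_subset[OF that]) auto
    have "(LINT x:cbox 0 ?L|lborel. h x * cis (\<kappa> \<bullet> x)) =
        (LINT x:cbox 0 ?L|lborel. of_real (f x) * cis (\<kappa> \<bullet> x)) - (LINT x:cbox 0 ?L|lborel. g x * cis (\<kappa> \<bullet> x))"
      unfolding h_def left_diff_distrib
      by (intro set_integral_diff si g continuous_intros f)
    also have "(LINT x:cbox 0 ?L|lborel. g x * cis (\<kappa> \<bullet> x)) = fcoef a f n * of_real (\<Prod>b\<in>Basis. ?L \<bullet> b)"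
    proof -
      have "{i. freq a i = - \<kappa>} = {n}" using n freq_eq_iff[OF a] by auto
      then show ?thesis
        using trig_series_coefficient[OF L freq_in_dual_lattice[OF a] dual_lattice_minus[OF \<kappa>] s, of "\<lambda>n. n"]
        by (simp add: g_def)
    qed
    also have "(LINT x:cbox 0 ?L|lborel. of_real (f x) * cis (\<kappa> \<bullet> x)) = fcoef a f n * of_real (\<Prod>b\<in>Basis. ?L \<bullet> b)"
      using pp by (simp add: fcoef_def torus_mean_def torus_cell_def scaleR_conv_of_real n[symmetric])
    finally show "(LINT x:cbox 0 ?L|lborel. h x * cis (\<kappa> \<bullet> x)) = 0" by simp
  qed
  then have ae: "AE x in lborel. x \<in> cbox 0 ?L \<longrightarrow> h x = 0" using null_spectrum_AE_zero L by blast
  have op: "open {x \<in> box 0 ?L. h x \<noteq> 0}"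
    using open_Int[OF open_box open_Collect_neq[OF h continuous_on_const], of 0 ?L 0] by (simp add: Int_def)
  have "{x \<in> box 0 ?L. h x \<noteq> 0} \<in> null_sets lborel"
    using ae op box_subset_cbox[of 0 ?L] by (intro AE_iff_null_sets[THEN iffD2]) (auto elim!: eventually_mono)
  then have "negligible {x \<in> box 0 ?L. h x \<noteq> 0}"
    by (simp add: negligible_iff_null_sets null_sets_completionI)
  then have "{x \<in> box 0 ?L. h x \<noteq> 0} = {}" using open_not_negligible[OF op] by blast
  then have "box 0 ?L \<subseteq> {x. h x = 0}" by blast
  moreover have "closed {x. h x = 0}" by (intro closed_Collect_eq h continuous_intros)
  moreover have "closure (box 0 ?L) = cbox 0 ?L"
    using L by (intro closure_box) (auto simp: box_ne_empty)
  ultimately have "h x = 0" if "x \<in> torus_cell a" for x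
    using that closure_minimal unfolding torus_cell_def by blast
  moreover have "torus_periodic a h"
    using p by (simp add: torus_periodic_def h_def g_def cis_freq_periodic[OF a])
  ultimately have "h x = 0" using torus_periodic_zero[OF a, of h] by metis
  then show ?thesis by (simp add: h_def g_def)
qed


section \<open>Fields with absolutely convergent Fourier series\<close>

text \<open>
  The equality is between functions at every point, with complex values on both sides, so that
  series may be multiplied and differentiated without taking real parts.
\<close>

definition has_fourier :: "real^3 \<Rightarrow> field \<Rightarrow> (int^3 \<Rightarrow> complex^4) \<Rightarrow> bool" where
  "has_fourier a W c \<longleftrightarrow> (\<lambda>n. norm (c n)) summable_on UNIV \<and>
     (\<forall>x l. complex_of_real (W x $ l) = (\<Sum>\<^sub>\<infinity>n. c n $ l * cis (freq a n \<bullet> x)))"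

lemmas norm_component_le = Finite_Cartesian_Product.norm_nth_le

lemma has_fourier_summable_nth:
  assumes "has_fourier a W c"
  shows "(\<lambda>n. norm (c n $ l)) summable_on UNIV"
  by (rule summable_on_bound(2)[where M = "\<lambda>n. norm (c n)"])
    (use assms in \<open>auto simp: has_fourier_def norm_component_le\<close>)

lemma has_fourier_has_sum:
  assumes "has_fourier a W c"
  shows "((\<lambda>n. c n $ l * cis (freq a n \<bullet> x)) has_sum complex_of_real (W x $ l)) UNIV"
proof -
  have "(\<lambda>n. c n $ l * cis (freq a n \<bullet> x)) summable_on UNIV"
    by (rule summable_on_bound[OF _ has_fourier_summable_nth[OF assms, of l]]) (simp add: norm_mult)
  then show ?thesis using assms by (simp add: has_fourier_def has_sum_infsum)
qed

lemma vcoef_has_fourier: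
  assumes a: "\<And>i. 0 < a $ i" and W: "has_fourier a W c"
  shows "vcoef a W = c"
proof -
  have "fcoef a (\<lambda>x. W x $ l) n = c n $ l" for n l
    using W by (subst fcoef_trig_series[OF a has_fourier_summable_nth[OF W, of l], where m = "\<lambda>n. n"])
      (auto simp: has_fourier_def)
  then show ?thesis by (simp add: fun_eq_iff vec_eq_iff vcoef_def)
qed

lemma has_fourier_continuous:
  assumes W: "has_fourier a W c"
  shows "continuous_on UNIV W"
proof -
  have "continuous_on UNIV (\<lambda>x. \<Sum>\<^sub>\<infinity>n. c n $ l * cis (freq a n \<bullet> x))" for l
    by (rule continuous_on_infsum[OF _ _ has_fourier_summable_nth[OF W]])
      (auto intro!: continuous_intros simp: norm_mult)
  then have "continuous_on UNIV (\<lambda>x. complex_of_real (W x $ l))" for l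
    using W by (simp add: has_fourier_def)
  from continuous_on_Re[OF this] have "continuous_on UNIV (\<lambda>x. W x $ l)" for l by simp
  then show ?thesis using continuous_on_vec_lambda[of UNIV "\<lambda>l x. W x $ l"] by simp
qed

lemma fcoef_uminus_freq: "fcoef a f (- n) = cnj (fcoef a f n)"
proof -
  have "(LINT x:torus_cell a|lborel. complex_of_real (f x) * cis (- (freq a (- n) \<bullet> x)))
      = cnj (LINT x:torus_cell a|lborel. complex_of_real (f x) * cis (- (freq a n \<bullet> x)))"
    unfolding set_lebesgue_integral_def
    by (simp add: freq_uminus cis_cnj flip: Bochner_Integration.integral_cnj)
  then show ?thesis by (simp add: fcoef_def torus_mean_def)
qed

lemma has_fourier_cnj:
  assumes a: "\<And>i. 0 < a $ i" and W: "has_fourier a W c"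
  shows "c (- n) $ l = cnj (c n $ l)"
  unfolding vcoef_has_fourier[OF a W, symmetric] by (simp add: vcoef_def fcoef_uminus_freq)

text \<open>
  Taking the real part in \<open>fourier_series\<close> is harmless because the conjugate symmetry of the
  coefficients makes the sum real.
\<close>

lemma has_fourier_fourier_series:
  assumes s: "(\<lambda>n. norm (c n)) summable_on UNIV" and c: "\<And>n l. c (- n) $ l = cnj (c n $ l)"
  shows "has_fourier a (fourier_series a c) c"
proof -
  have "complex_of_real (fourier_series a c x $ l) = (\<Sum>\<^sub>\<infinity>n. c n $ l * cis (freq a n \<bullet> x))" for x l
  proof -
    let ?f = "\<lambda>n. c n $ l * cis (freq a n \<bullet> x)"
    have "cnj (infsum ?f UNIV) = (\<Sum>\<^sub>\<infinity>n. cnj (?f n))" by (rule infsum_cnj[symmetric])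
    also have "\<dots> = (\<Sum>\<^sub>\<infinity>n. ?f (- n))"
      by (rule infsum_cong) (simp add: c freq_uminus cis_cnj)
    also have "\<dots> = infsum ?f UNIV"
      by (rule infsum_reindex_bij_witness[of _ uminus uminus]) auto
    finally have "infsum ?f UNIV \<in> \<real>" by (simp only: Reals_cnj_iff)
    then show ?thesis by (simp add: fourier_series_def)
  qed
  with s show ?thesis by (simp add: has_fourier_def)
qed

lemma norm_le_sum_nth: "norm (X :: complex^4) \<le> norm (X $ 1) + norm (X $ 2) + norm (X $ 3) + norm (X $ 4)"
  using L2_set_le_sum[of UNIV "\<lambda>i. norm (X $ i)"] by (simp add: norm_vec_def sum_4)

lemma norm_kdot_le: "norm (kdot k X) \<le> 3 * norm k * norm X"
proof -
  have t: "norm (of_real (k $ i) * X $ j) \<le> norm k * norm X" for i j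
    unfolding norm_mult norm_of_real
    by (intro mult_mono component_le_norm_cart norm_component_le) auto
  have "norm (kdot k X) \<le> norm (of_real (k $ 1) * X $ 1) + norm (of_real (k $ 2) * X $ 2)
      + norm (of_real (k $ 3) * X $ 3)"
    unfolding kdot_def by (intro order.trans[OF norm_triangle_ineq] add_mono norm_triangle_ineq) auto
  with t[of 1 1] t[of 2 2] t[of 3 3] show ?thesis by simp
qed

text \<open>
  Since the field is known to be differentiable, its derivative in a direction can be computed
  along a line, where the series is differentiated term by term.
\<close>

lemma has_fourier_directional_derivative:
  assumes W: "has_fourier a W c" and s: "(\<lambda>n. norm (freq a n) * norm (c n)) summable_on UNIV"
    and d: "W differentiable (at x)"
  shows "complex_of_real (frechet_derivative W (at x) h $ l)
    = (\<Sum>\<^sub>\<infinity>n. \<i> * of_real (freq a n \<bullet> h) * c n $ l * cis (freq a n \<bullet> x))"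
proof -
  let ?f = "\<lambda>n r. c n $ l * cis (freq a n \<bullet> (x + r *\<^sub>R h))"
  let ?f' = "\<lambda>n r. \<i> * of_real (freq a n \<bullet> h) * c n $ l * cis (freq a n \<bullet> (x + r *\<^sub>R h))"
  have "((\<lambda>r::real. \<Sum>\<^sub>\<infinity>n. ?f n r) has_vector_derivative (\<Sum>\<^sub>\<infinity>n. ?f' n 0)) (at 0 within UNIV)"
  proof (rule has_vector_derivative_infsum)
    fix n r
    have "((\<lambda>z. c n $ l * exp (\<i> * (of_real (freq a n \<bullet> x) + z * of_real (freq a n \<bullet> h))))
        has_field_derivative ?f' n r) (at (of_real r))"
      by (auto intro!: derivative_eq_intros simp: cis_conv_exp inner_add_right mult_ac)
    from has_vector_derivative_real_field[OF this]
    show "(?f n has_vector_derivative ?f' n r) (at r within UNIV)"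
      by (simp add: cis_conv_exp inner_add_right mult_ac)
    have "\<bar>freq a n \<bullet> h\<bar> * norm (c n $ l) \<le> (norm (freq a n) * norm h) * norm (c n)"
      by (intro mult_mono Cauchy_Schwarz_ineq2 norm_component_le) auto
    then show "norm (?f' n r) \<le> norm h * (norm (freq a n) * norm (c n))"
      by (simp add: norm_mult mult_ac)
    show "(\<lambda>n. ?f n r) summable_on UNIV"
      using has_fourier_has_sum[OF W] by (rule has_sum_imp_summable)
  qed (use s in \<open>auto intro: summable_on_cmult_right\<close>)
  moreover have "(\<Sum>\<^sub>\<infinity>n. ?f n r) = complex_of_real (W (x + r *\<^sub>R h) $ l)" for r
    using W by (simp add: has_fourier_def)
  ultimately have 1: "((\<lambda>r. complex_of_real (W (x + r *\<^sub>R h) $ l)) has_vector_derivative (\<Sum>\<^sub>\<infinity>n. ?f' n 0)) (at 0)"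
    by simp
  have dW: "(W has_derivative frechet_derivative W (at x)) (at (x + 0 *\<^sub>R h))"
    using frechet_derivative_works[THEN iffD1, OF d] by simp
  have dl: "((\<lambda>r. x + r *\<^sub>R h) has_derivative (\<lambda>r. r *\<^sub>R h)) (at 0)"
    by (auto intro!: derivative_eq_intros)
  have "((\<lambda>r. W (x + r *\<^sub>R h)) has_derivative (\<lambda>r. frechet_derivative W (at x) (r *\<^sub>R h))) (at 0)"
    by (rule has_derivative_compose[OF dl dW])
  then have "((\<lambda>r. W (x + r *\<^sub>R h)) has_vector_derivative frechet_derivative W (at x) h) (at 0)"
    using linear_frechet_derivative[OF d] by (simp add: has_vector_derivative_def linear_cmul)
  moreover have "bounded_linear (\<lambda>x :: real^4. complex_of_real (x $ l))"
    by (rule bounded_linear_compose[OF bounded_linear_of_real bounded_linear_vec_nth])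
  ultimately have "((\<lambda>r. complex_of_real (W (x + r *\<^sub>R h) $ l)) has_vector_derivative of_real (frechet_derivative W (at x) h $ l)) (at 0)"
    by (rule bounded_linear.has_vector_derivative[rotated])
  from vector_derivative_unique_at[OF this 1] show ?thesis by simp
qed

text \<open>
  The coefficients of \<open>v \<cdot> \<nabla>V\<close> as a convolution. Because \<open>kdot (freq a m) (c m) = 0\<close>, the frequency
  \<open>freq a (n - m)\<close> produced by the gradient may be replaced by \<open>freq a n\<close>: the convection term is a
  divergence.
\<close>

lemma convection_fourier_coefficients:
  assumes a: "\<And>i. 0 < a $ i" and W: "has_fourier a W c"
    and s: "(\<lambda>n. norm (freq a n) * norm (c n)) summable_on UNIV"
    and d: "\<And>x. W differentiable (at x)" and div: "\<And>n. kdot (freq a n) (c n) = 0"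
  shows "(\<lambda>m. kdot (freq a n) (c m) * c (n - m) $ l) summable_on UNIV"
    "vcoef a (convection W) n $ l = \<i> * (\<Sum>\<^sub>\<infinity>m. kdot (freq a n) (c m) * c (n - m) $ l)"
proof -
  let ?b = "\<lambda>z. \<i> * (kdot (freq a (fst z)) (c (snd z)) * c (fst z) $ l)"
  let ?M = "\<lambda>z. 3 * (norm (freq a (fst z)) * norm (c (fst z))) * norm (c (snd z))"
  have cs: "(\<lambda>n. norm (c n)) summable_on UNIV" using W by (simp add: has_fourier_def)
  have M: "?M summable_on UNIV"
  proof -
    have "(\<lambda>z. norm (?M z)) summable_on Sigma UNIV (\<lambda>_. UNIV)"
    proof (rule Infinite_Sum.abs_summable_on_Sigma_iff[THEN iffD2], intro conjI ballI)
      show "(\<lambda>m. norm (?M (p, m))) summable_on UNIV" for p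
        by (simp add: abs_mult summable_on_cmult_right cs)
      show "(\<lambda>p. norm (\<Sum>\<^sub>\<infinity>m. norm (?M (p, m)))) summable_on UNIV"
        using summable_on_cmult_left[OF summable_on_cmult_right[OF s, of 3]]
        by (simp add: abs_mult infsum_cmult_right')
    qed
    then show ?thesis by (simp add: abs_mult)
  qed
  have bM: "norm (?b z) \<le> ?M z" for z
  proof -
    have "norm (kdot (freq a (fst z)) (c (snd z))) * norm (c (fst z) $ l)
        \<le> (3 * norm (freq a (fst z)) * norm (c (snd z))) * norm (c (fst z))"
      by (intro mult_mono norm_kdot_le norm_component_le) auto
    then show ?thesis by (simp add: norm_mult mult_ac)
  qed
  have b: "(\<lambda>z. norm (?b z)) summable_on UNIV"
    by (rule summable_on_bound(2)[OF _ M]) (rule bM)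
  have conv: "complex_of_real (convection W x $ l) = (\<Sum>\<^sub>\<infinity>z. ?b z * cis (freq a (fst z + snd z) \<bullet> x))" for x
  proof -
    have vel: "of_real (freq a p \<bullet> velocity W x) = (\<Sum>\<^sub>\<infinity>m. kdot (freq a p) (c m) * cis (freq a m \<bullet> x))" for p
    proof -
      have "((\<lambda>m. of_real (freq a p $ 1) * (c m $ 1 * cis (freq a m \<bullet> x)) + of_real (freq a p $ 2) * (c m $ 2 * cis (freq a m \<bullet> x))
          + of_real (freq a p $ 3) * (c m $ 3 * cis (freq a m \<bullet> x))) has_sum
        (of_real (freq a p $ 1) * of_real (W x $ 1) + of_real (freq a p $ 2) * of_real (W x $ 2)
          + of_real (freq a p $ 3) * of_real (W x $ 3))) UNIV"
        by (intro has_sum_add has_sum_cmult_right has_fourier_has_sum W)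
      from infsumI[OF this] show ?thesis
        by (simp add: velocity_def inner_vec_def sum_3 kdot_def distrib_right mult.assoc)
    qed
    have "(\<lambda>z. ?b z * cis (freq a (fst z + snd z) \<bullet> x)) summable_on UNIV"
      by (rule summable_on_bound(1)[OF _ b]) (simp add: norm_mult)
    then have "(\<Sum>\<^sub>\<infinity>z. ?b z * cis (freq a (fst z + snd z) \<bullet> x))
        = (\<Sum>\<^sub>\<infinity>p. \<Sum>\<^sub>\<infinity>m. ?b (p, m) * cis (freq a (p + m) \<bullet> x))"
      using infsum_Sigma'_banach[of "\<lambda>p m. ?b (p, m) * cis (freq a (p + m) \<bullet> x)" UNIV "\<lambda>_. UNIV"]
      by (simp add: case_prod_unfold)
    also have "\<dots> = (\<Sum>\<^sub>\<infinity>p. \<i> * of_real (freq a p \<bullet> velocity W x) * c p $ l * cis (freq a p \<bullet> x))"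
    proof (rule infsum_cong)
      fix p
      have "(\<Sum>\<^sub>\<infinity>m. ?b (p, m) * cis (freq a (p + m) \<bullet> x))
        = (\<Sum>\<^sub>\<infinity>m. (\<i> * c p $ l * cis (freq a p \<bullet> x)) * (kdot (freq a p) (c m) * cis (freq a m \<bullet> x)))"
        by (rule infsum_cong) (simp add: freq_add inner_add_left mult_ac flip: cis_mult)
      also have "\<dots> = (\<i> * c p $ l * cis (freq a p \<bullet> x)) * of_real (freq a p \<bullet> velocity W x)"
        unfolding vel by (rule infsum_cmult_right')
      finally show "(\<Sum>\<^sub>\<infinity>m. ?b (p, m) * cis (freq a (p + m) \<bullet> x))
          = \<i> * of_real (freq a p \<bullet> velocity W x) * c p $ l * cis (freq a p \<bullet> x)"
        by (simp only: mult_ac)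
    qed
    also have "\<dots> = complex_of_real (convection W x $ l)"
      unfolding convection_def by (rule has_fourier_directional_derivative[OF W s d, symmetric])
    finally show ?thesis ..
  qed
  have bij: "bij_betw (\<lambda>m. (n - m, m)) UNIV {z. fst z + snd z = n}"
    by (rule bij_betw_byWitness[where f' = snd]) auto
  have bn: "?b (n - m, m) = \<i> * (kdot (freq a n) (c m) * c (n - m) $ l)" for m
  proof -
    have "kdot (freq a (n - m)) (c m) = kdot (freq a n) (c m) - kdot (freq a m) (c m)"
      by (simp add: kdot_def freq_diff algebra_simps)
    then show ?thesis by (simp add: div)
  qed
  have "vcoef a (convection W) n $ l = infsum ?b {z. fst z + snd z = n}"
    unfolding vcoef_def vec_lambda_beta by (rule fcoef_trig_series[OF a b conv])
  also have "\<dots> = (\<Sum>\<^sub>\<infinity>m. ?b (n - m, m))"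
    by (rule infsum_reindex_bij_betw[OF bij, symmetric])
  also have "\<dots> = \<i> * (\<Sum>\<^sub>\<infinity>m. kdot (freq a n) (c m) * c (n - m) $ l)"
    unfolding bn by (rule infsum_cmult_right')
  finally show "vcoef a (convection W) n $ l = \<i> * (\<Sum>\<^sub>\<infinity>m. kdot (freq a n) (c m) * c (n - m) $ l)" .
  have "?b summable_on {z. fst z + snd z = n}"
    by (rule summable_on_subset_banach[OF abs_summable_summable[OF b]]) simp
  then have "(\<lambda>m. ?b (n - m, m)) summable_on UNIV"
    by (subst summable_on_reindex_bij_betw[OF bij])
  then have "(\<lambda>m. - \<i> * ?b (n - m, m)) summable_on UNIV" by (rule summable_on_cmult_right)
  then show "(\<lambda>m. kdot (freq a n) (c m) * c (n - m) $ l) summable_on UNIV"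
    unfolding bn by simp
qed


section \<open>The filtering group, mode by mode\<close>

lemma vector_4 [simp]:
  "(vector [x, y, z, w] :: 'a::zero^4) $ 1 = x"
  "(vector [x, y, z, w] :: 'a::zero^4) $ 2 = y"
  "(vector [x, y, z, w] :: 'a::zero^4) $ 3 = z"
  "(vector [x, y, z, w] :: 'a::zero^4) $ 4 = w"
  unfolding vector_def by simp_all

definition skew_symbol :: "complex^4 \<Rightarrow> complex^4" where
  "skew_symbol X = vector [0, 0, X $ 4, - (X $ 3)]"

lemma norm_skew_symbol_le: "norm (skew_symbol X) \<le> 2 * norm X"
  using norm_le_sum_nth[of "skew_symbol X"] norm_component_le[of X 3]
    norm_component_le[of X 4] by (simp add: skew_symbol_def)

lemma norm_leray_symbol_le: "norm (leray_symbol k X) \<le> 10 * norm X"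
proof -
  let ?y = "\<lambda>i. of_real (k $ i) * kdot k X / of_real ((norm k)\<^sup>2)"
  have y: "norm (?y i) \<le> 3 * norm X" for i
  proof (cases "k = 0")
    case False
    have "norm (?y i) = \<bar>k $ i\<bar> * norm (kdot k X) / (norm k)\<^sup>2"
      by (simp add: norm_mult norm_divide norm_power)
    also have "\<dots> \<le> norm k * (3 * norm k * norm X) / (norm k)\<^sup>2"
      by (intro divide_right_mono mult_mono component_le_norm_cart norm_kdot_le) auto
    also have "\<dots> = 3 * norm X" using False by (simp add: power2_eq_square)
    finally show ?thesis .
  qed simp
  have "norm (vector [?y 1, ?y 2, ?y 3, 0] :: complex^4) \<le> 9 * norm X"
    using norm_le_sum_nth[of "vector [?y 1, ?y 2, ?y 3, 0]"] y[of 1] y[of 2] y[of 3] by simp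
  then show ?thesis
    unfolding leray_symbol_def using norm_triangle_ineq4[of X "vector [?y 1, ?y 2, ?y 3, 0]"] by linarith
qed

text \<open>
  The symbol of the generator \<open>- \<tau> \<P> \<A>\<close> of the filtering group.
\<close>

definition leray_skew_symbol :: "real \<Rightarrow> real^3 \<Rightarrow> complex^4 \<Rightarrow> complex^4" where
  "leray_skew_symbol \<tau> k X = (- \<tau>) *\<^sub>R leray_symbol k (skew_symbol X)"

lemma norm_leray_skew_symbol_le: "norm (leray_skew_symbol \<tau> k X) \<le> 20 * \<bar>\<tau>\<bar> * norm X"
proof -
  have "norm (leray_symbol k (skew_symbol X)) \<le> 20 * norm X"
    using norm_leray_symbol_le[of k "skew_symbol X"] norm_skew_symbol_le[of X] by linarith
  then have "\<bar>\<tau>\<bar> * norm (leray_symbol k (skew_symbol X)) \<le> \<bar>\<tau>\<bar> * (20 * norm X)"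
    by (intro mult_left_mono) auto
  then show ?thesis by (simp add: leray_skew_symbol_def)
qed

lemma has_fourier_skew: "has_fourier a W c \<Longrightarrow> has_fourier a (skew W) (\<lambda>n. skew_symbol (c n))"
  unfolding has_fourier_def
proof safe
  assume s: "(\<lambda>n. norm (c n)) summable_on UNIV"
    and W: "\<forall>x l. complex_of_real (W x $ l) = (\<Sum>\<^sub>\<infinity>n. c n $ l * cis (freq a n \<bullet> x))"
  show "(\<lambda>n. norm (skew_symbol (c n))) summable_on UNIV"
    by (rule summable_on_bound(2)[OF _ summable_on_cmult_right[OF s, of 2]]) (rule norm_skew_symbol_le)
  fix x and l :: 4
  show "complex_of_real (skew W x $ l) = (\<Sum>\<^sub>\<infinity>n. skew_symbol (c n) $ l * cis (freq a n \<bullet> x))"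
    using exhaust_4[of l] W by (auto simp: skew_def skew_symbol_def infsum_uminus)
qed

lemma has_fourier_leray_skew:
  assumes a: "\<And>i. 0 < a $ i" and W: "has_fourier a W c"
  shows "has_fourier a (\<lambda>x. (- \<tau>) *\<^sub>R leray a (skew W) x) (\<lambda>n. leray_skew_symbol \<tau> (freq a n) (c n))"
proof -
  let ?d = "\<lambda>n. leray_symbol (freq a n) (skew_symbol (c n))"
  have W': "has_fourier a (skew W) (\<lambda>n. skew_symbol (c n))" by (rule has_fourier_skew[OF W])
  have sc: "skew_symbol (c (- n)) $ l = cnj (skew_symbol (c n) $ l)" for n l
    by (rule has_fourier_cnj[OF a W'])
  have "(\<lambda>n. norm (?d n)) summable_on UNIV"
  proof (rule summable_on_bound(2))
    show "(\<lambda>n. 10 * norm (skew_symbol (c n))) summable_on UNIV"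
      using W' by (intro summable_on_cmult_right) (simp add: has_fourier_def)
  qed (rule norm_leray_symbol_le)
  moreover have "?d (- n) $ l = cnj (?d n $ l)" for n l
    using exhaust_4[of l] by (auto simp: leray_symbol_def kdot_def freq_uminus sc algebra_simps)
  ultimately have d: "has_fourier a (leray a (skew W)) ?d"
    unfolding leray_def vcoef_has_fourier[OF a W'] by (rule has_fourier_fourier_series)
  show ?thesis
    unfolding has_fourier_def
  proof safe
    show "(\<lambda>n. norm (leray_skew_symbol \<tau> (freq a n) (c n))) summable_on UNIV"
      using d unfolding leray_skew_symbol_def norm_scaleR has_fourier_def
      by (intro summable_on_cmult_right) auto
    fix x l
    have "((\<lambda>n. of_real (- \<tau>) * (?d n $ l * cis (freq a n \<bullet> x))) has_sum of_real (- \<tau>) * of_real (leray a (skew W) x $ l)) UNIV"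
      by (intro has_sum_cmult_right has_fourier_has_sum d)
    then show "complex_of_real (((- \<tau>) *\<^sub>R leray a (skew W) x) $ l)
        = (\<Sum>\<^sub>\<infinity>n. leray_skew_symbol \<tau> (freq a n) (c n) $ l * cis (freq a n \<bullet> x))"
      by (simp add: leray_skew_symbol_def scaleR_conv_of_real[where 'a = complex] infsumI mult.assoc)
  qed
qed

definition filter_symbol :: "real \<Rightarrow> real^3 \<Rightarrow> complex^4 \<Rightarrow> complex^4" where
  "filter_symbol \<tau> k X = (\<Sum>\<^sub>\<infinity>j. (1 / fact j) *\<^sub>R (leray_skew_symbol \<tau> k ^^ j) X)"

lemma summable_exp_coeffs: "(\<lambda>j::nat. (1 / fact j) * r ^ j) summable_on UNIV" if "0 \<le> r" for r :: real
  using summable_exp[of r] that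
  by (intro summable_nonneg_imp_summable_on) (auto simp: divide_inverse)

lemma norm_leray_skew_symbol_funpow_le:
  "norm ((leray_skew_symbol \<tau> k ^^ j) X) \<le> (20 * \<bar>\<tau>\<bar>) ^ j * norm X"
proof (induction j)
  case (Suc j)
  have "norm ((leray_skew_symbol \<tau> k ^^ Suc j) X) \<le> 20 * \<bar>\<tau>\<bar> * norm ((leray_skew_symbol \<tau> k ^^ j) X)"
    by (simp add: norm_leray_skew_symbol_le)
  also have "\<dots> \<le> 20 * \<bar>\<tau>\<bar> * ((20 * \<bar>\<tau>\<bar>) ^ j * norm X)"
    by (intro mult_left_mono Suc.IH) auto
  finally show ?case by (simp add: mult_ac)
qed simp

lemma filter_symbol_summable:
  "(\<lambda>j. norm ((1 / fact j) *\<^sub>R (leray_skew_symbol \<tau> k ^^ j) X)) summable_on UNIV"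
proof (rule summable_on_bound(2))
  show "(\<lambda>j. ((1 / fact j) * (20 * \<bar>\<tau>\<bar>) ^ j) * norm X) summable_on UNIV"
    by (intro summable_on_cmult_left summable_exp_coeffs) simp
  show "norm ((1 / fact j) *\<^sub>R (leray_skew_symbol \<tau> k ^^ j) X) \<le> ((1 / fact j) * (20 * \<bar>\<tau>\<bar>) ^ j) * norm X" for j
    using mult_left_mono[OF norm_leray_skew_symbol_funpow_le, of "1 / fact j"] by (simp add: mult.assoc)
qed

lemma norm_filter_symbol_le:
  "norm (filter_symbol \<tau> k X) \<le> (\<Sum>\<^sub>\<infinity>j::nat. (1 / fact j) * (20 * \<bar>\<tau>\<bar>) ^ j) * norm X"
proof (rule norm_infsum_le)
  show "((\<lambda>j. (1 / fact j) *\<^sub>R (leray_skew_symbol \<tau> k ^^ j) X) has_sum filter_symbol \<tau> k X) UNIV"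
    unfolding filter_symbol_def
    by (rule has_sum_infsum[OF abs_summable_summable[OF filter_symbol_summable]])
  show "((\<lambda>j. ((1 / fact j) * (20 * \<bar>\<tau>\<bar>) ^ j) * norm X) has_sum
      (\<Sum>\<^sub>\<infinity>j::nat. (1 / fact j) * (20 * \<bar>\<tau>\<bar>) ^ j) * norm X) UNIV"
    by (rule has_sum_cmult_left[OF has_sum_infsum[OF summable_exp_coeffs]]) simp
  show "norm ((1 / fact j) *\<^sub>R (leray_skew_symbol \<tau> k ^^ j) X) \<le> ((1 / fact j) * (20 * \<bar>\<tau>\<bar>) ^ j) * norm X" for j
    using mult_left_mono[OF norm_leray_skew_symbol_funpow_le, of "1 / fact j"] by (simp add: mult.assoc)
qed

text \<open>
  Only the term of order zero of the exponential series survives on the kernel of the generator.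
\<close>

lemma filter_symbol_fixes_kernel:
  assumes "skew_symbol X = 0 \<or> leray_symbol k (skew_symbol X) = 0"
  shows "filter_symbol \<tau> k X = X"
proof -
  have z: "leray_skew_symbol \<tau> k X = 0" "leray_skew_symbol \<tau> k 0 = 0"
    using assms by (auto simp: leray_skew_symbol_def leray_symbol_def skew_symbol_def kdot_def vec_eq_iff forall_4)
  have "(leray_skew_symbol \<tau> k ^^ Suc j) X = 0" for j
    by (induction j) (simp_all add: z)
  then have "(1 / fact j) *\<^sub>R (leray_skew_symbol \<tau> k ^^ j) X = (if j = 0 then X else 0)" for j
    by (cases j) simp_all
  then have "filter_symbol \<tau> k X = (\<Sum>\<^sub>\<infinity>j::nat. if j = 0 then X else 0)"
    by (simp add: filter_symbol_def)
  also have "\<dots> = (\<Sum>\<^sub>\<infinity>j\<in>{0::nat}. X)" by (rule infsum_cong_neutral) auto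
  finally show ?thesis by simp
qed

text \<open>
  The pointwise exponential series of iterated operators and the Fourier series are absolutely
  convergent as a double series, so they may be interchanged; the group acts mode by mode.
\<close>

lemma has_fourier_filter_group:
  assumes a: "\<And>i. 0 < a $ i" and W: "has_fourier a W c"
  shows "has_fourier a (filter_group a \<tau> W) (\<lambda>n. filter_symbol \<tau> (freq a n) (c n))"
proof -
  define B where "B = (\<lambda>W x. (- \<tau>) *\<^sub>R leray a (skew W) x)"
  have FG: "filter_group a \<tau> = operator_exp B" by (simp add: filter_group_def B_def)
  define C where "C j = (1 / fact j) * (20 * \<bar>\<tau>\<bar>) ^ j" for j :: nat
  let ?e = "\<lambda>j n. (1 / fact j) *\<^sub>R (leray_skew_symbol \<tau> (freq a n) ^^ j) (c n)"
  have cs: "(\<lambda>n. norm (c n)) summable_on UNIV" using W by (simp add: has_fourier_def)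
  have C: "C summable_on UNIV" "0 \<le> C j" for j
    unfolding C_def by (intro summable_exp_coeffs) simp_all
  have e: "norm (?e j n) \<le> C j * norm (c n)" for j n
    using mult_left_mono[OF norm_leray_skew_symbol_funpow_le, of "1 / fact j"]
    by (simp add: mult.assoc C_def)
  have B: "has_fourier a ((B ^^ j) W) (\<lambda>n. (leray_skew_symbol \<tau> (freq a n) ^^ j) (c n))" for j
  proof (induction j)
    case (Suc j)
    show ?case using has_fourier_leray_skew[OF a Suc.IH, of \<tau>] by (simp add: B_def)
  qed (use W in simp)
  have Bj: "((\<lambda>n. ?e j n $ l * cis (freq a n \<bullet> x)) has_sum complex_of_real ((1 / fact j) * (B ^^ j) W x $ l)) UNIV" for j l x
    using has_sum_cmult_right[OF has_fourier_has_sum[OF B[of j], of l x], of "of_real (1 / fact j)"]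
    by (simp add: scaleR_conv_of_real[where 'a = complex] mult.assoc)
  have dom: "(\<lambda>z. C (fst z) * norm (c (snd z))) summable_on UNIV"
  proof -
    have "(\<lambda>z. norm (C (fst z) * norm (c (snd z)))) summable_on Sigma UNIV (\<lambda>_. UNIV)"
    proof (rule Infinite_Sum.abs_summable_on_Sigma_iff[THEN iffD2], intro conjI ballI)
      show "(\<lambda>m. norm (C (fst (p, m)) * norm (c (snd (p, m))))) summable_on UNIV" for p
        using C by (simp add: abs_mult summable_on_cmult_right cs)
      show "(\<lambda>p. norm (\<Sum>\<^sub>\<infinity>m. norm (C (fst (p, m)) * norm (c (snd (p, m)))))) summable_on UNIV"
        using summable_on_cmult_left[OF C(1)] C(2) by (simp add: abs_mult infsum_cmult_right')
    qed
    then show ?thesis using C(2) by (simp add: abs_mult)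
  qed
  have sum2: "(\<lambda>(j, n). ?e j n $ l * cis (freq a n \<bullet> x)) summable_on UNIV \<times> UNIV" for l x
  proof (rule summable_on_bound(1))
    show "(\<lambda>z. C (fst z) * norm (c (snd z))) summable_on UNIV \<times> UNIV" using dom by simp
    show "norm (case z of (j, n) \<Rightarrow> ?e j n $ l * cis (freq a n \<bullet> x)) \<le> C (fst z) * norm (c (snd z))" for z
      using order.trans[OF norm_component_le e, of "fst z" "snd z" l]
      by (simp add: case_prod_unfold norm_mult)
  qed
  show ?thesis
    unfolding has_fourier_def
  proof safe
    show "(\<lambda>n. norm (filter_symbol \<tau> (freq a n) (c n))) summable_on UNIV"
      by (rule summable_on_bound(2)[OF norm_filter_symbol_le summable_on_cmult_right[OF cs]])
    fix x l
    have "complex_of_real (filter_group a \<tau> W x $ l)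
        = (\<Sum>\<^sub>\<infinity>j. complex_of_real ((1 / fact j) * (B ^^ j) W x $ l))"
    proof -
      have "norm (complex_of_real ((1 / fact j) * (B ^^ j) W x $ l)) \<le> C j * (\<Sum>\<^sub>\<infinity>n. norm (c n))" for j l
      proof (rule norm_infsum_le[OF Bj])
        show "((\<lambda>n. C j * norm (c n)) has_sum C j * (\<Sum>\<^sub>\<infinity>n. norm (c n))) UNIV"
          by (intro has_sum_cmult_right has_sum_infsum cs)
        show "norm (?e j n $ l * cis (freq a n \<bullet> x)) \<le> C j * norm (c n)" for n
          using order.trans[OF norm_component_le e] by (simp add: norm_mult)
      qed
      then have "norm ((1 / fact j) * (B ^^ j) W x $ l) \<le> C j * (\<Sum>\<^sub>\<infinity>n. norm (c n))" for j l
        unfolding norm_of_real real_norm_def .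
      from summable_on_bound(1)[OF this summable_on_cmult_left[OF C(1)]]
      have s: "(\<lambda>j. (1 / fact j) * (B ^^ j) W x $ l) summable_on UNIV" for l .
      have "((\<lambda>j. (1 / fact j) *\<^sub>R (B ^^ j) W x) has_sum (\<chi> l. \<Sum>\<^sub>\<infinity>j. (1 / fact j) * (B ^^ j) W x $ l)) UNIV"
        unfolding has_sum_def
      proof (rule vec_tendstoI)
        fix i
        have "((\<lambda>j. (1 / fact j) * (B ^^ j) W x $ i) has_sum (\<Sum>\<^sub>\<infinity>j. (1 / fact j) * (B ^^ j) W x $ i)) UNIV"
          by (rule has_sum_infsum[OF s])
        then show "((\<lambda>F. (\<Sum>j\<in>F. (1 / fact j) *\<^sub>R (B ^^ j) W x) $ i) \<longlongrightarrow>
            (\<chi> l. \<Sum>\<^sub>\<infinity>j. (1 / fact j) * (B ^^ j) W x $ l) $ i) (finite_subsets_at_top UNIV)"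
          by (simp add: has_sum_def)
      qed
      from has_sum_imp_sums[OF this]
      have FGx: "filter_group a \<tau> W x $ l = (\<Sum>\<^sub>\<infinity>j. (1 / fact j) * (B ^^ j) W x $ l)"
        by (simp add: FG operator_exp_def sums_iff)
      have "((\<lambda>j. complex_of_real ((1 / fact j) * (B ^^ j) W x $ l)) has_sum
          complex_of_real (\<Sum>\<^sub>\<infinity>j. (1 / fact j) * (B ^^ j) W x $ l)) UNIV"
        by (rule has_sum_of_real[OF has_sum_infsum[OF s]])
      from infsumI[OF this] show ?thesis unfolding FGx by (rule sym)
    qed
    also have "\<dots> = (\<Sum>\<^sub>\<infinity>j. \<Sum>\<^sub>\<infinity>n. ?e j n $ l * cis (freq a n \<bullet> x))"
      by (intro infsum_cong infsumI[OF Bj, symmetric])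
    also have "\<dots> = (\<Sum>\<^sub>\<infinity>n. \<Sum>\<^sub>\<infinity>j. ?e j n $ l * cis (freq a n \<bullet> x))"
      by (rule infsum_swap_banach[OF sum2])
    also have "\<dots> = (\<Sum>\<^sub>\<infinity>n. filter_symbol \<tau> (freq a n) (c n) $ l * cis (freq a n \<bullet> x))"
    proof (rule infsum_cong)
      fix n
      have "((\<lambda>j. ?e j n $ l) has_sum (filter_symbol \<tau> (freq a n) (c n)) $ l) UNIV"
        unfolding filter_symbol_def
        by (rule has_sum_bounded_linear[OF bounded_linear_vec_nth
              has_sum_infsum[OF abs_summable_summable[OF filter_symbol_summable]]])
      then show "(\<Sum>\<^sub>\<infinity>j. ?e j n $ l * cis (freq a n \<bullet> x)) = filter_symbol \<tau> (freq a n) (c n) $ l * cis (freq a n \<bullet> x)"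
        by (intro infsumI has_sum_cmult_left)
    qed
    finally show "complex_of_real (filter_group a \<tau> W x $ l)
        = (\<Sum>\<^sub>\<infinity>n. filter_symbol \<tau> (freq a n) (c n) $ l * cis (freq a n \<bullet> x))" .
  qed
qed


section \<open>Sobolev fields\<close>

lemma sobolev_coefficient_le:
  assumes "(\<lambda>n. (1 + (norm (freq a n))\<^sup>2) powr s * (norm (vcoef a V n))\<^sup>2) summable_on UNIV"
  shows "(1 + (norm (freq a n))\<^sup>2) powr s * (norm (vcoef a V n))\<^sup>2 \<le> (sobolev_norm a s V)\<^sup>2"
proof -
  let ?f = "\<lambda>n. (1 + (norm (freq a n))\<^sup>2) powr s * (norm (vcoef a V n))\<^sup>2"
  have "sum ?f {n} \<le> infsum ?f UNIV"
    by (rule finite_sum_le_infsum) (use assms in auto)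
  moreover have "0 \<le> infsum ?f UNIV" by (rule infsum_nonneg) simp
  ultimately show ?thesis by (simp add: sobolev_norm_def)
qed

lemma sobolev_norm_nonneg: "0 \<le> sobolev_norm a s V"
  unfolding sobolev_norm_def by (intro real_sqrt_ge_zero infsum_nonneg) simp

lemma norm_vcoef_le_sobolev_norm:
  assumes "(\<lambda>n. (1 + (norm (freq a n))\<^sup>2) powr s * (norm (vcoef a V n))\<^sup>2) summable_on UNIV"
  shows "norm (vcoef a V n) \<le> sobolev_norm a s V * (1 + (norm (freq a n))\<^sup>2) powr (- (s / 2))"
proof -
  let ?x = "1 + (norm (freq a n))\<^sup>2"
  have x: "0 < ?x" by (simp add: add_pos_nonneg)
  have "(norm (vcoef a V n))\<^sup>2 = ?x powr (- s) * (?x powr s * (norm (vcoef a V n))\<^sup>2)"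
    using x by (simp add: powr_minus)
  also have "\<dots> \<le> ?x powr (- s) * (sobolev_norm a s V)\<^sup>2"
    by (intro mult_left_mono sobolev_coefficient_le assms) simp
  also have "?x powr (- s) = (?x powr (- (s / 2)))\<^sup>2"
    using x by (simp add: powr_powr flip: powr_numeral)
  finally have "(norm (vcoef a V n))\<^sup>2 \<le> (sobolev_norm a s V * ?x powr (- (s / 2)))\<^sup>2"
    by (simp add: power_mult_distrib mult.commute)
  then show ?thesis by (rule power2_le_imp_le) (simp add: sobolev_norm_nonneg)
qed

text \<open>
  Cauchy-Schwarz in the form \<open>x y \<le> x\<^sup>2 + y\<^sup>2\<close>.
\<close>

lemma weighted_summable:
  fixes w :: "'i \<Rightarrow> real"
  assumes w: "\<And>n. 1 \<le> w n" and c: "(\<lambda>n. w n powr s * (c n)\<^sup>2) summable_on UNIV"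
    and r: "(\<lambda>n. w n powr (- (s - r))) summable_on UNIV" and c0: "\<And>n. 0 \<le> c n"
  shows "(\<lambda>n. w n powr (r / 2) * c n) summable_on UNIV"
proof (rule summable_on_comparison_test[OF summable_on_add[OF c r]])
  fix n
  let ?A = "w n powr (s / 2) * c n" and ?B = "w n powr ((r - s) / 2)"
  have w0: "0 < w n" using w[of n] by linarith
  have "w n powr (r / 2) * c n = ?A * ?B"
  proof -
    have "w n powr (s / 2) * w n powr ((r - s) / 2) = w n powr (r / 2)"
      unfolding powr_add[symmetric] by (simp add: field_simps)
    then show ?thesis by (simp add: mult.commute mult.left_commute)
  qed
  also have "\<dots> \<le> ?A\<^sup>2 + ?B\<^sup>2"
    using sum_squares_bound[of ?A ?B] zero_le_power2[of ?A] zero_le_power2[of ?B] by linarith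
  also have "?A\<^sup>2 = w n powr s * (c n)\<^sup>2"
    using w0 by (simp add: power_mult_distrib powr_powr flip: powr_numeral)
  also have "?B\<^sup>2 = w n powr (- (s - r))"
    using w0 by (simp add: powr_powr diff_divide_distrib flip: powr_numeral)
  finally show "w n powr (r / 2) * c n \<le> w n powr s * (c n)\<^sup>2 + w n powr (- (s - r))" .
qed (use c0 in simp)

lemma sobolev_has_fourier:
  assumes a: "\<And>i. 0 < a $ i" and s: "5 / 2 < s" and V: "V \<in> sobolev a s"
    and c: "continuous_on UNIV V"
  shows "has_fourier a V (vcoef a V)"
    "(\<lambda>n. norm (freq a n) * norm (vcoef a V n)) summable_on UNIV"
proof -
  let ?w = "\<lambda>n. 1 + (norm (freq a n))\<^sup>2"
  have sV: "(\<lambda>n. ?w n powr s * (norm (vcoef a V n))\<^sup>2) summable_on UNIV"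
    using V by (simp add: sobolev_def)
  have 1: "(\<lambda>n. ?w n powr (1 / 2) * norm (vcoef a V n)) summable_on UNIV"
    by (rule weighted_summable[OF _ sV summable_freq_powr[OF a]]) (use s in auto)
  have w: "norm (freq a n) \<le> ?w n powr (1 / 2)" "1 \<le> ?w n powr (1 / 2)" for n
  proof -
    have "sqrt ((norm (freq a n))\<^sup>2) \<le> sqrt (?w n)" by (intro real_sqrt_le_mono) simp
    then show "norm (freq a n) \<le> ?w n powr (1 / 2)" by (simp add: powr_half_sqrt)
    show "1 \<le> ?w n powr (1 / 2)" by (intro ge_one_powr_ge_zero) auto
  qed
  have b: "norm (freq a n) * norm (vcoef a V n) \<le> ?w n powr (1 / 2) * norm (vcoef a V n)"
    "norm (vcoef a V n) \<le> ?w n powr (1 / 2) * norm (vcoef a V n)" for n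
    using mult_right_mono[OF w(1)[of n] norm_ge_zero[of "vcoef a V n"]]
      mult_right_mono[OF w(2)[of n] norm_ge_zero[of "vcoef a V n"]] by auto
  show "(\<lambda>n. norm (freq a n) * norm (vcoef a V n)) summable_on UNIV"
    by (rule summable_on_comparison_test[OF 1]) (use b in auto)
  have n: "(\<lambda>n. norm (vcoef a V n)) summable_on UNIV"
    by (rule summable_on_comparison_test[OF 1]) (use b in auto)
  have per: "torus_periodic a (\<lambda>x. V x $ l)" for l
    using V by (simp add: sobolev_def torus_L2_def torus_periodic_def)
  have "(\<lambda>n. norm (fcoef a (\<lambda>x. V x $ l) n)) summable_on UNIV" for l
    by (rule summable_on_comparison_test[OF n])
      (use norm_component_le[of "vcoef a V _" l] in \<open>auto simp: vcoef_def\<close>)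
  from fourier_inversion[OF a _ per this]
  show "has_fourier a V (vcoef a V)"
    using n c by (simp add: has_fourier_def vcoef_def continuous_on_component)
qed

lemma torus_L2_integrable:
  assumes f: "f \<in> torus_L2 a"
  shows "set_integrable lborel (torus_cell a) f"
proof (rule set_integrable_bound)
  have [measurable]: "f \<in> borel_measurable borel" and i: "set_integrable lborel (torus_cell a) (\<lambda>x. (norm (f x))\<^sup>2)"
    using f by (auto simp: torus_L2_def)
  show "set_integrable lborel (torus_cell a) (\<lambda>x. 1 + (norm (f x))\<^sup>2)"
    using i set_integrable_compact[of "torus_cell a" "\<lambda>x. 1 :: real"]
    by (intro set_integral_add(1)) (auto simp: torus_cell_def)
  show "set_borel_measurable lborel (torus_cell a) f"
    unfolding set_borel_measurable_def torus_cell_def by measurable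
  have "norm (f x) \<le> 1 + (norm (f x))\<^sup>2" for x
    using sum_squares_bound[of 1 "norm (f x)"] norm_ge_zero[of "f x"] unfolding power2_eq_square by linarith
  then show "AE x in lborel. x \<in> torus_cell a \<longrightarrow> norm (f x) \<le> norm (1 + (norm (f x))\<^sup>2)"
    by (simp add: abs_of_nonneg)
qed

lemma torus_L2_set_integrable:
  assumes f: "f \<in> torus_L2 a" and g: "continuous_on UNIV g"
  shows "set_integrable lborel (torus_cell a) (\<lambda>x. complex_of_real (f x $ l) * cis (g x))"
proof -
  have "integrable lborel (\<lambda>x. complex_of_real ((indicator (torus_cell a) x *\<^sub>R f x) $ l))"
    using torus_L2_integrable[OF f] unfolding set_integrable_def
    by (rule integrable_bounded_linear[OF bounded_linear_compose[OF bounded_linear_of_real bounded_linear_vec_nth]])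
  then have "set_integrable lborel (torus_cell a) (\<lambda>x. complex_of_real (f x $ l))"
    by (simp add: set_integrable_def scaleR_conv_of_real[where 'a = complex])
  moreover have "continuous_on UNIV (\<lambda>x. cis (g x))" by (intro continuous_intros g)
  ultimately show ?thesis unfolding torus_cell_def by (rule set_integrable_mult_continuous)
qed

lemma vcoef_diff:
  assumes W: "continuous_on UNIV W" and U: "U \<in> torus_L2 a"
  shows "vcoef a (\<lambda>x. W x - U x) n = vcoef a W n - vcoef a U n"
proof -
  have "fcoef a (\<lambda>x. W x $ l - U x $ l) n = fcoef a (\<lambda>x. W x $ l) n - fcoef a (\<lambda>x. U x $ l) n" for l
  proof -
    have "set_integrable lborel (torus_cell a) (\<lambda>x. complex_of_real (W x $ l) * cis (- (freq a n \<bullet> x)))"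
      unfolding torus_cell_def
      by (intro set_integrable_compact continuous_intros continuous_on_subset[OF W]) auto
    moreover have "set_integrable lborel (torus_cell a) (\<lambda>x. complex_of_real (U x $ l) * cis (- (freq a n \<bullet> x)))"
      by (intro torus_L2_set_integrable[OF U] continuous_intros)
    ultimately have "(LINT x:torus_cell a|lborel. complex_of_real (W x $ l) * cis (- (freq a n \<bullet> x))
        - complex_of_real (U x $ l) * cis (- (freq a n \<bullet> x)))
      = (LINT x:torus_cell a|lborel. complex_of_real (W x $ l) * cis (- (freq a n \<bullet> x)))
        - (LINT x:torus_cell a|lborel. complex_of_real (U x $ l) * cis (- (freq a n \<bullet> x)))"
      by (rule set_integral_diff(2))
    then show ?thesis by (simp add: fcoef_def torus_mean_def left_diff_distrib scaleR_diff_right)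
  qed
  then show ?thesis by (simp add: vcoef_def vec_eq_iff)
qed

lemma vcoef_cong_AE:
  assumes "f \<in> borel_measurable borel" "g \<in> borel_measurable borel" "AE x in lborel. f x = g x"
  shows "vcoef a f n = vcoef a g n"
proof -
  have [measurable]: "(\<lambda>x. f x $ l) \<in> borel_measurable borel" "(\<lambda>x. g x $ l) \<in> borel_measurable borel" for l
    by (rule measurable_compose[OF assms(1)] measurable_compose[OF assms(2)],
        intro borel_measurable_continuous_onI continuous_intros)+
  have [measurable]: "(\<lambda>x. cis (- (freq a n \<bullet> x))) \<in> borel_measurable borel"
    by (intro borel_measurable_continuous_onI continuous_intros)
  have "fcoef a (\<lambda>x. f x $ l) n = fcoef a (\<lambda>x. g x $ l) n" for l
    unfolding fcoef_def torus_mean_def set_lebesgue_integral_def torus_cell_def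
    by (intro arg_cong[where f = "\<lambda>z. _ *\<^sub>R z"] Bochner_Integration.integral_cong_AE)
      (use assms(3) in \<open>auto elim!: eventually_mono\<close>)
  then show ?thesis by (simp add: vcoef_def)
qed

text \<open>
  On a mode that the filter fixes, the distance of the limit from the filtered solution bounds its
  distance from the solution itself. The difference is shown to lie in \<open>H\<^sup>\<sigma>\<close> first, because
  \<open>sobolev_norm\<close> dominates coefficients only where its defining series converges.
\<close>

lemma filtered_mode_distance:
  assumes a: "\<And>i. 0 < a $ i" and s: "5 / 2 < s" and \<sigma>: "\<sigma> \<le> s"
    and V: "V \<in> sobolev a s" "continuous_on UNIV V" and U: "U \<in> sobolev a \<sigma>"
    and n: "leray_symbol (freq a n) (skew_symbol (vcoef a V n)) = 0"
  shows "norm (vcoef a V n - vcoef a U n)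
    \<le> sobolev_norm a \<sigma> (\<lambda>x. filter_group a \<tau> V x - U x) * (1 + (norm (freq a n))\<^sup>2) powr (- (\<sigma> / 2))"
proof -
  let ?w = "\<lambda>n. 1 + (norm (freq a n))\<^sup>2"
  let ?d = "\<lambda>n. filter_symbol \<tau> (freq a n) (vcoef a V n)"
  let ?W = "filter_group a \<tau> V"
  have W: "has_fourier a ?W ?d"
    by (intro has_fourier_filter_group a sobolev_has_fourier[OF a s V])
  define C where "C = (\<Sum>\<^sub>\<infinity>j::nat. (1 / fact j) * (20 * \<bar>\<tau>\<bar>) ^ j)"
  have diff: "vcoef a (\<lambda>x. ?W x - U x) m = ?d m - vcoef a U m" for m
    using U by (subst vcoef_diff[OF has_fourier_continuous[OF W]])
      (auto simp: vcoef_has_fourier[OF a W] sobolev_def)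
  have sV: "(\<lambda>n. ?w n powr s * (norm (vcoef a V n))\<^sup>2) summable_on UNIV"
    and sU: "(\<lambda>n. ?w n powr \<sigma> * (norm (vcoef a U n))\<^sup>2) summable_on UNIV"
    using V U by (simp_all add: sobolev_def)
  have "(\<lambda>n. ?w n powr \<sigma> * (norm (vcoef a (\<lambda>x. ?W x - U x) n))\<^sup>2) summable_on UNIV"
  proof (rule summable_on_comparison_test)
    show "(\<lambda>n. 2 * C\<^sup>2 * (?w n powr s * (norm (vcoef a V n))\<^sup>2) + 2 * (?w n powr \<sigma> * (norm (vcoef a U n))\<^sup>2)) summable_on UNIV"
      by (intro summable_on_add summable_on_cmult_right sV sU)
    fix m
    have "norm (?d m - vcoef a U m) \<le> norm (?d m) + norm (vcoef a U m)" by (rule norm_triangle_ineq4)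
    then have "(norm (?d m - vcoef a U m))\<^sup>2 \<le> (norm (?d m) + norm (vcoef a U m))\<^sup>2" by (intro power_mono) auto
    also have "\<dots> \<le> 2 * (norm (?d m))\<^sup>2 + 2 * (norm (vcoef a U m))\<^sup>2"
      using sum_squares_bound[of "norm (?d m)" "norm (vcoef a U m)"] by (simp add: power2_sum)
    also have "(norm (?d m))\<^sup>2 \<le> (C * norm (vcoef a V m))\<^sup>2"
      using norm_filter_symbol_le[of \<tau> "freq a m" "vcoef a V m"] by (intro power_mono) (auto simp: C_def)
    finally have "?w m powr \<sigma> * (norm (?d m - vcoef a U m))\<^sup>2
        \<le> ?w m powr \<sigma> * (2 * (C\<^sup>2 * (norm (vcoef a V m))\<^sup>2) + 2 * (norm (vcoef a U m))\<^sup>2)"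
      by (intro mult_left_mono) (auto simp: power_mult_distrib)
    also have "\<dots> = 2 * C\<^sup>2 * (?w m powr \<sigma> * (norm (vcoef a V m))\<^sup>2) + 2 * (?w m powr \<sigma> * (norm (vcoef a U m))\<^sup>2)"
      by (simp add: algebra_simps)
    also have "\<dots> \<le> 2 * C\<^sup>2 * (?w m powr s * (norm (vcoef a V m))\<^sup>2) + 2 * (?w m powr \<sigma> * (norm (vcoef a U m))\<^sup>2)"
      by (intro add_right_mono mult_left_mono mult_right_mono powr_mono \<sigma>) auto
    finally show "?w m powr \<sigma> * (norm (vcoef a (\<lambda>x. ?W x - U x) m))\<^sup>2 \<le> \<dots>" unfolding diff .
  qed simp
  from norm_vcoef_le_sobolev_norm[OF this, of n] show ?thesis
    unfolding diff using filter_symbol_fixes_kernel[of "vcoef a V n" "freq a n" \<tau>] n by simp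
qed


section \<open>The vertical flux as a derivative in the fast time\<close>

text \<open>
  The singular part of the equation: a solution satisfies
  \<open>d/dt V\<^sub>k = (1/\<epsilon>) fast_symbol k p V\<^sub>k + O(1)\<close>, where \<open>p\<close> is the pressure mode. The pressure is kept
  as a free parameter and drops out of the identities below.
\<close>

definition fast_symbol :: "real^3 \<Rightarrow> complex \<Rightarrow> complex^4 \<Rightarrow> complex^4" where
  "fast_symbol k p X = - (skew_symbol X + grad_symbol k p)"

text \<open>
  The contribution of an unordered pair of modes to the vertical flux of \<open>V\<close>.
\<close>

definition vertical_flux :: "complex^4 \<Rightarrow> complex^4 \<Rightarrow> complex^4" where
  "vertical_flux X Y = (\<chi> j. X $ 3 * Y $ j + X $ j * Y $ 3)"

lemma fast_symbol_nth:
  "fast_symbol k p X $ 1 = - (\<i> * of_real (k $ 1) * p)"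
  "fast_symbol k p X $ 2 = - (\<i> * of_real (k $ 2) * p)"
  "fast_symbol k p X $ 3 = - (X $ 4 + \<i> * of_real (k $ 3) * p)"
  "fast_symbol k p X $ 4 = X $ 3"
  by (simp_all add: fast_symbol_def skew_symbol_def grad_symbol_def)

text \<open>
  The identity \<open>\<partial>\<^sub>3 (v\<^sup>3 v\<^sup>1) = v\<^sup>3 \<omega>\<^sup>2 - v\<^sup>2 \<omega>\<^sup>3\<close> for horizontal means, written for a pair of modes
  with opposite horizontal frequencies \<open>(k1, k2)\<close> and \<open>(-k1, -k2)\<close>. In the second summand the
  velocity \<open>v\<^sup>2\<close> is decomposed into its rotational part, whose contribution cancels, and its
  potential part, which the divergence constraint expresses by \<open>v\<^sup>3\<close>. Every term on the right
  thus contains the third component of one of the modes.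
\<close>

lemma horizontal_vorticity_identity:
  fixes k1 k2 k3 l3 r x1 x2 x3 y1 y2 y3 :: complex
  assumes x: "k1 * x1 + k2 * x2 + k3 * x3 = 0" and y: "- k1 * y1 - k2 * y2 + l3 * y3 = 0"
    and r: "r * (k1\<^sup>2 + k2\<^sup>2) = 1"
  shows "(k3 + l3) * (x3 * y1 + x1 * y3) =
    x3 * (l3 * y1 + k1 * y3) + y3 * (k3 * x1 - k1 * x3)
    + k2 * r * (- k3 * x3 * (k1 * y2 - k2 * y1) - l3 * y3 * (k1 * x2 - k2 * x1))"
proof -
  have "k2 * (x1 * y2 - x2 * y1) = r * (k1\<^sup>2 + k2\<^sup>2) * k2 * (x1 * y2 - x2 * y1)" using r by simp
  also have "\<dots> = k2 * r * ((k1 * x1 + k2 * x2) * (k1 * y2 - k2 * y1)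
      - (k1 * y1 + k2 * y2) * (k1 * x2 - k2 * x1))" by algebra
  also have "\<dots> = k2 * r * (- k3 * x3 * (k1 * y2 - k2 * y1) - l3 * y3 * (k1 * x2 - k2 * x1))"
    using x y by algebra
  finally show ?thesis using x y by algebra
qed

text \<open>
  The algebraic core. Under the fast flow \<open>X\<^sup>4\<close> has derivative \<open>X\<^sup>3\<close>, the vertical vorticity is
  constant, and the derivative of the horizontal vorticity is a horizontal frequency times \<open>X\<^sup>4\<close>.
  For \<open>j = 4\<close> the flux is thus the derivative of \<open>X\<^sup>4 Y\<^sup>4\<close>. For \<open>j = 1, 2\<close> let \<open>Q\<close> be the right-hand side of
  the identity above with the fourth component in place of each third component that multiplies a
  vorticity; the terms in which the horizontal vorticity is differentiated cancel, the two
  horizontal frequencies being opposite. Pairs of modes without horizontal frequency have no flux at all.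
\<close>

lemma vertical_flux_is_fast_derivative:
  fixes k l :: "real^3"
  assumes kl: "l $ 1 = - k $ 1" "l $ 2 = - k $ 2" and k: "k \<noteq> 0" "l \<noteq> 0" and j: "j \<noteq> 3"
  obtains Q :: "complex^4 \<Rightarrow> complex^4 \<Rightarrow> complex" where "bounded_bilinear Q"
    "\<And>X Y p q. kdot k X = 0 \<Longrightarrow> kdot l Y = 0 \<Longrightarrow>
      Q (fast_symbol k p X) Y + Q X (fast_symbol l q Y)
        = of_real (k $ 3 + l $ 3) * vertical_flux X Y $ j"
proof (cases "k $ 1 = 0 \<and> k $ 2 = 0")
  case True
  have "k $ 3 \<noteq> 0" "l $ 3 \<noteq> 0"
    using True k kl by (auto simp: vec_eq_iff forall_3)
  then have "X $ 3 = 0" if "kdot k X = 0 \<or> kdot l X = 0" for X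
    using that True kl by (auto simp: kdot_def)
  then show ?thesis
    by (intro that[of "\<lambda>X Y. 0"]) (auto simp: vertical_flux_def bilinear_conv_bounded_bilinear[symmetric] bilinear_def linear_iff)
next
  case False
  define r where "r = inverse ((k $ 1)\<^sup>2 + (k $ 2)\<^sup>2)"
  have r: "r * ((k $ 1)\<^sup>2 + (k $ 2)\<^sup>2) = 1"
    using False by (simp add: r_def sum_power2_eq_zero_iff)
  then have r': "of_real r * ((of_real (k $ 1))\<^sup>2 + (of_real (k $ 2))\<^sup>2) = (1 :: complex)"
    by (simp only: of_real_power[symmetric] of_real_add[symmetric] of_real_mult[symmetric] of_real_1)
  \<comment> \<open>\<open>j'\<close> is the index \<open>j\<close> among the three coordinates, and \<open>i\<close> is the other horizontal index\<close>
  consider (vertical) "j = 4"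
    | (horizontal) j' :: 3 and i :: 4 and i' :: 3
      where "(j, j', i, i') = (1, 1, 2, 2) \<or> (j, j', i, i') = (2, 2, 1, 1)"
    using j exhaust_4[of j] by blast
  then show ?thesis
  proof cases
    case vertical
    define Q :: "complex^4 \<Rightarrow> complex^4 \<Rightarrow> complex" where
      "Q X Y = of_real (k $ 3 + l $ 3) * (X $ 4 * Y $ 4)" for X Y
    have "bounded_bilinear Q"
      unfolding Q_def bilinear_conv_bounded_bilinear[symmetric] bilinear_def linear_iff
      by (auto simp: algebra_simps scaleR_conv_of_real[where 'a=complex])
    then show ?thesis
      by (rule that) (simp add: Q_def fast_symbol_nth vertical_flux_def vertical algebra_simps)
  next
    case horizontal
    define Q :: "complex^4 \<Rightarrow> complex^4 \<Rightarrow> complex" where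
      "Q X Y = X $ 4 * (of_real (l $ 3) * Y $ j + of_real (k $ j') * Y $ 3)
        + Y $ 4 * (of_real (k $ 3) * X $ j - of_real (k $ j') * X $ 3)
        + of_real (k $ i') * of_real r *
          (- of_real (k $ 3) * X $ 4 * (of_real (k $ j') * Y $ i - of_real (k $ i') * Y $ j)
           - of_real (l $ 3) * Y $ 4 * (of_real (k $ j') * X $ i - of_real (k $ i') * X $ j))" for X Y
    have "bounded_bilinear Q"
      unfolding Q_def bilinear_conv_bounded_bilinear[symmetric] bilinear_def linear_iff
      by (auto simp: algebra_simps scaleR_conv_of_real[where 'a=complex])
    then show ?thesis
    proof (rule that)
      fix X Y :: "complex^4" and p q
      assume X: "kdot k X = 0" and Y: "kdot l Y = 0"
      have "of_real (k $ 3 + l $ 3) * vertical_flux X Y $ j =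
        X $ 3 * (of_real (l $ 3) * Y $ j + of_real (k $ j') * Y $ 3)
        + Y $ 3 * (of_real (k $ 3) * X $ j - of_real (k $ j') * X $ 3)
        + of_real (k $ i') * of_real r *
          (- of_real (k $ 3) * X $ 3 * (of_real (k $ j') * Y $ i - of_real (k $ i') * Y $ j)
           - of_real (l $ 3) * Y $ 3 * (of_real (k $ j') * X $ i - of_real (k $ i') * X $ j))"
        unfolding vertical_flux_def vec_lambda_beta of_real_add
        by (rule horizontal_vorticity_identity)
          (use X Y r' kl horizontal in \<open>auto simp: kdot_def algebra_simps\<close>)
      also have "\<dots> = Q (fast_symbol k p X) Y + Q X (fast_symbol l q Y)"
      proof -
        have "fast_symbol k p X $ j = - (\<i> * of_real (k $ j') * p)"
          "fast_symbol k p X $ i = - (\<i> * of_real (k $ i') * p)"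
          "fast_symbol l q Y $ j = \<i> * of_real (k $ j') * q"
          "fast_symbol l q Y $ i = \<i> * of_real (k $ i') * q"
          using horizontal by (auto simp: fast_symbol_nth kl)
        then show ?thesis unfolding Q_def fast_symbol_nth by algebra
      qed
      finally show "Q (fast_symbol k p X) Y + Q X (fast_symbol l q Y)
        = of_real (k $ 3 + l $ 3) * vertical_flux X Y $ j" ..
    qed
  qed
qed


section \<open>Averaging of the quadratic term\<close>

text \<open>
  Averaging. The function \<open>X n t $ j\<close> decays with rate \<open>\<kappa>\<close> and is forced by the terms \<open>\<phi> p t\<close>; each
  of these is \<open>\<epsilon>\<close> times a time derivative up to an error of order \<open>\<epsilon>\<close> produced by the bounded
  remainders \<open>R\<close>. Correcting \<open>X n t $ j\<close> by the corresponding bilinear terms for \<open>p\<close> in a finite set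
  \<open>F\<close> and applying the mean value inequality gives an error of order \<open>\<epsilon>\<close> plus the sum over the
  complement of \<open>F\<close>.
\<close>

lemma slow_mode_estimate:
  fixes X D R :: "int^3 \<Rightarrow> real \<Rightarrow> complex^4" and Q :: "int^3 \<Rightarrow> complex^4 \<Rightarrow> complex^4 \<Rightarrow> complex"
    and B g h :: "int^3 \<Rightarrow> real" and K M \<epsilon> \<kappa> T :: real
  assumes T: "0 \<le> T" and \<epsilon>: "0 < \<epsilon>" and \<kappa>: "0 \<le> \<kappa>" and F: "finite F" and M: "0 \<le> M"
    and Q: "\<And>p. bounded_bilinear (Q p)" "\<And>p Y Z. norm (Q p Y Z) \<le> B p * norm Y * norm Z" "\<And>p. 0 \<le> B p"
    and d: "\<And>p t. t \<in> {0..T} \<Longrightarrow> (X p has_vector_derivative D p t) (at t within {0..T})"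
    and X: "\<And>p t. t \<in> {0..T} \<Longrightarrow> norm (X p t) \<le> M"
    and R: "\<And>p t. t \<in> {0..T} \<Longrightarrow> norm (R p t) \<le> g p" and g: "\<And>p. 0 \<le> g p"
    and fast: "\<And>p t. t \<in> {0..T} \<Longrightarrow>
      Q p (D p t - R p t) (X (n - p) t) + Q p (X p t) (D (n - p) t - R (n - p) t) = of_real (K / \<epsilon>) * \<phi> p t"
    and slow: "\<And>t. t \<in> {0..T} \<Longrightarrow> D n t $ j = - of_real \<kappa> * X n t $ j - (\<i> * of_real K / 2) * (\<Sum>\<^sub>\<infinity>p. \<phi> p t)"
    and \<phi>: "\<And>p t. t \<in> {0..T} \<Longrightarrow> norm (\<phi> p t) \<le> h p" and h: "h summable_on UNIV"
    and t: "t \<in> {0..T}"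
  shows "norm (of_real (exp (\<kappa> * t)) * X n t $ j - X n 0 $ j)
    \<le> exp (\<kappa> * T) * (\<epsilon> * (\<Sum>p\<in>F. B p * M * (2 * M + T * (\<kappa> * M + g p + g (n - p))))
        + T * \<bar>K\<bar> * infsum h (- F))"
proof -
  \<comment> \<open>The corrector; the factor \<open>\<i> / 2\<close> is that of the forcing in \<open>slow\<close>.\<close>
  define q where "q t = (\<i> * of_real \<epsilon> / 2) * (\<Sum>p\<in>F. Q p (X p t) (X (n - p) t))" for t
  define q' where "q' t = (\<i> * of_real \<epsilon> / 2) * (\<Sum>p\<in>F. Q p (X p t) (D (n - p) t) + Q p (D p t) (X (n - p) t))" for t
  define H where "H t = of_real (exp (\<kappa> * t)) * (X n t $ j + q t)" for t
  define S where "S = (\<Sum>p\<in>F. B p * M * M)"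
  define S' where "S' = (\<Sum>p\<in>F. B p * M * (g p + g (n - p)))"
  define \<eta> where "\<eta> = infsum h (- F)"
  have h0: "0 \<le> h p" for p using \<phi>[OF t, of p] norm_ge_zero order_trans by blast
  have \<eta>0: "0 \<le> \<eta>" unfolding \<eta>_def by (rule infsum_nonneg) (rule h0)
  have S0: "0 \<le> S" "0 \<le> S'" unfolding S_def S'_def using Q(3) M g by (auto intro!: sum_nonneg)
  have q_deriv: "(q has_vector_derivative q' t) (at t within {0..T})" if "t \<in> {0..T}" for t
    unfolding q_def q'_def
    by (intro has_vector_derivative_mult_right has_vector_derivative_sum
        bounded_bilinear.has_vector_derivative[OF Q(1)] d that)
  have q_bd: "norm (q t) \<le> \<epsilon> * S" if t: "t \<in> {0..T}" for t
  proof -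
    have "norm (Q p (X p t) (X (n - p) t)) \<le> B p * M * M" for p
      using Q(3) M by (intro order.trans[OF Q(2)] mult_mono X t mult_nonneg_nonneg) auto
    then have "norm (\<Sum>p\<in>F. Q p (X p t) (X (n - p) t)) \<le> S"
      unfolding S_def by (rule sum_norm_le)
    then have "norm (\<Sum>p\<in>F. Q p (X p t) (X (n - p) t)) \<le> 2 * S" using S0 by linarith
    from mult_left_mono[OF this, of "\<epsilon> / 2"] show ?thesis using \<epsilon> by (simp add: q_def norm_mult)
  qed
  define H' where "H' t = of_real (\<kappa> * exp (\<kappa> * t)) * (X n t $ j + q t) + of_real (exp (\<kappa> * t)) * (D n t $ j + q' t)" for t
  have H_deriv: "(H has_vector_derivative H' t) (at t within {0..T})" if t: "t \<in> {0..T}" for t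
  proof -
    have "((\<lambda>t. exp (\<kappa> * t)) has_real_derivative \<kappa> * exp (\<kappa> * t)) (at t within {0..T})"
      by (auto intro!: derivative_eq_intros)
    then have "((\<lambda>t. complex_of_real (exp (\<kappa> * t))) has_vector_derivative of_real (\<kappa> * exp (\<kappa> * t))) (at t within {0..T})"
      by (intro has_vector_derivative_of_real) (simp add: has_real_derivative_iff_has_vector_derivative)
    moreover have "((\<lambda>t. X n t $ j) has_vector_derivative D n t $ j) (at t within {0..T})"
      by (rule bounded_linear.has_vector_derivative[OF bounded_linear_vec_nth d[OF t]])
    ultimately have "((\<lambda>t. of_real (exp (\<kappa> * t)) * (X n t $ j + q t)) has_vector_derivative
        of_real (exp (\<kappa> * t)) * (D n t $ j + q' t) + of_real (\<kappa> * exp (\<kappa> * t)) * (X n t $ j + q t)) (at t within {0..T})"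
      by (intro has_vector_derivative_mult has_vector_derivative_add q_deriv t)
    then show ?thesis by (simp add: H_def[abs_def] H'_def add.commute)
  qed
  have H'_bd: "norm (H' t) \<le> exp (\<kappa> * T) * (\<epsilon> * (\<kappa> * S + S') + \<bar>K\<bar> * \<eta>)" if t: "t \<in> {0..T}" for t
  proof -
    define r where "r = (\<Sum>p\<in>F. Q p (X p t) (R (n - p) t) + Q p (R p t) (X (n - p) t))"
    have "Q p (X p t) (D (n - p) t) + Q p (D p t) (X (n - p) t)
        = of_real (K / \<epsilon>) * \<phi> p t + (Q p (X p t) (R (n - p) t) + Q p (R p t) (X (n - p) t))" for p
      unfolding fast[OF t, symmetric] bounded_bilinear.diff_left[OF Q(1)] bounded_bilinear.diff_right[OF Q(1)]
      by simp
    then have "q' t = (\<i> * of_real \<epsilon> / 2) * (of_real (K / \<epsilon>) * (\<Sum>p\<in>F. \<phi> p t) + r)"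
      by (simp add: q'_def r_def sum.distrib sum_distrib_left)
    also have "\<dots> = (\<i> * of_real K / 2) * (\<Sum>p\<in>F. \<phi> p t) + (\<i> * of_real \<epsilon> / 2) * r"
      using \<epsilon> by (simp add: field_simps)
    finally have q': "q' t = (\<i> * of_real K / 2) * (\<Sum>p\<in>F. \<phi> p t) + (\<i> * of_real \<epsilon> / 2) * r" .
    have \<phi>s: "(\<lambda>p. \<phi> p t) summable_on A" for A
      by (rule summable_on_bound(1)[OF \<phi>[OF t] summable_on_subset_banach[OF h]]) simp
    have "(\<Sum>\<^sub>\<infinity>p. \<phi> p t) = (\<Sum>p\<in>F. \<phi> p t) + (\<Sum>\<^sub>\<infinity>p\<in>-F. \<phi> p t)"
      using infsum_Un_disjoint[OF \<phi>s \<phi>s, of F "- F"] F by simp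
    then have H': "H' t = of_real (exp (\<kappa> * t)) * (of_real \<kappa> * q t + (\<i> * of_real \<epsilon> / 2) * r
        - (\<i> * of_real K / 2) * (\<Sum>\<^sub>\<infinity>p\<in>-F. \<phi> p t))"
      unfolding H'_def slow[OF t] q' by (simp add: algebra_simps)
    have "norm (\<Sum>\<^sub>\<infinity>p\<in>-F. \<phi> p t) \<le> \<eta>"
      unfolding \<eta>_def using \<phi>s summable_on_subset_banach[OF h]
      by (intro norm_infsum_le[OF has_sum_infsum has_sum_infsum] \<phi> t) auto
    then have n1: "norm ((\<i> * of_real K / 2) * (\<Sum>\<^sub>\<infinity>p\<in>-F. \<phi> p t)) \<le> \<bar>K\<bar> * \<eta>"
      using mult_left_mono[of "norm (\<Sum>\<^sub>\<infinity>p\<in>-F. \<phi> p t)" \<eta> "\<bar>K\<bar>"] \<eta>0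
      by (simp add: norm_mult) (smt (verit) abs_ge_zero mult_nonneg_nonneg norm_ge_zero)
    have "norm r \<le> S'"
      unfolding r_def S'_def
    proof (rule sum_norm_le)
      fix p
      have "norm (Q p (X p t) (R (n - p) t)) \<le> B p * M * g (n - p)"
        using Q(3) M g by (intro order.trans[OF Q(2)] mult_mono X R t mult_nonneg_nonneg) auto
      moreover have "norm (Q p (R p t) (X (n - p) t)) \<le> B p * g p * M"
        using Q(3) M g by (intro order.trans[OF Q(2)] mult_mono X R t mult_nonneg_nonneg) auto
      ultimately show "norm (Q p (X p t) (R (n - p) t) + Q p (R p t) (X (n - p) t)) \<le> B p * M * (g p + g (n - p))"
        by (intro order.trans[OF norm_triangle_ineq]) (simp add: algebra_simps)
    qed
    then have n2: "norm ((\<i> * of_real \<epsilon> / 2) * r) \<le> \<epsilon> * S'"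
      using mult_left_mono[of "norm r" S' \<epsilon>] \<epsilon> by (simp add: norm_mult) (smt (verit) mult_nonneg_nonneg norm_ge_zero)
    have n3: "norm (of_real \<kappa> * q t) \<le> \<kappa> * (\<epsilon> * S)"
      using mult_left_mono[OF q_bd[OF t] \<kappa>] \<kappa> by (simp add: norm_mult)
    have "norm (of_real \<kappa> * q t + (\<i> * of_real \<epsilon> / 2) * r - (\<i> * of_real K / 2) * (\<Sum>\<^sub>\<infinity>p\<in>-F. \<phi> p t))
        \<le> \<epsilon> * (\<kappa> * S + S') + \<bar>K\<bar> * \<eta>"
      using norm_triangle_ineq4[of "of_real \<kappa> * q t + (\<i> * of_real \<epsilon> / 2) * r" "(\<i> * of_real K / 2) * (\<Sum>\<^sub>\<infinity>p\<in>-F. \<phi> p t)"]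
        norm_triangle_ineq[of "of_real \<kappa> * q t" "(\<i> * of_real \<epsilon> / 2) * r"] n1 n2 n3
      by (simp add: algebra_simps)
    moreover have "exp (\<kappa> * t) \<le> exp (\<kappa> * T)" using t \<kappa> by (simp add: mult_left_mono)
    ultimately show ?thesis
      unfolding H' norm_mult norm_of_real abs_exp_cancel by (intro mult_mono) auto
  qed
  let ?c = "exp (\<kappa> * T) * (\<epsilon> * (\<kappa> * S + S') + \<bar>K\<bar> * \<eta>)"
  have c0: "0 \<le> ?c" using \<epsilon> \<kappa> S0 \<eta>0 by simp
  have "norm (H t - H 0) \<le> ?c * norm (t - 0)"
    by (rule differentiable_bound[of "{0..T}" H "\<lambda>t x. x *\<^sub>R H' t"])
      (use H_deriv H'_bd onorm_scaleR_le t T in \<open>auto simp: has_vector_derivative_def\<close>)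
  also have "\<dots> \<le> ?c * T" using t c0 by (intro mult_left_mono) auto
  finally have 1: "norm (H t - H 0) \<le> ?c * T" .
  have "of_real (exp (\<kappa> * t)) * X n t $ j - X n 0 $ j = H t - H 0 - of_real (exp (\<kappa> * t)) * q t + q 0"
    by (simp add: H_def algebra_simps)
  then have "norm (of_real (exp (\<kappa> * t)) * X n t $ j - X n 0 $ j) \<le> norm (H t - H 0) + exp (\<kappa> * t) * norm (q t) + norm (q 0)"
    using norm_triangle_ineq[of "H t - H 0 - of_real (exp (\<kappa> * t)) * q t" "q 0"]
      norm_triangle_ineq4[of "H t - H 0" "of_real (exp (\<kappa> * t)) * q t"] by (simp add: norm_mult)
  also have "\<dots> \<le> ?c * T + exp (\<kappa> * T) * (\<epsilon> * S) + exp (\<kappa> * T) * (\<epsilon> * S)"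
  proof -
    have "0 \<le> \<kappa> * t" "\<kappa> * t \<le> \<kappa> * T" using t \<kappa> by (auto intro: mult_left_mono)
    then have e: "1 \<le> exp (\<kappa> * T)" "exp (\<kappa> * t) \<le> exp (\<kappa> * T)" by (auto simp: add_increasing)
    have "exp (\<kappa> * t) * norm (q t) \<le> exp (\<kappa> * T) * (\<epsilon> * S)"
      by (intro mult_mono q_bd t e) auto
    moreover have "1 * norm (q 0) \<le> exp (\<kappa> * T) * (\<epsilon> * S)"
      by (intro mult_mono q_bd e) (use T in auto)
    ultimately show ?thesis using 1 by linarith
  qed
  also have "\<dots> = exp (\<kappa> * T) * (\<epsilon> * (2 * S + T * (\<kappa> * S + S')) + T * \<bar>K\<bar> * \<eta>)"
    by (simp add: algebra_simps)
  also have "2 * S + T * (\<kappa> * S + S') = (\<Sum>p\<in>F. B p * M * (2 * M + T * (\<kappa> * M + g p + g (n - p))))"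
    by (simp add: S_def S'_def sum_distrib_left sum.distrib[symmetric] algebra_simps)
  finally show ?thesis unfolding \<eta>_def .
qed

lemma infsum_tail_less:
  fixes h :: "'i \<Rightarrow> real"
  assumes h: "h summable_on UNIV" and e: "0 < e"
  obtains F where "finite F" "infsum h (- F) < e"
proof -
  obtain F where F: "finite F" "dist (sum h F) (infsum h UNIV) \<le> e / 2"
    using infsum_finite_approximation[OF h, of "e / 2"] e by auto
  have "infsum h UNIV = infsum h F + infsum h (- F)"
    using infsum_Un_disjoint[of h F "- F"] summable_on_subset_banach[OF h] by simp
  then have "infsum h (- F) < e" using F e by (simp add: dist_real_def)
  with F(1) show thesis by (rule that)
qed

lemma bij_reflect: "bij_betw (\<lambda>m. n - m) UNIV (UNIV :: (int^3) set)"
  by (rule bij_betw_byWitness[where f' = "\<lambda>m. n - m"]) auto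

lemma norm_diffusion_symbol_le: "0 \<le> \<nu> \<Longrightarrow> norm (diffusion_symbol \<nu> k X) \<le> 3 * \<nu> * (norm k)\<^sup>2 * norm X"
proof -
  assume \<nu>: "0 \<le> \<nu>"
  have "norm (- of_real (\<nu> * (norm k)\<^sup>2) * X $ i) \<le> \<nu> * (norm k)\<^sup>2 * norm X" for i
    using \<nu> mult_left_mono[OF norm_component_le[of X i], of "\<nu> * (norm k)\<^sup>2"]
    by (simp add: norm_mult norm_power)
  from this[of 1] this[of 2] this[of 3] show ?thesis
    using norm_le_sum_nth[of "diffusion_symbol \<nu> k X"] by (simp add: diffusion_symbol_def)
qed

text \<open>
  The bound \<open>2 x y \<le> x\<^sup>2 + y\<^sup>2\<close> is used instead of the Cauchy-Schwarz inequality because it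
  provides, for each summand, a summable majorant that is independent of \<open>c\<close>.
\<close>

lemma norm_convolution_le:
  fixes c :: "int^3 \<Rightarrow> complex^4"
  assumes c: "\<And>m. (norm (c m))\<^sup>2 \<le> C * v m" and v: "v summable_on UNIV"
  shows "(\<lambda>m. norm (c m) * norm (c (n - m))) summable_on UNIV"
    "(\<Sum>\<^sub>\<infinity>m. norm (c m) * norm (c (n - m))) \<le> C * infsum v UNIV"
proof -
  have v': "(\<lambda>m. v (n - m)) summable_on UNIV" "(\<Sum>\<^sub>\<infinity>m. v (n - m)) = infsum v UNIV"
    using v summable_on_reindex_bij_betw[OF bij_reflect, of v n] infsum_reindex_bij_betw[OF bij_reflect, of v n] by auto
  have le: "norm (c m) * norm (c (n - m)) \<le> C / 2 * (v m + v (n - m))" for m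
    using sum_squares_bound[of "norm (c m)" "norm (c (n - m))"] c[of m] c[of "n - m"] by (simp add: algebra_simps)
  have s: "(\<lambda>m. C / 2 * (v m + v (n - m))) summable_on UNIV"
    by (intro summable_on_cmult_right summable_on_add v v')
  show "(\<lambda>m. norm (c m) * norm (c (n - m))) summable_on UNIV"
    by (rule summable_on_comparison_test[OF s le]) simp
  from infsum_mono[OF this s le]
  have "(\<Sum>\<^sub>\<infinity>m. norm (c m) * norm (c (n - m))) \<le> (\<Sum>\<^sub>\<infinity>m. C / 2 * (v m + v (n - m)))" .
  also have "\<dots> = C / 2 * (infsum v UNIV + infsum v UNIV)"
    by (simp only: infsum_cmult_right' infsum_add[OF v v'(1)] v'(2))
  finally show "(\<Sum>\<^sub>\<infinity>m. norm (c m) * norm (c (n - m))) \<le> C * infsum v UNIV" by simp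
qed

lemma vcoef_0:
  assumes "continuous_on UNIV W"
  shows "vcoef a W 0 $ l = of_real (torus_mean a W $ l)"
proof -
  have i: "set_integrable lborel (torus_cell a) W"
    unfolding torus_cell_def by (intro set_integrable_compact continuous_on_subset[OF assms]) auto
  have "(LINT x:torus_cell a|lborel. W x $ l) = (LINT x:torus_cell a|lborel. W x) $ l"
    using integral_bounded_linear[OF bounded_linear_vec_nth i[unfolded set_integrable_def], of l]
    by (simp add: set_lebesgue_integral_def)
  moreover have "(LINT x:torus_cell a|lborel. complex_of_real (W x $ l)) = of_real (LINT x:torus_cell a|lborel. W x $ l)"
    by (rule set_integral_complex_of_real)
  ultimately show ?thesis
    by (simp add: vcoef_def fcoef_def torus_mean_def freq_def zero_vec_def[symmetric] scaleR_conv_of_real[where 'a=complex])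
qed

lemma norm_convection_coefficient_le:
  assumes a: "\<And>i. 0 < a $ i" and W: "has_fourier a W c"
    and s: "(\<lambda>n. norm (freq a n) * norm (c n)) summable_on UNIV"
    and d: "\<And>x. W differentiable (at x)" and div: "\<And>n. kdot (freq a n) (c n) = 0"
    and c: "\<And>m. (norm (c m))\<^sup>2 \<le> C * v m" and v: "v summable_on UNIV"
  shows "norm (vcoef a (convection W) n) \<le> 12 * norm (freq a n) * (C * infsum v UNIV)"
proof -
  have "norm (vcoef a (convection W) n $ l) \<le> 3 * norm (freq a n) * (C * infsum v UNIV)" for l
  proof -
    note conv = convection_fourier_coefficients[OF a W s d div, of n l]
    have "norm (\<Sum>\<^sub>\<infinity>m. kdot (freq a n) (c m) * c (n - m) $ l)
        \<le> 3 * norm (freq a n) * (\<Sum>\<^sub>\<infinity>m. norm (c m) * norm (c (n - m)))"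
    proof (rule norm_infsum_le[OF has_sum_infsum[OF conv(1)]])
      show "((\<lambda>m. 3 * norm (freq a n) * (norm (c m) * norm (c (n - m)))) has_sum
          3 * norm (freq a n) * (\<Sum>\<^sub>\<infinity>m. norm (c m) * norm (c (n - m)))) UNIV"
        by (intro has_sum_cmult_right has_sum_infsum norm_convolution_le(1)[OF c v])
      show "norm (kdot (freq a n) (c m) * c (n - m) $ l) \<le> 3 * norm (freq a n) * (norm (c m) * norm (c (n - m)))" for m
        using mult_mono[OF norm_kdot_le[of "freq a n" "c m"] norm_component_le[of "c (n - m)" l]]
        by (simp add: norm_mult mult.assoc)
    qed
    also have "\<dots> \<le> 3 * norm (freq a n) * (C * infsum v UNIV)"
      by (intro mult_left_mono norm_convolution_le(2)[OF c v]) auto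
    finally show ?thesis by (simp add: conv(2) norm_mult)
  qed
  from this[of 1] this[of 2] this[of 3] this[of 4] norm_le_sum_nth[of "vcoef a (convection W) n"]
  show ?thesis by linarith
qed

text \<open>
  The finite set \<open>F\<close> is chosen first, so that the tail contributes at most half of \<open>\<delta>\<close>; this choice
  depends on the solution only through the bound \<open>M\<close>. The error of order \<open>\<epsilon>\<close>, whose constant
  depends on \<open>F\<close>, is made small afterwards.
\<close>

lemma horizontal_mode_convergence:
  fixes a :: "real^3" and n :: "int^3"
  assumes a: "\<And>i. 0 < a $ i" and \<nu>: "0 < \<nu>" and s: "5 / 2 < s" and T: "0 \<le> T"
    and n: "n \<noteq> 0" "n $ 1 = 0" "n $ 2 = 0" and j: "j \<noteq> 3" and \<delta>: "0 < \<delta>"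
    and \<kappa>: "\<kappa> = (if j = 4 then 0 else \<nu> * (norm (freq a n))\<^sup>2)"
  obtains \<epsilon>0 where "0 < \<epsilon>0"
    "\<And>\<epsilon> V t. \<lbrakk>0 < \<epsilon>; \<epsilon> < \<epsilon>0; PBS_solution a \<nu> s \<epsilon> V0 T V; \<forall>t\<in>{0..T}. sobolev_norm a s (V t) \<le> M; t \<in> {0..T}\<rbrakk>
      \<Longrightarrow> norm (of_real (exp (\<kappa> * t)) * vcoef a (V t) n $ j - vcoef a (V 0) n $ j) \<le> \<delta>"
proof -
  define v where "v p = (1 + (norm (freq a p))\<^sup>2) powr (- s)" for p
  \<comment> \<open>If there is no solution to which the bound applies, \<open>M\<close> can be negative.\<close>
  define N where "N = max 0 M"
  define K where "K = freq a n $ 3"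
  define g where "g p = 12 * norm (freq a p) * (N\<^sup>2 * infsum v UNIV) + 3 * \<nu> * (norm (freq a p))\<^sup>2 * N" for p
  define h where "h p = N\<^sup>2 * (v p + v (n - p))" for p
  have N: "0 \<le> N" by (simp add: N_def)
  have v: "v summable_on UNIV" unfolding v_def by (rule summable_freq_powr[OF a]) (use s in simp)
  have v0: "0 \<le> v p" for p by (simp add: v_def)
  have g0: "0 \<le> g p" for p using \<nu> N infsum_nonneg[of UNIV v] v0 by (simp add: g_def)
  have h: "h summable_on UNIV"
    unfolding h_def using summable_on_reindex_bij_betw[OF bij_reflect, of v n] v
    by (intro summable_on_cmult_right summable_on_add) auto
  have \<kappa>0: "0 \<le> \<kappa>" using \<nu> \<kappa> by simp
  have Kn0: "K \<noteq> 0" using n less_imp_neq[OF a, of 3]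
    by (auto simp: K_def freq_def vec_eq_iff forall_3)
  have "\<exists>Q. bounded_bilinear Q \<and> (\<forall>X Y P q. kdot (freq a p) X = 0 \<longrightarrow> kdot (freq a (n - p)) Y = 0
      \<longrightarrow> (p = 0 \<longrightarrow> X = 0) \<longrightarrow> (n - p = 0 \<longrightarrow> Y = 0) \<longrightarrow>
      Q (fast_symbol (freq a p) P X) Y + Q X (fast_symbol (freq a (n - p)) q Y)
        = of_real K * vertical_flux X Y $ j)" for p
  proof (cases "p = 0 \<or> n - p = 0")
    case True
    have "bounded_bilinear (\<lambda>(X :: complex^4) (Y :: complex^4). 0 :: complex)"
      by (simp add: bilinear_conv_bounded_bilinear[symmetric] bilinear_def linear_iff)
    then show ?thesis using True by (intro exI[of _ "\<lambda>X Y. 0"]) (auto simp: vertical_flux_def)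
  next
    case False
    have z: "freq a q = 0 \<longleftrightarrow> q = 0" for q using freq_eq_iff[OF a, of q 0] by (simp add: freq_def zero_vec_def)
    have e: "freq a (n - p) $ 1 = - freq a p $ 1" "freq a (n - p) $ 2 = - freq a p $ 2"
      "K = freq a p $ 3 + freq a (n - p) $ 3"
      using n by (simp_all add: K_def freq_def diff_divide_distrib)
    show ?thesis
      using vertical_flux_is_fast_derivative[OF e(1,2) _ _ j] False unfolding z e(3) by metis
  qed
  then obtain Q where Q: "\<And>p. bounded_bilinear (Q p)"
    and Q_fast: "\<And>p X Y P q. \<lbrakk>kdot (freq a p) X = 0; kdot (freq a (n - p)) Y = 0; p = 0 \<Longrightarrow> X = 0; n - p = 0 \<Longrightarrow> Y = 0\<rbrakk>
      \<Longrightarrow> Q p (fast_symbol (freq a p) P X) Y + Q p X (fast_symbol (freq a (n - p)) q Y)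
        = of_real K * vertical_flux X Y $ j"
    by metis
  have "\<exists>B\<ge>0. \<forall>Y Z. norm (Q p Y Z) \<le> B * norm Y * norm Z" for p
    using bounded_bilinear.nonneg_bounded[OF Q, of p] by (metis mult.assoc mult.commute)
  then obtain B where B: "\<And>p. 0 \<le> B p" "\<And>p Y Z. norm (Q p Y Z) \<le> B p * norm Y * norm Z" by metis
  define E where "E = exp (\<kappa> * T)"
  have E: "0 < E" by (simp add: E_def)
  \<comment> \<open>The denominators make the two error terms at the end add up to \<open>\<delta>\<close>; adding \<open>1\<close> avoids a division by zero.\<close>
  obtain F where F: "finite F" and tail: "infsum h (- F) < \<delta> / (2 * E * (T * \<bar>K\<bar> + 1))"
    by (rule infsum_tail_less[OF h, of "\<delta> / (2 * E * (T * \<bar>K\<bar> + 1))"])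
      (use \<delta> E T in \<open>auto intro!: divide_pos_pos mult_pos_pos add_nonneg_pos\<close>)
  define A where "A = (\<Sum>p\<in>F. B p * N * (2 * N + T * (\<kappa> * N + g p + g (n - p))))"
  have A: "0 \<le> A" unfolding A_def using B(1) N g0 T \<kappa>0 by (intro sum_nonneg mult_nonneg_nonneg add_nonneg_nonneg) auto
  define \<epsilon>0 where "\<epsilon>0 = \<delta> / (2 * E * (A + 1))"
  show thesis
  proof (rule that)
    show "0 < \<epsilon>0" using \<delta> E A by (simp add: \<epsilon>0_def)
    fix \<epsilon> V t
    assume \<epsilon>: "0 < \<epsilon>" "\<epsilon> < \<epsilon>0" and PBS: "PBS_solution a \<nu> s \<epsilon> V0 T V"
      and M: "\<forall>t\<in>{0..T}. sobolev_norm a s (V t) \<le> M" and t: "t \<in> {0..T}"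
    define X where "X p t = vcoef a (V t) p" for p t
    have sob: "V t \<in> sobolev a s" and mean: "torus_mean a (V t) = 0"
      and diff: "V t differentiable (at x)" and div: "kdot (freq a p) (X p t) = 0" if "t \<in> {0..T}" for t x p
      using PBS that by (auto simp: PBS_solution_def sobolev_path_def div_free_def X_def)
    have cont: "continuous_on UNIV (V t)" if "t \<in> {0..T}" for t
      using diff[OF that] by (simp add: continuous_at_imp_continuous_on differentiable_imp_continuous_within)
    have four: "has_fourier a (V t) (\<lambda>p. X p t)" "(\<lambda>p. norm (freq a p) * norm (X p t)) summable_on UNIV"
      if "t \<in> {0..T}" for t
      using sobolev_has_fourier[OF a s sob[OF that] cont[OF that]] by (simp_all add: X_def)
    have X2: "(norm (X p t))\<^sup>2 \<le> N\<^sup>2 * v p" if t: "t \<in> {0..T}" for p t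
    proof -
      have x: "0 < 1 + (norm (freq a p))\<^sup>2" by (simp add: add_pos_nonneg)
      have "(1 + (norm (freq a p))\<^sup>2) powr s * (norm (X p t))\<^sup>2 \<le> (sobolev_norm a s (V t))\<^sup>2"
        unfolding X_def by (rule sobolev_coefficient_le) (use sob[OF t] in \<open>simp add: sobolev_def\<close>)
      also have "\<dots> \<le> N\<^sup>2"
        using bspec[OF M t] by (intro power_mono sobolev_norm_nonneg) (simp add: N_def)
      finally have "(1 + (norm (freq a p))\<^sup>2) powr s * (norm (X p t))\<^sup>2 * v p \<le> N\<^sup>2 * v p"
        by (intro mult_right_mono v0)
      moreover have "(1 + (norm (freq a p))\<^sup>2) powr s * v p = 1"
        unfolding v_def powr_add[symmetric] using x by simp
      then have "(1 + (norm (freq a p))\<^sup>2) powr s * (norm (X p t))\<^sup>2 * v p = (norm (X p t))\<^sup>2"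
        by algebra
      ultimately show ?thesis by (simp only:)
    qed
    have XN: "norm (X p t) \<le> N" if "t \<in> {0..T}" for p t
    proof (rule power2_le_imp_le[OF order.trans[OF X2[OF that]] N])
      have "v p \<le> 1" unfolding v_def using s powr_mono[of "- s" 0 "1 + (norm (freq a p))\<^sup>2"] by (simp split: if_splits)
      then show "N\<^sup>2 * v p \<le> N\<^sup>2" by (simp add: mult_left_le)
    qed
    have X0: "X 0 t = 0" if t: "t \<in> {0..T}" for t
      by (simp add: X_def vec_eq_iff vcoef_0[OF cont[OF t]] mean[OF t])
    define P where "P \<Phi> t p d \<longleftrightarrow> (X p has_vector_derivative d) (at t within {0..T}) \<and>
        d + vcoef a (convection (V t)) p - diffusion_symbol \<nu> (freq a p) (X p t)
          + (1 / \<epsilon>) *\<^sub>R vcoef a (skew (V t)) p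
        = - ((1 / \<epsilon>) *\<^sub>R grad_symbol (freq a p) (fcoef a (\<Phi> t) p))" for \<Phi> t p d
    obtain \<Phi> where \<Phi>: "\<forall>t\<in>{0..T}. \<forall>p. \<exists>d. P \<Phi> t p d"
      using PBS unfolding PBS_solution_def P_def X_def[abs_def] by blast
    define D where "D p t = (SOME d. P \<Phi> t p d)" for p t
    have PD: "P \<Phi> t p (D p t)" if "t \<in> {0..T}" for t p
      unfolding D_def by (rule someI_ex) (use \<Phi> that in blast)
    have D: "(X p has_vector_derivative D p t) (at t within {0..T})"
      and eq: "D p t + vcoef a (convection (V t)) p - diffusion_symbol \<nu> (freq a p) (X p t)
             + (1 / \<epsilon>) *\<^sub>R vcoef a (skew (V t)) p
           = - ((1 / \<epsilon>) *\<^sub>R grad_symbol (freq a p) (fcoef a (\<Phi> t) p))" if "t \<in> {0..T}" for t p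
      using PD[OF that, of p] by (auto simp: P_def)
    define R where "R p t = diffusion_symbol \<nu> (freq a p) (X p t) - vcoef a (convection (V t)) p" for p t
    have skew: "vcoef a (skew (V t)) p = skew_symbol (X p t)" if "t \<in> {0..T}" for p t
      using vcoef_has_fourier[OF a has_fourier_skew[OF four(1)[OF that]]] by simp
    have DR: "D p t = R p t + (1 / \<epsilon>) *\<^sub>R fast_symbol (freq a p) (fcoef a (\<Phi> t) p) (X p t)" if "t \<in> {0..T}" for p t
      using eq[OF that, of p] unfolding skew[OF that] R_def fast_symbol_def
      by (simp add: algebra_simps)
    define \<phi> where "\<phi> p t = vertical_flux (X p t) (X (n - p) t) $ j" for p t
    have flux: "norm (X p t $ i * X (n - p) t $ l) \<le> N\<^sup>2 / 2 * (v p + v (n - p))" if t: "t \<in> {0..T}" for p t i l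
    proof -
      have "norm (X p t $ i * X (n - p) t $ l) \<le> norm (X p t) * norm (X (n - p) t)"
        unfolding norm_mult by (intro mult_mono norm_component_le) auto
      also have "\<dots> \<le> N\<^sup>2 / 2 * (v p + v (n - p))"
        using sum_squares_bound[of "norm (X p t)" "norm (X (n - p) t)"] X2[OF t, of p] X2[OF t, of "n - p"]
        by (simp add: algebra_simps)
      finally show ?thesis .
    qed
    have \<phi>h: "norm (\<phi> p t) \<le> h p" if t: "t \<in> {0..T}" for p t
      using norm_triangle_ineq[of "X p t $ 3 * X (n - p) t $ j" "X p t $ j * X (n - p) t $ 3"]
        flux[OF t, of p 3 j] flux[OF t, of p j 3]
      by (simp add: \<phi>_def vertical_flux_def h_def algebra_simps)
    have "norm (of_real (exp (\<kappa> * t)) * X n t $ j - X n 0 $ j)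
      \<le> exp (\<kappa> * T) * (\<epsilon> * (\<Sum>p\<in>F. B p * N * (2 * N + T * (\<kappa> * N + g p + g (n - p)))) + T * \<bar>K\<bar> * infsum h (- F))"
    proof (rule slow_mode_estimate[OF T \<epsilon>(1) \<kappa>0 F N Q B(2,1) D XN _ g0 _ _ \<phi>h h t])
      fix p t assume t: "t \<in> {0..T}"
      have "norm (diffusion_symbol \<nu> (freq a p) (X p t)) \<le> 3 * \<nu> * (norm (freq a p))\<^sup>2 * N"
        using \<nu> by (intro order.trans[OF norm_diffusion_symbol_le] mult_left_mono XN t) auto
      moreover have "norm (vcoef a (convection (V t)) p) \<le> 12 * norm (freq a p) * (N\<^sup>2 * infsum v UNIV)"
        by (rule norm_convection_coefficient_le[OF a four[OF t] diff[OF t] div[OF t] X2[OF t] v])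
      ultimately show "norm (R p t) \<le> g p"
        unfolding R_def g_def by (intro order.trans[OF norm_triangle_ineq4]) simp
      show "Q p (D p t - R p t) (X (n - p) t) + Q p (X p t) (D (n - p) t - R (n - p) t) = of_real (K / \<epsilon>) * \<phi> p t"
        using Q_fast[OF div[OF t] div[OF t], of p "fcoef a (\<Phi> t) p" "fcoef a (\<Phi> t) (n - p)"] X0[OF t]
        by (simp add: DR[OF t] bounded_bilinear.scaleR_left[OF Q] bounded_bilinear.scaleR_right[OF Q]
            \<phi>_def scaleR_conv_of_real[where 'a = complex] flip: add_divide_distrib)
    next
      fix t assume t: "t \<in> {0..T}"
      show "D n t $ j = - of_real \<kappa> * X n t $ j - (\<i> * of_real K / 2) * (\<Sum>\<^sub>\<infinity>p. \<phi> p t)"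
      proof -
        have k: "freq a n $ 1 = 0" "freq a n $ 2 = 0" using n by (simp_all add: freq_def)
        have kdot: "kdot (freq a n) Y = of_real K * Y $ 3" for Y by (simp add: kdot_def k K_def)
        have Xn3: "X n t $ 3 = 0" using div[OF t, of n] Kn0 by (simp add: kdot)
        have fast0: "fast_symbol (freq a n) P (X n t) $ j = 0" for P
          using exhaust_4[of j] j k Xn3 by (auto simp: fast_symbol_nth)
        have dif: "diffusion_symbol \<nu> (freq a n) (X n t) $ j = - of_real \<kappa> * X n t $ j"
          using exhaust_4[of j] j by (auto simp: diffusion_symbol_def \<kappa>)
        have u: "(\<lambda>m. X m t $ 3 * X (n - m) t $ j) summable_on UNIV" (is "?u summable_on UNIV")
        proof (rule summable_on_bound(1))
          show "(\<lambda>m. N\<^sup>2 / 2 * (v m + v (n - m))) summable_on UNIV"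
            using summable_on_cmult_right[OF h, of "1/2"] by (simp add: h_def)
        qed (rule flux[OF t])
        have u': "(\<lambda>m. ?u (n - m)) summable_on UNIV" "(\<Sum>\<^sub>\<infinity>m. ?u (n - m)) = infsum ?u UNIV"
          using u summable_on_reindex_bij_betw[OF bij_reflect, of ?u n]
            infsum_reindex_bij_betw[OF bij_reflect, of ?u n] by auto
        have "(\<Sum>\<^sub>\<infinity>p. \<phi> p t) = (\<Sum>\<^sub>\<infinity>m. ?u m + ?u (n - m))"
          by (rule infsum_cong) (simp add: \<phi>_def vertical_flux_def mult.commute)
        also have "\<dots> = infsum ?u UNIV + (\<Sum>\<^sub>\<infinity>m. ?u (n - m))" by (rule infsum_add[OF u u'(1)])
        also have "\<dots> = 2 * infsum ?u UNIV" by (simp only: u'(2) mult_2)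
        finally have \<phi>u: "(\<Sum>\<^sub>\<infinity>p. \<phi> p t) = 2 * infsum ?u UNIV" .
        have "vcoef a (convection (V t)) n $ j = \<i> * (\<Sum>\<^sub>\<infinity>m. kdot (freq a n) (X m t) * X (n - m) t $ j)"
          by (rule convection_fourier_coefficients(2)[OF a four[OF t] diff[OF t] div[OF t]])
        also have "(\<Sum>\<^sub>\<infinity>m. kdot (freq a n) (X m t) * X (n - m) t $ j) = of_real K * infsum ?u UNIV"
          unfolding kdot mult.assoc by (rule infsum_cmult_right')
        finally show ?thesis
          by (simp add: DR[OF t] fast0 R_def dif \<phi>u)
      qed
    qed
    also have "\<dots> = E * \<epsilon> * A + E * (T * \<bar>K\<bar>) * infsum h (- F)"
      by (simp add: A_def E_def algebra_simps)
    also have "\<dots> \<le> E * \<epsilon>0 * (A + 1) + E * (T * \<bar>K\<bar> + 1) * (\<delta> / (2 * E * (T * \<bar>K\<bar> + 1)))"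
      using \<epsilon> E A T tail \<delta> infsum_nonneg[of "- F" h] N v0
      by (intro add_mono mult_mono) (auto simp: h_def)
    also have "\<dots> = \<delta>"
    proof -
      have "T * \<bar>K\<bar> + 1 > 0" "A + 1 > 0" using T A by (auto intro: add_nonneg_pos)
      then show ?thesis using E unfolding \<epsilon>0_def by (simp add: divide_simps) (simp add: algebra_simps)
    qed
    finally show "norm (of_real (exp (\<kappa> * t)) * vcoef a (V t) n $ j - vcoef a (V 0) n $ j) \<le> \<delta>"
      by (simp add: X_def)
  qed
qed


section \<open>Horizontal averages and vertical modes\<close>

text \<open>
  The torus as a product of the horizontal torus and the vertical circle, in the coordinates used
  by \<open>horizontal_average\<close>.
\<close>

definition cylinder :: "(real^2) \<times> real \<Rightarrow> real^3" where
  "cylinder p = vector [fst p $ 1, fst p $ 2, snd p]"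

lemma cylinder_nth [simp]:
  "cylinder p $ 1 = fst p $ 1" "cylinder p $ 2 = fst p $ 2" "cylinder p $ 3 = snd p"
  by (simp_all add: cylinder_def)

lemma cylinder_measurable [measurable]: "cylinder \<in> borel_measurable borel"
proof -
  have "cylinder = (\<lambda>p. \<chi> i. if i = 1 then fst p $ 1 else if i = 2 then fst p $ 2 else snd p)"
    by (simp add: fun_eq_iff vec_eq_iff forall_3)
  moreover have "continuous_on UNIV (\<lambda>p::(real^2) \<times> real. \<chi> i::3. if i = 1 then fst p $ 1 else if i = 2 then fst p $ 2 else snd p)"
  proof (rule continuous_on_vec_lambda)
    fix i :: 3
    show "continuous_on UNIV (\<lambda>p::(real^2) \<times> real. if i = 1 then fst p $ 1 else if i = 2 then fst p $ 2 else snd p)"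
      by (cases "i = 1"; cases "i = 2") (auto intro!: continuous_intros)
  qed
  ultimately show ?thesis by (metis borel_measurable_continuous_onI)
qed

lemma lborel_cylinder: "distr (lborel \<Otimes>\<^sub>M lborel) borel cylinder = lborel"
proof (rule lborel_eqI[symmetric])
  fix l u :: "real^3" assume lu: "\<And>b. b \<in> Basis \<Longrightarrow> l \<bullet> b \<le> u \<bullet> b"
  have le: "l $ i \<le> u $ i" for i
    using lu[of "axis i 1"] by (auto simp: inner_axis Basis_vec_def)
  let ?h = "\<lambda>x::real^3. vector [x $ 1, x $ 2] :: real^2"
  have "cylinder -` box l u \<inter> space (lborel \<Otimes>\<^sub>M lborel) = box (?h l) (?h u) \<times> box (l $ 3) (u $ 3)"
    by (auto simp: mem_box_cart forall_3 forall_2 space_pair_measure)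
  then have "emeasure (distr (lborel \<Otimes>\<^sub>M lborel) borel cylinder) (box l u)
      = emeasure (lborel \<Otimes>\<^sub>M lborel) (box (?h l) (?h u) \<times> box (l $ 3) (u $ 3))"
    by (subst emeasure_distr) (simp_all add: lborel_prod)
  also have "\<dots> = emeasure lborel (box (?h l) (?h u)) * emeasure lborel (box (l $ 3) (u $ 3))"
    by (rule lborel.emeasure_pair_measure_Times) auto
  also have "emeasure lborel (box (?h l) (?h u)) = ennreal ((u $ 1 - l $ 1) * (u $ 2 - l $ 2))"
  proof -
    have "\<forall>b\<in>Basis. ?h l \<bullet> b \<le> ?h u \<bullet> b"
      using le by (auto simp: Basis_vec_def inner_axis forall_2)
    then show ?thesis
      by (subst emeasure_lborel_box_eq) (simp add: prod_Basis_cart inner_axis UNIV_2)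
  qed
  also have "emeasure lborel (box (l $ 3) (u $ 3)) = ennreal (u $ 3 - l $ 3)"
    using le[of 3] by simp
  also have "ennreal ((u $ 1 - l $ 1) * (u $ 2 - l $ 2)) * ennreal (u $ 3 - l $ 3) = ennreal (\<Prod>b\<in>Basis. (u - l) \<bullet> b)"
  proof -
    have "(\<Prod>b\<in>Basis. (u - l) \<bullet> b) = (u $ 1 - l $ 1) * (u $ 2 - l $ 2) * (u $ 3 - l $ 3)"
      unfolding prod_Basis_cart inner_axis UNIV_3 by simp
    then show ?thesis using ennreal_mult''[of "u $ 3 - l $ 3"] le[of 3] by simp
  qed
  finally show "emeasure (distr (lborel \<Otimes>\<^sub>M lborel) borel cylinder) (box l u) = ennreal (\<Prod>b\<in>Basis. (u - l) \<bullet> b)" .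
qed simp

lemma cylinder_fubini:
  fixes f :: "real^3 \<Rightarrow> 'b::{banach,second_countable_topology}"
  assumes f: "integrable lborel f"
  shows "integrable lborel (\<lambda>z. \<integral>y. f (cylinder (y, z)) \<partial>lborel)"
    "(\<integral>z. (\<integral>y. f (cylinder (y, z)) \<partial>lborel) \<partial>lborel) = integral\<^sup>L lborel f"
    "AE z in lborel. integrable lborel (\<lambda>y. f (cylinder (y, z)))"
proof -
  have [measurable]: "f \<in> borel_measurable borel" using f by auto
  have m: "cylinder \<in> measurable (lborel \<Otimes>\<^sub>M lborel) borel" unfolding lborel_prod by simp
  have i: "integrable (lborel \<Otimes>\<^sub>M lborel) (\<lambda>(y, z). f (cylinder (y, z)))"
    using f by (subst (asm) lborel_cylinder[symmetric]) (simp add: integrable_distr_eq[OF m] case_prod_unfold)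
  show "integrable lborel (\<lambda>z. \<integral>y. f (cylinder (y, z)) \<partial>lborel)"
    by (rule lborel_pair.integrable_snd[OF i])
  show "AE z in lborel. integrable lborel (\<lambda>y. f (cylinder (y, z)))"
    by (rule lborel_pair.AE_integrable_snd[OF i])
  have "(\<integral>z. (\<integral>y. f (cylinder (y, z)) \<partial>lborel) \<partial>lborel) = integral\<^sup>L (lborel \<Otimes>\<^sub>M lborel) (\<lambda>(y, z). f (cylinder (y, z)))"
    by (rule lborel_pair.integral_snd[OF i])
  also have "\<dots> = integral\<^sup>L lborel f"
    using integral_distr[OF m, of f] by (simp add: lborel_cylinder case_prod_unfold)
  finally show "(\<integral>z. (\<integral>y. f (cylinder (y, z)) \<partial>lborel) \<partial>lborel) = integral\<^sup>L lborel f" .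
qed

definition vertical_mode :: "int \<Rightarrow> int^3" where
  "vertical_mode m = vector [0, 0, m]"

lemma vertical_mode_nth [simp]:
  "vertical_mode m $ 1 = 0" "vertical_mode m $ 2 = 0" "vertical_mode m $ 3 = m"
  by (simp_all add: vertical_mode_def)

lemma freq_vertical_mode: "freq a (vertical_mode m) \<bullet> x = of_int m / a $ 3 * x $ 3"
  by (simp add: inner_vec_def sum_3 freq_def)

lemma norm_freq_vertical_mode: "(norm (freq a (vertical_mode m)))\<^sup>2 = (of_int m / a $ 3)\<^sup>2"
  unfolding power2_norm_eq_inner inner_vec_def sum_3 freq_def by (simp add: power2_eq_square)

lemma indicator_cell_cylinder:
  "indicator (torus_cell a) (cylinder (y, z)) =
    (indicator (torus_cell (vector [a $ 1, a $ 2] :: real^2)) y * indicator {0..2 * pi * a $ 3} z :: real)"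
  by (auto simp: indicator_def torus_cell_def mem_box_cart forall_3 forall_2)

lemma horizontal_average_integral:
  "(\<integral>y. indicator (torus_cell a) (cylinder (y, z)) *\<^sub>R W (cylinder (y, z)) \<partial>lborel)
    = indicator {0..2 * pi * a $ 3} z *\<^sub>R
      (LINT y:torus_cell (vector [a $ 1, a $ 2] :: real^2)|lborel. W (cylinder (y, z)))"
  by (simp add: indicator_cell_cylinder set_lebesgue_integral_def mult.commute flip: scaleR_scaleR)

lemma horizontal_average_eq:
  "horizontal_average a W z = (1 / ((2 * pi * a $ 1) * (2 * pi * a $ 2))) *\<^sub>R
    (LINT y:torus_cell (vector [a $ 1, a $ 2] :: real^2)|lborel. W (cylinder (y, z)))"
  by (simp add: horizontal_average_def torus_mean_def cylinder_def UNIV_2)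

text \<open>
  By Fubini's theorem: the characters with vertical frequency do not depend on the horizontal
  variables. Components and horizontal integrals commute only where the slice is integrable, that
  is, for almost every \<open>z\<close>.
\<close>

lemma horizontal_average_coefficients:
  assumes a: "\<And>i. 0 < a $ i" and W: "W \<in> torus_L2 a"
  shows "set_integrable lborel {0..2 * pi * a $ 3} (\<lambda>z. complex_of_real (horizontal_average a W z $ k))"
    "(LINT z:{0..2 * pi * a $ 3}|lborel. complex_of_real (horizontal_average a W z $ k) * cis (- (of_int m / a $ 3 * z)))
      = of_real (2 * pi * a $ 3) * vcoef a W (vertical_mode m) $ k"
proof -
  let ?C2 = "torus_cell (vector [a $ 1, a $ 2] :: real^2)" and ?I = "{0..2 * pi * a $ 3}"
  define A where "A = (2 * pi * a $ 1) * (2 * pi * a $ 2)"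
  have A: "A \<noteq> 0" using less_imp_neq[OF a] by (simp add: A_def)
  let ?J = "\<lambda>z. LINT y:?C2|lborel. W (cylinder (y, z))"
  have H: "?J z = A *\<^sub>R horizontal_average a W z" for z
    using A by (simp add: horizontal_average_eq A_def)
  have G: "integrable lborel (\<lambda>x. indicator (torus_cell a) x *\<^sub>R W x)"
    using torus_L2_integrable[OF W] by (simp add: set_integrable_def)
  note fub = cylinder_fubini[OF G, unfolded horizontal_average_integral H]
  have "integrable lborel (\<lambda>z. (1 / A) *\<^sub>R indicator ?I z *\<^sub>R A *\<^sub>R horizontal_average a W z)"
    by (rule integrable_scaleR_right[OF fub(1)])
  then have Hi: "integrable lborel (\<lambda>z. indicator ?I z *\<^sub>R horizontal_average a W z)"
    using A by simp
  have "integrable lborel (\<lambda>z. complex_of_real ((indicator ?I z *\<^sub>R horizontal_average a W z) $ k))"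
    by (rule integrable_bounded_linear[OF bounded_linear_compose[OF bounded_linear_of_real bounded_linear_vec_nth] Hi])
  then show Hc: "set_integrable lborel ?I (\<lambda>z. complex_of_real (horizontal_average a W z $ k))"
    by (simp add: set_integrable_def scaleR_conv_of_real[where 'a = complex])
  define E where "E z = cis (- (of_int m / a $ 3 * z))" for z
  have [measurable]: "E \<in> borel_measurable borel"
    unfolding E_def by (intro borel_measurable_continuous_onI continuous_intros)
  let ?F = "\<lambda>x. indicator (torus_cell a) x *\<^sub>R (complex_of_real (W x $ k) * cis (- (freq a (vertical_mode m) \<bullet> x)))"
  have F: "integrable lborel ?F"
    using torus_L2_set_integrable[OF W, of "\<lambda>x. - (freq a (vertical_mode m) \<bullet> x)" k]
    by (simp add: set_integrable_def continuous_intros)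
  note fubF = cylinder_fubini[OF F]
  have ae: "AE z in lborel. (\<integral>y. ?F (cylinder (y, z)) \<partial>lborel)
      = indicator ?I z *\<^sub>R (of_real (A * horizontal_average a W z $ k) * E z)"
    using cylinder_fubini(3)[OF G]
  proof eventually_elim
    case (elim z)
    have "(\<integral>y. ?F (cylinder (y, z)) \<partial>lborel)
      = (\<integral>y. complex_of_real ((indicator (torus_cell a) (cylinder (y, z)) *\<^sub>R W (cylinder (y, z))) $ k) * E z \<partial>lborel)"
      by (rule Bochner_Integration.integral_cong) (simp_all add: freq_vertical_mode E_def scaleR_conv_of_real[where 'a = complex])
    also have "\<dots> = (\<integral>y. complex_of_real ((indicator (torus_cell a) (cylinder (y, z)) *\<^sub>R W (cylinder (y, z))) $ k) \<partial>lborel) * E z"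
      by simp
    also have "(\<integral>y. complex_of_real ((indicator (torus_cell a) (cylinder (y, z)) *\<^sub>R W (cylinder (y, z))) $ k) \<partial>lborel)
      = of_real ((\<integral>y. indicator (torus_cell a) (cylinder (y, z)) *\<^sub>R W (cylinder (y, z)) \<partial>lborel) $ k)"
      by (rule integral_bounded_linear[OF bounded_linear_compose[OF bounded_linear_of_real bounded_linear_vec_nth] elim])
    finally show ?case
      unfolding horizontal_average_integral H by (simp add: scaleR_conv_of_real[where 'a = complex])
  qed
  have "(\<integral>z. indicator ?I z *\<^sub>R (of_real (A * horizontal_average a W z $ k) * E z) \<partial>lborel)
      = (\<integral>z. (\<integral>y. ?F (cylinder (y, z)) \<partial>lborel) \<partial>lborel)"
  proof (rule Bochner_Integration.integral_cong_AE)
    have [measurable]: "(\<lambda>z. indicator ?I z *\<^sub>R complex_of_real (horizontal_average a W z $ k)) \<in> borel_measurable lborel"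
      using Hc by (auto simp: set_integrable_def)
    have "(\<lambda>z. (indicator ?I z *\<^sub>R complex_of_real (horizontal_average a W z $ k)) * (of_real A * E z)) \<in> borel_measurable lborel"
      by measurable
    then show "(\<lambda>z. indicator ?I z *\<^sub>R (of_real (A * horizontal_average a W z $ k) * E z)) \<in> borel_measurable lborel"
      by (simp add: mult_ac)
    show "(\<lambda>z. \<integral>y. ?F (cylinder (y, z)) \<partial>lborel) \<in> borel_measurable lborel"
      using fubF(1) by auto
  qed (use ae in \<open>auto elim!: eventually_mono\<close>)
  also have "\<dots> = integral\<^sup>L lborel ?F" by (rule fubF(2))
  also have "\<dots> = of_real (A * (2 * pi * a $ 3)) * vcoef a W (vertical_mode m) $ k"
  proof -
    have P: "(\<Prod>i\<in>UNIV. 2 * pi * a $ i) = A * (2 * pi * a $ 3)"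
      unfolding UNIV_3 A_def by simp
    have "vcoef a W (vertical_mode m) $ k = (1 / (A * (2 * pi * a $ 3))) *\<^sub>R integral\<^sup>L lborel ?F"
      unfolding vcoef_def vec_lambda_beta fcoef_def torus_mean_def set_lebesgue_integral_def P ..
    moreover have "A * (2 * pi * a $ 3) \<noteq> 0" using A less_imp_neq[OF a, of 3] by simp
    ultimately show ?thesis
      by (simp only: scaleR_conv_of_real mult.assoc[symmetric] of_real_mult[symmetric]) simp
  qed
  finally have *: "(\<integral>z. of_real A * (indicator ?I z *\<^sub>R (of_real (horizontal_average a W z $ k) * E z)) \<partial>lborel)
      = of_real A * (of_real (2 * pi * a $ 3) * vcoef a W (vertical_mode m) $ k)"
    by (simp add: mult_ac)
  then show "(LINT z:?I|lborel. complex_of_real (horizontal_average a W z $ k) * cis (- (of_int m / a $ 3 * z)))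
      = of_real (2 * pi * a $ 3) * vcoef a W (vertical_mode m) $ k"
    using A unfolding set_lebesgue_integral_def E_def[symmetric] integral_mult_right_zero
    by simp
qed

lemma AE_lborel_periodic:
  fixes L :: real
  assumes L: "0 < L" and P: "\<And>z. P (z + L) = P z" and ae: "AE z in lborel. z \<in> {0..L} \<longrightarrow> P z"
  shows "AE z in lborel. P z"
proof -
  have nat: "P (z + of_nat j * L) = P z" for j z
  proof (induction j)
    case (Suc j)
    then show ?case using P[of "z + of_nat j * L"] by (simp add: algebra_simps)
  qed simp
  have int: "P (z + of_int j * L) = P z" for j z
  proof (cases j rule: int_cases2)
    case (nonneg k)
    then show ?thesis using nat by simp
  next
    case (nonpos k)
    then show ?thesis using nat[of "z + of_int j * L" k] by simp
  qed
  have "AE z in lborel. of_int j * L + z \<in> {0..L} \<longrightarrow> P (of_int j * L + z)" for j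
  proof (rule AE_distrD[where f = "(+) (real_of_int j * L)" and M' = borel and P = "\<lambda>z. z \<in> {0..L} \<longrightarrow> P z"])
    show "AE z in distr lborel borel ((+) (of_int j * L)). z \<in> {0..L} \<longrightarrow> P z"
      using ae by (simp only: lborel_distr_plus)
  qed simp
  then have "AE z in lborel. \<forall>j::int. of_int j * L + z \<in> {0..L} \<longrightarrow> P (of_int j * L + z)"
    by (simp add: AE_all_countable)
  then show ?thesis
  proof eventually_elim
    case (elim z)
    let ?j = "- \<lfloor>z / L\<rfloor>"
    have "real_of_int \<lfloor>z / L\<rfloor> \<le> z / L" "z / L \<le> real_of_int \<lfloor>z / L\<rfloor> + 1" by linarith+
    then have "real_of_int \<lfloor>z / L\<rfloor> * L \<le> z" "z \<le> (real_of_int \<lfloor>z / L\<rfloor> + 1) * L"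
      unfolding pos_le_divide_eq[OF L] pos_divide_le_eq[OF L] .
    then have "of_int ?j * L + z \<in> {0..L}" by (simp add: algebra_simps)
    with elim have "P (of_int ?j * L + z)" by blast
    then show ?case using int[of z ?j] by (simp add: add.commute)
  qed
qed

text \<open>
  Uniqueness of Fourier coefficients on the vertical circle, extended to the line by periodicity.
\<close>

lemma horizontal_average_eq_series:
  assumes a: "\<And>i. 0 < a $ i" and W: "W \<in> torus_L2 a"
    and c: "(\<lambda>m. norm (c m)) summable_on UNIV" and eq: "\<And>m. vcoef a W (vertical_mode m) $ k = c m"
  shows "AE z in lborel. complex_of_real (horizontal_average a W z $ k) = (\<Sum>\<^sub>\<infinity>m. c m * cis (of_int m / a $ 3 * z))"
proof -
  define L where "L = 2 * pi * a $ 3"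
  have L: "0 < L" using a by (simp add: L_def)
  define g where "g z = (\<Sum>\<^sub>\<infinity>m. c m * cis (of_int m / a $ 3 * z))" for z
  define H where "H z = complex_of_real (horizontal_average a W z $ k)" for z
  note HA = horizontal_average_coefficients[OF a W, where k = k, folded L_def H_def]
  have a3: "a $ 3 \<noteq> 0" using less_imp_neq[OF a, of 3] by simp
  have dual: "\<kappa> \<in> dual_lattice L \<longleftrightarrow> (\<exists>m::int. \<kappa> = of_int m / a $ 3)" for \<kappa> :: real
  proof -
    have "\<kappa> * L = 2 * pi * of_int m \<longleftrightarrow> \<kappa> * a $ 3 = of_int m" for m :: int by (simp add: L_def mult_ac)
    then show ?thesis using a3 by (simp add: dual_lattice_def eq_divide_eq)
  qed
  have g: "continuous_on UNIV g" unfolding g_def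
    by (rule continuous_on_infsum[OF _ _ c]) (auto intro!: continuous_intros simp: norm_mult a3)
  have cell: "cbox 0 L = {0..L}" by simp
  have "null_spectrum L (\<lambda>z. H z - g z)"
    unfolding null_spectrum_def cell
  proof (intro conjI ballI)
    have gi: "set_integrable lborel {0..L} g" by (intro set_integrable_compact continuous_on_subset[OF g]) auto
    show "set_integrable lborel {0..L} (\<lambda>z. H z - g z)" by (intro set_integral_diff(1) HA(1) gi)
    fix \<kappa> :: real assume "\<kappa> \<in> dual_lattice L"
    then obtain m' :: int where "\<kappa> = of_int m' / a $ 3" using dual by blast
    then obtain m :: int where \<kappa>: "\<kappa> = - (of_int m / a $ 3)" by (metis minus_divide_left minus_minus of_int_minus)
    have si: "set_integrable lborel {0..L} (\<lambda>z. u z * cis (\<kappa> \<bullet> z))" if "set_integrable lborel {0..L} u" for u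
      using set_integrable_mult_continuous[of L u "\<lambda>z. cis (\<kappa> \<bullet> z)"] that
      by (simp add: cell continuous_intros)
    have "(LINT z:{0..L}|lborel. (H z - g z) * cis (\<kappa> \<bullet> z))
        = (LINT z:{0..L}|lborel. H z * cis (\<kappa> \<bullet> z)) - (LINT z:{0..L}|lborel. g z * cis (\<kappa> \<bullet> z))"
      unfolding left_diff_distrib by (intro set_integral_diff(2) si HA(1) gi)
    also have "(LINT z:{0..L}|lborel. H z * cis (\<kappa> \<bullet> z)) = of_real L * c m"
      using HA(2)[of m] by (simp add: \<kappa> eq)
    also have "(LINT z:{0..L}|lborel. g z * cis (\<kappa> \<bullet> z)) = of_real L * c m"
    proof -
      have "{i::int. of_int i / a $ 3 = of_int m / a $ 3} = {m}" using less_imp_neq[OF a, of 3] by auto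
      then show ?thesis
        using trig_series_coefficient[of L "\<lambda>i::int. of_int i / a $ 3" "of_int m / a $ 3" c] L dual c
        by (simp add: g_def \<kappa> cell mult.commute)
    qed
    finally show "(LINT z:{0..L}|lborel. (H z - g z) * cis (\<kappa> \<bullet> z)) = 0" by simp
  qed
  then have "AE z in lborel. z \<in> cbox 0 L \<longrightarrow> H z - g z = 0"
    by (rule null_spectrum_AE_zero[rotated]) (simp add: L)
  then have ae: "AE z in lborel. z \<in> {0..L} \<longrightarrow> H z = g z" by simp
  have "AE z in lborel. H z = g z"
  proof (rule AE_lborel_periodic[OF L _ ae])
    fix z
    have "W (vector [y $ 1, y $ 2, z + L]) = W (vector [y $ 1, y $ 2, z])" for y :: "real^2"
    proof -
      have "vector [y $ 1, y $ 2, z + L] = (vector [y $ 1, y $ 2, z] + axis 3 (2 * pi * a $ 3) :: real^3)"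
        by (simp add: vec_eq_iff forall_3 axis_def L_def)
      then show ?thesis using W by (simp add: torus_L2_def torus_periodic_def)
    qed
    then have "H (z + L) = H z" by (simp add: H_def horizontal_average_def)
    moreover have "g (z + L) = g z"
    proof -
      have "cis (of_int m / a $ 3 * (z + L)) = cis (of_int m / a $ 3 * z)" for m :: int
      proof -
        have "of_int m / a $ 3 * (z + L) = of_int m / a $ 3 * z + 2 * pi * of_int m"
          using a[of 3] by (simp add: L_def field_simps)
        then show ?thesis by (simp flip: cis_mult)
      qed
      then show ?thesis by (simp add: g_def)
    qed
    ultimately show "(H (z + L) = g (z + L)) = (H z = g z)" by simp
  qed
  then show ?thesis by (simp add: H_def g_def)
qed


section \<open>The heat equation on the vertical circle\<close>

definition heat_series :: "real \<Rightarrow> real \<Rightarrow> (int \<Rightarrow> complex) \<Rightarrow> real \<Rightarrow> real \<Rightarrow> complex" where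
  "heat_series b \<nu> c t z = (\<Sum>\<^sub>\<infinity>m. c m * of_real (exp (- (\<nu> * (of_int m / b)\<^sup>2 * t))) * cis (of_int m / b * z))"

lemma heat_series_derivatives:
  fixes b \<nu> T :: real and c :: "int \<Rightarrow> complex"
  assumes b: "0 < b" and \<nu>: "0 < \<nu>"
    and c: "(\<lambda>m. (1 + (of_int m / b)\<^sup>2) * norm (c m)) summable_on UNIV"
  obtains uz uzz where
    "\<And>t z. t \<in> {0..T} \<Longrightarrow> ((\<lambda>r. heat_series b \<nu> c r z) has_vector_derivative of_real \<nu> * uzz t z) (at t within {0..T})"
    "\<And>t z. t \<in> {0..T} \<Longrightarrow> (heat_series b \<nu> c t has_vector_derivative uz t z) (at z)"
    "\<And>t z. t \<in> {0..T} \<Longrightarrow> (uz t has_vector_derivative uzz t z) (at z)"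
    "\<And>t z. heat_series b \<nu> c t (z + 2 * pi * b) = heat_series b \<nu> c t z"
proof -
  define k where "k m = of_int m / b" for m :: int
  define e where "e m t = complex_of_real (exp (- (\<nu> * (k m)\<^sup>2 * t)))" for m t
  define f where "f n m t z = c m * (\<i> * of_real (k m)) ^ n * e m t * cis (k m * z)" for n m t z
  let ?M = "\<lambda>m. (1 + (k m)\<^sup>2) * norm (c m)"
  have M: "?M summable_on UNIV" using c by (simp add: k_def)
  have e1: "norm (e m t) \<le> 1" if "0 \<le> t" for m t using that \<nu> by (simp add: e_def)
  have bd: "norm (f n m t z) \<le> ?M m" if t: "0 \<le> t" and n: "n \<in> {0, 1, 2}" for n m t z
  proof -
    have "\<bar>k m\<bar> ^ n \<le> 1 + (k m)\<^sup>2"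
      using n sum_squares_bound[of 1 "\<bar>k m\<bar>"] abs_ge_zero[of "k m"] by (auto simp: power2_eq_square)
    then have "norm (c m) * \<bar>k m\<bar> ^ n * norm (e m t) \<le> norm (c m) * (1 + (k m)\<^sup>2) * 1"
      by (intro mult_mono e1 t mult_nonneg_nonneg) auto
    then show ?thesis by (simp add: f_def norm_mult norm_power mult.commute)
  qed
  have s: "(\<lambda>m. f n m t z) summable_on UNIV" if "0 \<le> t" "n \<in> {0, 1, 2}" for n t z
    by (rule summable_on_bound(1)[OF bd[OF that] M])
  have dz: "((\<lambda>z. \<Sum>\<^sub>\<infinity>m. f n m t z) has_vector_derivative (\<Sum>\<^sub>\<infinity>m. f (Suc n) m t z)) (at z)"
    if t: "0 \<le> t" and n: "n \<in> {0, 1}" for n t z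
  proof -
    have "((\<lambda>z. \<Sum>\<^sub>\<infinity>m. f n m t z) has_vector_derivative (\<Sum>\<^sub>\<infinity>m. f (Suc n) m t z)) (at z within UNIV)"
    proof (rule has_vector_derivative_infsum[OF _ _ _ _ M])
      fix m z
      have "((\<lambda>w. c m * (\<i> * of_real (k m)) ^ n * e m t * exp (\<i> * (of_real (k m) * w)))
          has_field_derivative f (Suc n) m t z) (at (of_real z))"
        by (auto intro!: derivative_eq_intros simp: f_def cis_conv_exp mult_ac)
      from has_vector_derivative_real_field[OF this]
      show "(f n m t has_vector_derivative f (Suc n) m t z) (at z within UNIV)"
        by (simp add: f_def[abs_def] cis_conv_exp)
      show "norm (f (Suc n) m t z) \<le> ?M m" using n by (intro bd t) auto
      show "(\<lambda>m. f n m t z) summable_on UNIV" using n by (intro s t) auto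
    qed auto
    then show ?thesis by simp
  qed
  have dt: "((\<lambda>r. \<Sum>\<^sub>\<infinity>m. f 0 m r z) has_vector_derivative (\<Sum>\<^sub>\<infinity>m. of_real \<nu> * f 2 m t z)) (at t within {0..T})"
    if t: "t \<in> {0..T}" for t z
  proof (rule has_vector_derivative_infsum[OF _ t])
    fix m r assume r: "r \<in> {0..T}"
    have "((\<lambda>w. c m * exp (- (of_real \<nu> * (of_real (k m))\<^sup>2 * w)) * cis (k m * z))
        has_field_derivative of_real \<nu> * f 2 m r z) (at (of_real r))"
      by (auto intro!: derivative_eq_intros simp: f_def e_def power2_eq_square mult_ac exp_of_real[symmetric])
    from has_vector_derivative_real_field[OF this]
    show "((\<lambda>r. f 0 m r z) has_vector_derivative of_real \<nu> * f 2 m r z) (at r within {0..T})"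
      by (simp add: f_def[abs_def] e_def exp_of_real[symmetric])
    show "norm (of_real \<nu> * f 2 m r z) \<le> \<nu> * ?M m"
      using bd[of r 2 m z] r \<nu> by (simp add: norm_mult)
    show "(\<lambda>m. f 0 m r z) summable_on UNIV" using r by (intro s) auto
  qed (use M in \<open>auto intro: summable_on_cmult_right\<close>)
  have hs: "heat_series b \<nu> c = (\<lambda>t z. \<Sum>\<^sub>\<infinity>m. f 0 m t z)"
    by (simp add: fun_eq_iff heat_series_def f_def e_def k_def)
  show thesis
  proof (rule that[of "\<lambda>t z. \<Sum>\<^sub>\<infinity>m. f 2 m t z" "\<lambda>t z. \<Sum>\<^sub>\<infinity>m. f 1 m t z"])
    fix t z
    show "heat_series b \<nu> c t (z + 2 * pi * b) = heat_series b \<nu> c t z"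
    proof -
      have "cis (of_int m / b * (z + 2 * pi * b)) = cis (of_int m / b * z)" for m :: int
      proof -
        have "of_int m / b * (z + 2 * pi * b) = of_int m / b * z + 2 * pi * of_int m"
          using b by (simp add: field_simps)
        then show ?thesis by (simp flip: cis_mult)
      qed
      then show ?thesis by (simp add: heat_series_def)
    qed
    assume t: "t \<in> {0..T}"
    show "((\<lambda>r. heat_series b \<nu> c r z) has_vector_derivative of_real \<nu> * (\<Sum>\<^sub>\<infinity>m. f 2 m t z)) (at t within {0..T})"
      using dt[OF t, of z] by (simp add: hs infsum_cmult_right')
    show "(heat_series b \<nu> c t has_vector_derivative (\<Sum>\<^sub>\<infinity>m. f 1 m t z)) (at z)"
      using dz[of t 0 z] t by (simp add: hs)
    show "((\<lambda>z. \<Sum>\<^sub>\<infinity>m. f 1 m t z) has_vector_derivative (\<Sum>\<^sub>\<infinity>m. f 2 m t z)) (at z)"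
      using dz[of t 1 z] t by (simp add: numeral_2_eq_2)
  qed
qed


section \<open>The limit system on horizontal averages\<close>

text \<open>
  On the mode \<open>(0,0,m)\<close> with \<open>m \<noteq> 0\<close> the divergence constraint is \<open>m V\<^sup>3 = 0\<close>. Then \<open>skew\<close> has only a
  third component left, which is a gradient and is removed by the Leray projection.
\<close>

lemma PBS_vertical_modes:
  assumes a: "\<And>i. 0 < a $ i" and PBS: "PBS_solution a \<nu> s \<epsilon> V0 T V" and t: "t \<in> {0..T}"
  shows "vcoef a (V t) (vertical_mode m) $ 3 = 0" "vcoef a (V t) 0 = 0"
    "leray_symbol (freq a (vertical_mode m)) (skew_symbol (vcoef a (V t) (vertical_mode m))) = 0"
    "V t \<in> sobolev a s" "continuous_on UNIV (V t)"
proof -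
  let ?n = "vertical_mode m"
  have sob: "V t \<in> sobolev a s" and mean: "torus_mean a (V t) = 0" and div: "div_free a (V t)"
    and diff: "\<And>x. V t differentiable (at x)"
    using PBS t by (auto simp: PBS_solution_def sobolev_path_def)
  show "V t \<in> sobolev a s" by (rule sob)
  show cont: "continuous_on UNIV (V t)"
    using diff by (simp add: continuous_at_imp_continuous_on differentiable_imp_continuous_within)
  show V0: "vcoef a (V t) 0 = 0" by (simp add: vec_eq_iff vcoef_0[OF cont] mean)
  have k: "freq a ?n $ 1 = 0" "freq a ?n $ 2 = 0" "freq a ?n $ 3 = of_int m / a $ 3"
    by (simp_all add: freq_def)
  have n0: "?n = 0 \<longleftrightarrow> m = 0" by (auto simp: vec_eq_iff forall_3)
  show V3: "vcoef a (V t) ?n $ 3 = 0"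
  proof (cases "m = 0")
    case True
    then have "?n = 0" using n0 by simp
    then show ?thesis using V0 by simp
  next
    case False
    have "kdot (freq a ?n) (vcoef a (V t) ?n) = 0" using div by (simp add: div_free_def)
    then show ?thesis using False less_imp_neq[OF a, of 3] by (simp add: kdot_def k)
  qed
  show "leray_symbol (freq a ?n) (skew_symbol (vcoef a (V t) ?n)) = 0"
  proof (cases "m = 0")
    case True
    then have X: "vcoef a (V t) ?n = 0" using V0 n0 by simp
    show ?thesis unfolding X by (simp add: vec_eq_iff forall_4 leray_symbol_def skew_symbol_def kdot_def)
  next
    case False
    then have "of_int m / a $ 3 \<noteq> 0" using less_imp_neq[OF a, of 3] by simp
    then show ?thesis
      unfolding vec_eq_iff forall_4 leray_symbol_def skew_symbol_def norm_freq_vertical_mode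
      by (simp add: kdot_def k V3 power2_eq_square)
  qed
qed

text \<open>
  The filter fixes these modes, so those of \<open>U\<close> are the limits of the modes of the solutions, for
  which \<open>horizontal_mode_convergence\<close> gives the asymptotic behaviour.
\<close>

lemma limit_vertical_modes:
  fixes a :: "real^3" and V :: "real \<Rightarrow> real \<Rightarrow> field" and \<nu> s \<sigma> T :: real
  assumes a: "\<And>i. 0 < a $ i" and \<nu>: "0 < \<nu>" and s: "5 / 2 < s" and T: "0 \<le> T" and \<sigma>: "\<sigma> < s"
    and V0: "V0 \<in> sobolev a s"
    and PBS: "\<And>\<epsilon>. 0 < \<epsilon> \<Longrightarrow> PBS_solution a \<nu> s \<epsilon> V0 T (V \<epsilon>)"
    and M: "\<And>\<epsilon>. 0 < \<epsilon> \<Longrightarrow> \<forall>t\<in>{0..T}. sobolev_norm a s (V \<epsilon> t) \<le> M"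
    and lim: "limit_point_at_zero a \<sigma> T (filtered_solution a V) U" and t: "t \<in> {0..T}"
  shows "vcoef a (U t) (vertical_mode m) $ j = (if j = 3 then 0
    else vcoef a V0 (vertical_mode m) $ j * of_real (exp (- ((if j = 4 then 0 else \<nu> * (of_int m / a $ 3)\<^sup>2) * t))))"
proof -
  let ?n = "vertical_mode m"
  obtain e where e: "\<And>i::nat. 0 < e i" "e \<longlonglongrightarrow> 0"
    and ul: "uniform_limit {0..T} (\<lambda>i t. sobolev_norm a \<sigma> (\<lambda>x. filtered_solution a V (e i) t x - U t x)) (\<lambda>_. 0) sequentially"
    and U: "U t \<in> sobolev a \<sigma>"
    using lim t by (auto simp: limit_point_at_zero_def sobolev_path_def)
  note pv = PBS_vertical_modes[OF a PBS t]
  let ?x = "1 + (norm (freq a ?n))\<^sup>2"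
  have "(\<lambda>i. vcoef a (V (e i) t) ?n - vcoef a (U t) ?n) \<longlonglongrightarrow> 0"
  proof (rule Lim_null_comparison)
    show "\<forall>\<^sub>F i in sequentially. norm (vcoef a (V (e i) t) ?n - vcoef a (U t) ?n)
        \<le> sobolev_norm a \<sigma> (\<lambda>x. filtered_solution a V (e i) t x - U t x) * ?x powr (- (\<sigma> / 2))"
      unfolding filtered_solution_def
      by (intro always_eventually allI filtered_mode_distance[OF a s less_imp_le[OF \<sigma>] pv(4) pv(5) U pv(3)] e)
    have "(\<lambda>i. sobolev_norm a \<sigma> (\<lambda>x. filtered_solution a V (e i) t x - U t x)) \<longlonglongrightarrow> 0"
      by (rule tendsto_uniform_limitI[OF ul t])
    then show "(\<lambda>i. sobolev_norm a \<sigma> (\<lambda>x. filtered_solution a V (e i) t x - U t x) * ?x powr (- (\<sigma> / 2))) \<longlonglongrightarrow> 0"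
      by (rule tendsto_mult_left_zero)
  qed
  then have conv: "(\<lambda>i. vcoef a (V (e i) t) ?n $ j) \<longlonglongrightarrow> vcoef a (U t) ?n $ j"
    by (intro tendsto_vec_nth) (simp add: LIM_zero_iff)
  have init: "vcoef a (V \<epsilon> 0) = vcoef a V0" if "0 < \<epsilon>" for \<epsilon>
  proof
    fix p
    have "V \<epsilon> 0 \<in> borel_measurable borel" "V0 \<in> borel_measurable borel" "AE x in lborel. V \<epsilon> 0 x = V0 x"
      using PBS[OF that] V0 T by (auto simp: PBS_solution_def sobolev_path_def sobolev_def torus_L2_def)
    then show "vcoef a (V \<epsilon> 0) p = vcoef a V0 p" by (rule vcoef_cong_AE)
  qed
  have "0 \<in> {0..T}" using T by simp
  note pv0 = PBS_vertical_modes[OF a PBS this, unfolded init]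
  consider "j = 3" | "m = 0" | "j \<noteq> 3" "m \<noteq> 0" by blast
  then show ?thesis
  proof cases
    case 1
    then have "(\<lambda>i. vcoef a (V (e i) t) ?n $ j) = (\<lambda>i. 0)" using pv(1) e by auto
    then show ?thesis using conv 1 by (simp add: LIMSEQ_const_iff)
  next
    case 2
    then have n: "?n = 0" by (simp add: vec_eq_iff forall_3)
    then have "(\<lambda>i. vcoef a (V (e i) t) ?n $ j) = (\<lambda>i. 0)" using pv(2) e by auto
    moreover have "vcoef a V0 ?n = 0" using pv0(2)[of 1] init[of 1] n by simp
    ultimately show ?thesis using conv by (simp add: LIMSEQ_const_iff)
  next
    case 3
    define \<kappa> where "\<kappa> = (if j = 4 then 0 else \<nu> * (norm (freq a ?n))\<^sup>2)"
    have n: "?n \<noteq> 0" using 3 by (auto simp: vec_eq_iff forall_3)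
    let ?E = "complex_of_real (exp (\<kappa> * t))"
    have "norm (?E * vcoef a (U t) ?n $ j - vcoef a V0 ?n $ j) \<le> \<delta>" if \<delta>: "0 < \<delta>" for \<delta>
    proof -
      obtain \<epsilon>0 where \<epsilon>0: "0 < \<epsilon>0" and
        est: "\<And>\<epsilon> W t. \<lbrakk>0 < \<epsilon>; \<epsilon> < \<epsilon>0; PBS_solution a \<nu> s \<epsilon> V0 T W; \<forall>t\<in>{0..T}. sobolev_norm a s (W t) \<le> M; t \<in> {0..T}\<rbrakk>
          \<Longrightarrow> norm (of_real (exp (\<kappa> * t)) * vcoef a (W t) ?n $ j - vcoef a (W 0) ?n $ j) \<le> \<delta>"
        by (rule horizontal_mode_convergence[OF a \<nu> s T n vertical_mode_nth(1,2) 3(1) \<delta> \<kappa>_def]) (rule that)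
      have "\<forall>\<^sub>F i in sequentially. e i < \<epsilon>0" using e(2) \<epsilon>0 by (rule order_tendstoD)
      then have "\<forall>\<^sub>F i in sequentially. norm (?E * vcoef a (V (e i) t) ?n $ j - vcoef a V0 ?n $ j) \<le> \<delta>"
        by eventually_elim (use est[OF e(1) _ PBS[OF e(1)] M[OF e(1)] t] init[OF e(1)] in auto)
      moreover have "(\<lambda>i. norm (?E * vcoef a (V (e i) t) ?n $ j - vcoef a V0 ?n $ j))
          \<longlonglongrightarrow> norm (?E * vcoef a (U t) ?n $ j - vcoef a V0 ?n $ j)"
        by (intro tendsto_intros conv)
      ultimately show ?thesis by (intro tendsto_upperbound[of _ _ sequentially]) auto
    qed
    then have "norm (?E * vcoef a (U t) ?n $ j - vcoef a V0 ?n $ j) \<le> 0"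
      by (rule field_le_epsilon[of _ 0, simplified])
    then have "vcoef a V0 ?n $ j = ?E * vcoef a (U t) ?n $ j" by simp
    moreover have "?E * complex_of_real (exp (- (\<kappa> * t))) = 1"
      by (simp flip: of_real_mult exp_add)
    ultimately have "vcoef a (U t) ?n $ j = vcoef a V0 ?n $ j * of_real (exp (- (\<kappa> * t)))"
      by (simp add: mult_ac)
    then show ?thesis using 3(1) by (simp add: \<kappa>_def norm_freq_vertical_mode)
  qed
qed

text \<open>
  Here \<open>s > 5/2\<close> enters through the convergence of \<open>\<Sum>m. (1 + m\<^sup>2)\<^sup>2\<^sup>-\<^sup>s\<close>.
\<close>

lemma vertical_modes_summable:
  assumes a: "\<And>i. 0 < a $ i" and s: "5 / 2 < s" and V: "V \<in> sobolev a s"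
  shows "(\<lambda>m. (1 + (of_int m / a $ 3)\<^sup>2) * norm (vcoef a V (vertical_mode m) $ k)) summable_on UNIV"
proof -
  have "inj vertical_mode" by (rule inj_on_inverseI[where g = "\<lambda>n. n $ 3"]) simp
  moreover have "(\<lambda>n. (1 + (norm (freq a n))\<^sup>2) powr s * (norm (vcoef a V n))\<^sup>2) summable_on range vertical_mode"
    by (rule summable_on_subset_banach[of _ UNIV]) (use V in \<open>auto simp: sobolev_def\<close>)
  ultimately have "(\<lambda>m. (1 + (of_int m / a $ 3)\<^sup>2) powr s * (norm (vcoef a V (vertical_mode m)))\<^sup>2) summable_on UNIV"
    by (simp add: summable_on_reindex o_def norm_freq_vertical_mode)
  then have "(\<lambda>m. (1 + (of_int m / a $ 3)\<^sup>2) powr (2 / 2) * norm (vcoef a V (vertical_mode m))) summable_on UNIV"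
    by (rule weighted_summable[rotated]) (use s a summable_int_powr[of "s - 2" "a $ 3"] in auto)
  then have "(\<lambda>m. (1 + (of_int m / a $ 3)\<^sup>2) * norm (vcoef a V (vertical_mode m))) summable_on UNIV"
    by simp
  then show ?thesis
    by (rule summable_on_comparison_test) (auto intro!: mult_left_mono norm_component_le)
qed

theorem proposition5p1:
  fixes a :: "real^3" and \<nu> s \<sigma> Tstar T :: real
    and V0 :: field and V :: "real \<Rightarrow> real \<Rightarrow> field" and U :: "real \<Rightarrow> field"
  assumes "\<And>i. 0 < a $ i" and "0 < \<nu>" and "5 / 2 < s"
    and "V0 \<in> sobolev a s" and "torus_mean a V0 = 0" and "div_free a V0"
    and "uniform_lifespan a \<nu> s V0 Tstar"
    and "\<And>\<epsilon> T'. \<lbrakk>0 < \<epsilon>; 0 \<le> T'; T' < Tstar\<rbrakk> \<Longrightarrow> PBS_solution a \<nu> s \<epsilon> V0 T' (V \<epsilon>)"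
    and "0 \<le> T" and "T < Tstar"
    and "s - 2 < \<sigma>" and "\<sigma> < s"
    and "limit_point_at_zero a \<sigma> T (filtered_solution a V) U"
  shows "\<exists>uh :: real \<Rightarrow> real \<Rightarrow> real^2.
    (\<forall>t\<in>{0..T}. AE z in lborel.
       horizontal_average a (U t) z =
         vector [uh t z $ 1, uh t z $ 2, 0, horizontal_average a V0 z $ 4]) \<and>
    heat_solution_ae (a $ 3) \<nu> T uh \<and>
    (AE z in lborel.
       uh 0 z = vector [horizontal_average a V0 z $ 1, horizontal_average a V0 z $ 2])"
proof -
  note a = assms(1) and \<nu> = assms(2) and s = assms(3) and V0 = assms(4)
  have PBS: "PBS_solution a \<nu> s \<epsilon> V0 T (V \<epsilon>)" if "0 < \<epsilon>" for \<epsilon>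
    using assms(8-10) that by blast
  obtain M where M: "\<forall>t\<in>{0..T}. sobolev_norm a s (V \<epsilon> t) \<le> M" if "0 < \<epsilon>" for \<epsilon>
  proof -
    obtain M where M: "\<forall>\<epsilon>>0. \<exists>W. PBS_solution a \<nu> s \<epsilon> V0 T W \<and> (\<forall>t\<in>{0..T}. sobolev_norm a s (W t) \<le> M) \<and>
        (\<forall>W'. PBS_solution a \<nu> s \<epsilon> V0 T W' \<longrightarrow> (\<forall>t\<in>{0..T}. W' t = W t))"
      using assms(7,9,10) unfolding uniform_lifespan_def by blast
    have "\<forall>t\<in>{0..T}. sobolev_norm a s (V \<epsilon> t) \<le> M" if pos: "0 < \<epsilon>" for \<epsilon>
    proof -
      obtain W where W: "\<forall>t\<in>{0..T}. sobolev_norm a s (W t) \<le> M" "\<forall>t\<in>{0..T}. V \<epsilon> t = W t"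
        using M PBS[OF pos] pos by blast
      then show ?thesis by simp
    qed
    then show thesis by (rule that)
  qed
  let ?b = "a $ 3"
  define c where "c k m = vcoef a V0 (vertical_mode m) $ k" for k m
  note cw = vertical_modes_summable[OF a s V0, folded c_def]
  have cs: "(\<lambda>m. norm (c k m)) summable_on UNIV" for k
    by (rule summable_on_comparison_test[OF cw[of k]]) (auto simp: distrib_right)
  have modes: "vcoef a (U t) (vertical_mode m) $ k = (if k = 3 then 0
      else c k m * of_real (exp (- ((if k = 4 then 0 else \<nu> * (of_int m / ?b)\<^sup>2) * t))))" if "t \<in> {0..T}" for t m k
    unfolding c_def by (rule limit_vertical_modes[OF a \<nu> s assms(9,12) V0 PBS M assms(13) that])
  have UL2: "U t \<in> torus_L2 a" if "t \<in> {0..T}" for t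
    using assms(13) that by (auto simp: limit_point_at_zero_def sobolev_path_def sobolev_def)
  have V0L2: "V0 \<in> torus_L2 a" using V0 by (simp add: sobolev_def)
  define w where "w k = heat_series ?b \<nu> (c k)" for k :: 4
  define uh where "uh t z = Re (w 1 t z) *\<^sub>R axis 1 1 + Re (w 2 t z) *\<^sub>R (axis 2 1 :: real^2)" for t z
  have uh: "uh t z $ 1 = Re (w 1 t z)" "uh t z $ 2 = Re (w 2 t z)" for t z
    by (simp_all add: uh_def axis_def)
  have V0k: "AE z in lborel. complex_of_real (horizontal_average a V0 z $ k) = (\<Sum>\<^sub>\<infinity>m. c k m * cis (of_int m / ?b * z))" for k
    by (rule horizontal_average_eq_series[OF a V0L2 cs]) (simp add: c_def)
  have decay: "(\<lambda>m. norm (c k m * of_real (exp (- (\<nu> * (of_int m / ?b)\<^sup>2 * t))))) summable_on UNIV" if "t \<in> {0..T}" for k t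
    by (rule summable_on_comparison_test[OF cs[of k]])
      (use that \<nu> in \<open>auto simp: norm_mult intro!: mult_left_le\<close>)
  have Uk: "AE z in lborel. horizontal_average a (U t) z $ k = Re (w k t z)" if t: "t \<in> {0..T}" and k: "k = 1 \<or> k = 2" for t k
  proof -
    have "AE z in lborel. complex_of_real (horizontal_average a (U t) z $ k)
        = (\<Sum>\<^sub>\<infinity>m. c k m * of_real (exp (- (\<nu> * (of_int m / ?b)\<^sup>2 * t))) * cis (of_int m / ?b * z))"
      by (rule horizontal_average_eq_series[OF a UL2[OF t] decay[OF t]]) (use modes[OF t] k in auto)
    then show ?thesis
    proof eventually_elim
      case (elim z)
      from arg_cong[OF this, of Re] show ?case by (simp only: w_def heat_series_def Re_complex_of_real)
    qed
  qed
  have U3: "AE z in lborel. horizontal_average a (U t) z $ 3 = 0" if t: "t \<in> {0..T}" for t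
  proof -
    have "AE z in lborel. complex_of_real (horizontal_average a (U t) z $ 3) = (\<Sum>\<^sub>\<infinity>m. 0 * cis (of_int m / ?b * z))"
      by (rule horizontal_average_eq_series[OF a UL2[OF t]]) (use modes[OF t] in auto)
    then show ?thesis by eventually_elim simp
  qed
  have U4: "AE z in lborel. horizontal_average a (U t) z $ 4 = horizontal_average a V0 z $ 4" if t: "t \<in> {0..T}" for t
  proof -
    have "AE z in lborel. complex_of_real (horizontal_average a (U t) z $ 4) = (\<Sum>\<^sub>\<infinity>m. c 4 m * cis (of_int m / ?b * z))"
      by (rule horizontal_average_eq_series[OF a UL2[OF t] cs]) (use modes[OF t] in auto)
    with V0k[of 4] show ?thesis by eventually_elim (metis of_real_eq_iff)
  qed
  have "heat_solution_ae ?b \<nu> T uh"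
  proof -
    obtain wz1 wzz1 where w1: "\<And>t z. t \<in> {0..T} \<Longrightarrow> ((\<lambda>r. w 1 r z) has_vector_derivative of_real \<nu> * wzz1 t z) (at t within {0..T})"
      "\<And>t z. t \<in> {0..T} \<Longrightarrow> (w 1 t has_vector_derivative wz1 t z) (at z)"
      "\<And>t z. t \<in> {0..T} \<Longrightarrow> (wz1 t has_vector_derivative wzz1 t z) (at z)"
      "\<And>t z. w 1 t (z + 2 * pi * ?b) = w 1 t z"
      by (rule heat_series_derivatives[OF a[of 3] \<nu> cw[of 1], of T, folded w_def]) (rule that)
    obtain wz2 wzz2 where w2: "\<And>t z. t \<in> {0..T} \<Longrightarrow> ((\<lambda>r. w 2 r z) has_vector_derivative of_real \<nu> * wzz2 t z) (at t within {0..T})"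
      "\<And>t z. t \<in> {0..T} \<Longrightarrow> (w 2 t has_vector_derivative wz2 t z) (at z)"
      "\<And>t z. t \<in> {0..T} \<Longrightarrow> (wz2 t has_vector_derivative wzz2 t z) (at z)"
      "\<And>t z. w 2 t (z + 2 * pi * ?b) = w 2 t z"
      by (rule heat_series_derivatives[OF a[of 3] \<nu> cw[of 2], of T, folded w_def]) (rule that)
    define J where "J x y = Re x *\<^sub>R axis 1 1 + Re y *\<^sub>R (axis 2 1 :: real^2)" for x y
    have J: "((\<lambda>r. J (f r) (g r)) has_vector_derivative J f' g') F"
      if "(f has_vector_derivative f') F" "(g has_vector_derivative g') F" for f g f' g' F
      unfolding J_def
      by (intro has_vector_derivative_add
          bounded_linear.has_vector_derivative[OF bounded_linear_compose[OF bounded_linear_scaleR_left bounded_linear_Re]] that)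
    have uJ: "uh = (\<lambda>t z. J (w 1 t z) (w 2 t z))" by (simp add: fun_eq_iff uh_def J_def)
    have sc: "J (of_real \<nu> * x) (of_real \<nu> * y) = \<nu> *\<^sub>R J x y" for x y
      by (simp add: J_def scaleR_add_right)
    show ?thesis
      unfolding heat_solution_ae_def
    proof (intro conjI ballI allI exI)
      show "uh t (z + 2 * pi * ?b) = uh t z" for t z by (simp add: uJ w1(4) w2(4))
      fix t z assume t: "t \<in> {0..T}"
      show "((\<lambda>r. uh r z) has_vector_derivative (\<lambda>t z. \<nu> *\<^sub>R J (wzz1 t z) (wzz2 t z)) t z) (at t within {0..T})"
        using J[OF w1(1)[OF t] w2(1)[OF t]] by (simp add: uJ sc)
      show "(uh t has_vector_derivative (\<lambda>t z. J (wz1 t z) (wz2 t z)) t z) (at z)"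
        using J[OF w1(2)[OF t] w2(2)[OF t]] by (simp add: uJ)
      show "((\<lambda>t z. J (wz1 t z) (wz2 t z)) t has_vector_derivative (\<lambda>t z. J (wzz1 t z) (wzz2 t z)) t z) (at z)"
        using J[OF w1(3)[OF t] w2(3)[OF t]] by simp
    qed simp
  qed
  moreover have "AE z in lborel. horizontal_average a (U t) z =
      vector [uh t z $ 1, uh t z $ 2, 0, horizontal_average a V0 z $ 4]" if t: "t \<in> {0..T}" for t
    using Uk[OF t, of 1, simplified] Uk[OF t, of 2, simplified] U3[OF t] U4[OF t]
    by eventually_elim (simp add: vec_eq_iff forall_4 uh)
  moreover have "AE z in lborel. uh 0 z = vector [horizontal_average a V0 z $ 1, horizontal_average a V0 z $ 2]"
    using V0k[of 1] V0k[of 2]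
  proof eventually_elim
    case (elim z)
    have "w k 0 z = (\<Sum>\<^sub>\<infinity>m. c k m * cis (of_int m / ?b * z))" for k by (simp add: w_def heat_series_def)
    then have "w 1 0 z = complex_of_real (horizontal_average a V0 z $ 1)" "w 2 0 z = complex_of_real (horizontal_average a V0 z $ 2)"
      using elim by simp_all
    then show ?case by (simp add: vec_eq_iff forall_2 uh)
  qed
  ultimately show ?thesis by blast
qed

end
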